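(* Let $L$ be an operator of affine type on $M_+(E)$ with functions $F$ and $R$. Suppose an $M_+(E^\Delta)$-valued solution $(X_t)_{t\ge0}$ to the martingale problem for $L$ exists, on a filtered probability space $(\Omega,\mathcal F,(\mathcal F_t),\mathbb P)$. Let $g\in D_-$ and assume there is a function $t\mapsto\psi_t$ on $[0,T]$ with values in $D_-$ solving $\partial_t\psi_t=R(\psi_t)$, $\psi_0=g$, in the sense that $\langle\psi_t,\nu\rangle=\langle g,\nu\rangle+\int_0^t\langle R(\psi_s),\nu\rangle ds$ for all $\nu\in M_+(E^\Delta)$ and $t\in(0,T]$. Define $\phi_t=\int_0^tF(\psi_s)ds$ and suppose it takes values in $\mathbb R_-$. Then for all $0\le t\le T$, almost surely, \[\mathbb E[\exp(\langle g,X_T\rangle)\mid\mathcal F_t]=\exp(\phi_{T-t}+\langle\psi_{T-t},X_t\rangle).\]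
   Context: $E$ locally compact Polish, $E^\Delta$ one-point compactification; $M(E)$, $M_+(E)$, $M_+(E^\Delta)$ finite signed/non-negative measures with weak topology. $C_\Delta(E)=\{f|_E:f\in C(E^\Delta)\}$; $D\subseteq C_\Delta(E)$ dense linear subspace containing $1$; $D_-=\{g\in D:g\le0\}$. $\langle g,\nu\rangle=\int g\,d\nu$. $\mathcal D$ is the linear span of maps $\nu\mapsto\phi(\langle g_1,\nu\rangle,\dots,\langle g_m,\nu\rangle)$, $g_i\in D$, $\phi$ a polynomial or in $C_0^\infty(\mathbb R^m)$. A linear $L$ on $\mathcal D$ (with values in measurable maps on $M(E)$) is of affine type on $M_+(E)$ if there exist $F:D\to\mathbb R$, $R:D\to C_\Delta(E)$ with $L\exp(\langle g,\cdot\rangle)(\nu)=(F(g)+\langle R(g),\nu\rangle)\exp(\langle g,\nu\rangle)$ for all $g\in D_-$, $\nu\in M_+(E)$. An $M_+(E^\Delta)$-valued solution of the martingale problem for $L$ is a càdlàg $M_+(E^\Delta)$-valued adapted process with deterministic $X_0$ such that $f(X_t)-f(X_0)-\int_0^tLf(X_s)ds$ is a local martingale for all $f$ in the domain of $L$ (functions evaluated on $M_+(E^\Delta)$ by the same formulas). *)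

theory Defs
  imports "HOL-Analysis.Analysis" "HOL-Probability.Probability"
begin

text \<open>The one-point compactification E^Delta is represented by the type 'e option,
  with None playing the role of the point Delta at infinity.
  A finite non-negative Borel measure on E^Delta is represented by a pair (mu, c)
  where mu is a finite Borel measure on E (its restriction to E) and c >= 0 is the
  mass at Delta. M_+(E) corresponds to the pairs with c = 0.\<close>

type_synonym 'e dmeas = "'e measure \<times> real"

definition fin_meas :: "'e::topological_space measure \<Rightarrow> bool" where
  "fin_meas \<mu> \<longleftrightarrow> sets \<mu> = sets (borel :: 'e measure) \<and> finite_measure \<mu>"

definition Mplus_Delta :: "('e::topological_space) dmeas set" where
  "Mplus_Delta = {(\<mu>, c). fin_meas \<mu> \<and> 0 \<le> c}"

definition Mplus :: "('e::topological_space) dmeas set" where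
  "Mplus = {(\<mu>, c). fin_meas \<mu> \<and> c = 0}"

text \<open>Continuous functions on E^Delta: continuous on E and converging to the value
  at Delta outside compacts. (If E is compact, Delta is isolated and the value at
  Delta is unconstrained.) Functions in C_Delta(E) are identified with their unique
  continuous extension to E^Delta.\<close>
definition CDelta :: "('e::topological_space option \<Rightarrow> real) set" where
  "CDelta = {f. continuous_on UNIV (\<lambda>x. f (Some x)) \<and>
      (\<forall>\<epsilon>>0. \<exists>K. compact K \<and> (\<forall>x. x \<notin> K \<longrightarrow> \<bar>f (Some x) - f None\<bar> < \<epsilon>))}"

definition pair :: "('e::topological_space option \<Rightarrow> real) \<Rightarrow> 'e dmeas \<Rightarrow> real" where
  "pair f \<nu> = (\<integral>x. f (Some x) \<partial>(fst \<nu>)) + snd \<nu> * f None"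

definition dense_subspace :: "('e::topological_space option \<Rightarrow> real) set \<Rightarrow> bool" where
  "dense_subspace D \<longleftrightarrow> D \<subseteq> CDelta \<and> (\<lambda>_. 0) \<in> D \<and>
     (\<forall>f\<in>D. \<forall>g\<in>D. (\<lambda>x. f x + g x) \<in> D) \<and>
     (\<forall>a::real. \<forall>f\<in>D. (\<lambda>x. a * f x) \<in> D) \<and>
     (\<lambda>_. 1) \<in> D \<and>
     (\<forall>f\<in>CDelta. \<forall>\<epsilon>>0. \<exists>g\<in>D. \<forall>x. \<bar>f x - g x\<bar> < \<epsilon>)"

definition Dminus :: "('e option \<Rightarrow> real) set \<Rightarrow> ('e option \<Rightarrow> real) set" where
  "Dminus D = {g\<in>D. \<forall>x. g x \<le> 0}"

text \<open>R^m is represented as the subspace of nat => real (product topology) of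
  vectors vanishing from index m on.\<close>
definition Rm :: "nat \<Rightarrow> (nat \<Rightarrow> real) set" where
  "Rm m = {x. \<forall>i\<ge>m. x i = 0}"

definition vec_of :: "nat \<Rightarrow> (nat \<Rightarrow> real) \<Rightarrow> (nat \<Rightarrow> real)" where
  "vec_of m y = (\<lambda>i. if i < m then y i else 0)"

definition is_poly :: "nat \<Rightarrow> ((nat \<Rightarrow> real) \<Rightarrow> real) \<Rightarrow> bool" where
  "is_poly m \<phi> \<longleftrightarrow> (\<exists>A c. finite (A :: (nat \<Rightarrow> nat) set) \<and>
     (\<forall>x\<in>Rm m. \<phi> x = (\<Sum>\<alpha>\<in>A. c \<alpha> * (\<Prod>i<m. (x i) ^ (\<alpha> i)))))"

definition smooth_m :: "nat \<Rightarrow> ((nat \<Rightarrow> real) \<Rightarrow> real) \<Rightarrow> bool" where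
  "smooth_m m \<phi> \<longleftrightarrow> (\<exists>S. \<phi> \<in> S \<and> (\<forall>h\<in>S.
      continuous_on (Rm m) h \<and>
      (\<forall>i<m. \<exists>k\<in>S. \<forall>x\<in>Rm m.
          ((\<lambda>t. h (x(i := t))) has_real_derivative k x) (at (x i)))))"

definition Cc_inf :: "nat \<Rightarrow> ((nat \<Rightarrow> real) \<Rightarrow> real) \<Rightarrow> bool" where
  "Cc_inf m \<phi> \<longleftrightarrow> smooth_m m \<phi> \<and>
     (\<exists>B. \<forall>x\<in>Rm m. (\<exists>i<m. B < \<bar>x i\<bar>) \<longrightarrow> \<phi> x = 0)"

definition Dgen :: "('e::topological_space option \<Rightarrow> real) set \<Rightarrow> ('e dmeas \<Rightarrow> real) set" where
  "Dgen D = {(\<lambda>\<nu>. \<phi> (vec_of m (\<lambda>i. pair (gs i) \<nu>))) | \<phi> m gs.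
      (\<forall>i<m. gs i \<in> D) \<and> (is_poly m \<phi> \<or> Cc_inf m \<phi>)}"

definition DomD :: "('e::topological_space option \<Rightarrow> real) set \<Rightarrow> ('e dmeas \<Rightarrow> real) set" where
  "DomD D = {(\<lambda>\<nu>. \<Sum>i<n. a i * fs i \<nu>) | (n::nat) a fs. \<forall>i<n. fs i \<in> Dgen D}"

text \<open>Domain of L: \<open>\<D>\<close> together with the exponentials exp(<g,.>), g in D_-,
  on which L is evaluated in the affine-type condition.\<close>
definition DomL :: "('e::topological_space option \<Rightarrow> real) set \<Rightarrow> ('e dmeas \<Rightarrow> real) set" where
  "DomL D = DomD D \<union> {(\<lambda>\<nu>. exp (pair g \<nu>)) | g. g \<in> Dminus D}"

definition linear_on_Dom ::
  "('e::topological_space option \<Rightarrow> real) set \<Rightarrow> (('e dmeas \<Rightarrow> real) \<Rightarrow> ('e dmeas \<Rightarrow> real)) \<Rightarrow> bool" where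
  "linear_on_Dom D L \<longleftrightarrow> (\<forall>f\<in>DomD D. \<forall>h\<in>DomD D. \<forall>a b::real. \<forall>\<nu>\<in>Mplus_Delta.
      L (\<lambda>\<mu>. a * f \<mu> + b * h \<mu>) \<nu> = a * L f \<nu> + b * L h \<nu>)"

definition affine_type ::
  "('e::topological_space option \<Rightarrow> real) set \<Rightarrow> (('e dmeas \<Rightarrow> real) \<Rightarrow> ('e dmeas \<Rightarrow> real))
   \<Rightarrow> (('e option \<Rightarrow> real) \<Rightarrow> real) \<Rightarrow> (('e option \<Rightarrow> real) \<Rightarrow> ('e option \<Rightarrow> real)) \<Rightarrow> bool" where
  "affine_type D L F R \<longleftrightarrow> (\<forall>g\<in>D. R g \<in> CDelta) \<and>
     (\<forall>g\<in>Dminus D. \<forall>\<nu>\<in>Mplus_Delta.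
        L (\<lambda>\<mu>. exp (pair g \<mu>)) \<nu> = (F g + pair (R g) \<nu>) * exp (pair g \<nu>))"

definition filtration_on :: "'w measure \<Rightarrow> (real \<Rightarrow> 'w measure) \<Rightarrow> bool" where
  "filtration_on M Fl \<longleftrightarrow> (\<forall>t. subalgebra M (Fl t)) \<and> (\<forall>s t. s \<le> t \<longrightarrow> sets (Fl s) \<subseteq> sets (Fl t))"

definition is_stopping_time :: "(real \<Rightarrow> 'w measure) \<Rightarrow> ('w \<Rightarrow> ereal) \<Rightarrow> bool" where
  "is_stopping_time Fl \<tau> \<longleftrightarrow> (\<forall>t\<ge>0. {\<omega>\<in>space (Fl t). \<tau> \<omega> \<le> ereal t} \<in> sets (Fl t)) \<and>
     (\<forall>\<omega>. 0 \<le> \<tau> \<omega>)"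

definition stopped :: "(real \<Rightarrow> 'w \<Rightarrow> real) \<Rightarrow> ('w \<Rightarrow> ereal) \<Rightarrow> real \<Rightarrow> 'w \<Rightarrow> real" where
  "stopped Y \<tau> t \<omega> = (if \<tau> \<omega> \<le> ereal t then Y (real_of_ereal (\<tau> \<omega>)) \<omega> else Y t \<omega>)"

definition martingale :: "'w measure \<Rightarrow> (real \<Rightarrow> 'w measure) \<Rightarrow> (real \<Rightarrow> 'w \<Rightarrow> real) \<Rightarrow> bool" where
  "martingale M Fl Y \<longleftrightarrow> (\<forall>t\<ge>0. Y t \<in> borel_measurable (Fl t) \<and> integrable M (Y t)) \<and>
     (\<forall>s t. 0 \<le> s \<longrightarrow> s \<le> t \<longrightarrow> (AE \<omega> in M. real_cond_exp M (Fl s) (Y t) \<omega> = Y s \<omega>))"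

definition local_martingale :: "'w measure \<Rightarrow> (real \<Rightarrow> 'w measure) \<Rightarrow> (real \<Rightarrow> 'w \<Rightarrow> real) \<Rightarrow> bool" where
  "local_martingale M Fl Y \<longleftrightarrow> (\<forall>t\<ge>0. Y t \<in> borel_measurable (Fl t)) \<and>
     (\<exists>\<tau>::nat \<Rightarrow> 'w \<Rightarrow> ereal. (\<forall>n. is_stopping_time Fl (\<tau> n)) \<and>
        (\<forall>\<omega>\<in>space M. incseq (\<lambda>n. \<tau> n \<omega>)) \<and>
        (AE \<omega> in M. (\<lambda>n. \<tau> n \<omega>) \<longlonglongrightarrow> \<infinity>) \<and>
        (\<forall>n. martingale M Fl (stopped Y (\<tau> n))))"

text \<open>Cadlag in the weak topology of M_+(E^Delta): the weak topology is the coarsest one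
  making all pairings with continuous functions on E^Delta continuous.\<close>
definition cadlag_weak :: "(real \<Rightarrow> 'e::topological_space dmeas) \<Rightarrow> bool" where
  "cadlag_weak x \<longleftrightarrow> (\<forall>f\<in>CDelta.
      (\<forall>t\<ge>0. ((\<lambda>s. pair f (x s)) \<longlongrightarrow> pair f (x t)) (at_right t)) \<and>
      (\<forall>t>0. \<exists>l. ((\<lambda>s. pair f (x s)) \<longlongrightarrow> l) (at_left t)))"

definition mp_solution ::
  "('e::topological_space option \<Rightarrow> real) set \<Rightarrow> (('e dmeas \<Rightarrow> real) \<Rightarrow> ('e dmeas \<Rightarrow> real))
   \<Rightarrow> 'w measure \<Rightarrow> (real \<Rightarrow> 'w measure) \<Rightarrow> (real \<Rightarrow> 'w \<Rightarrow> 'e dmeas) \<Rightarrow> bool" where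
  "mp_solution D L M Fl X \<longleftrightarrow>
     (\<forall>t\<ge>0. \<forall>\<omega>\<in>space M. X t \<omega> \<in> Mplus_Delta) \<and>
     (\<forall>\<omega>\<in>space M. cadlag_weak (\<lambda>t. X t \<omega>)) \<and>
     (\<forall>t\<ge>0. \<forall>f\<in>CDelta. (\<lambda>\<omega>. pair f (X t \<omega>)) \<in> borel_measurable (Fl t)) \<and>
     (\<exists>x0. \<forall>\<omega>\<in>space M. X 0 \<omega> = x0) \<and>
     (\<forall>f\<in>DomL D.
        (\<forall>\<omega>\<in>space M. \<forall>t\<ge>0. set_integrable lborel {0..t} (\<lambda>s. L f (X s \<omega>))) \<and>
        local_martingale M Fl
          (\<lambda>t \<omega>. f (X t \<omega>) - f (X 0 \<omega>) - (\<integral>s\<in>{0..t}. L f (X s \<omega>) \<partial>lborel)))"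

end

theory Submission
  imports Defs
begin

text \<open>Write \<open>\<phi>\<^sub>t\<close> for the integral of \<open>F(\<psi>)\<close> over \<open>[0, t]\<close> and \<open>f\<^sub>s(\<nu>) = exp (\<phi>\<^sub>s + \<langle>\<psi>\<^sub>s, \<nu>\<rangle>)\<close>.
  The Riccati equation says \<open>\<partial>\<^sub>s f\<^sub>s = L f\<^sub>s\<close>, while the martingale problem says that
  \<open>\<partial>\<^sub>t E[1\<^sub>A f\<^sub>s(X\<^sub>t)] = E[1\<^sub>A L f\<^sub>s(X\<^sub>t)]\<close> for \<open>A \<in> F\<^sub>r\<close>, \<open>r \<le> t\<close>, so
  \<open>G(s, t) = E[1\<^sub>A f\<^sub>s(X\<^sub>t)]\<close> depends on \<open>s + t\<close> only; comparing \<open>(T - r, r)\<close> with \<open>(0, T)\<close> is the claim.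

  Two points need care. The total mass of \<open>X\<close> is not integrable, and the stopping times that
  localise depend on \<open>f\<^sub>s\<close>. Both are handled by the discount \<open>damp \<epsilon> t = exp (- \<epsilon> \<integral>\<^sub>0\<^sup>t \<langle>1, X\<^sub>u\<rangle> du)\<close>,
  which is adapted and continuous even though the filtration is not right-continuous, and under which
  the mass has finite total integral \<open>\<le> 1 / \<epsilon>\<close>; finally \<open>\<epsilon> \<rightarrow> 0\<close>. Moreover \<open>s \<mapsto> R(\<psi>\<^sub>s)\<close> is only
  weakly integrable. A uniform boundedness argument bounds \<open>\<integral> |\<langle>R(\<psi>\<^sub>s), \<nu>\<rangle>| ds\<close> by a multiple of
  the mass of \<open>\<nu>\<close>, which makes Fubini applicable.\<close>

section \<open>Indefinite Lebesgue integrals\<close>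

text \<open>Stopping when the mass itself exceeds a level is problematic: if the filtration is not
  right-continuous, such a time need not be a stopping time. The discount works instead because its
  density along a path is \<open>- \<epsilon> * mass * damp\<close>. So \<open>mass * damp\<close>
  is, up to the factor \<open>\<epsilon>\<close>, the rate at which a quantity falls from 1, while
  the drift \<open>(F \<psi> + pair (R \<psi>) X) * exp (pair \<psi> X)\<close> is at most affine in
  the mass. The cost is one extra drift term; over the whole interval it amounts to at most the
  expectation of \<open>1 - damp \<epsilon> T\<close>, which vanishes with \<open>\<epsilon>\<close>
  because every path has finite integrated mass. The Riccati equation concerns one fixed measure at
  a time, whereas the measure \<open>X u \<omega>\<close> varies with the scenario. Hence the need
  for a bound linear in the mass and for joint measurability of pairings in parameter, time and
  scenario. All derivatives exist only as integrable densities, so product and chain rule are proved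
  for indefinite Lebesgue integrals through Fubini's theorem.\<close>

lemma indefinite_integral_product:
  fixes p q :: "real \<Rightarrow> real"
  assumes p: "set_integrable lborel {0..t} p" and q: "set_integrable lborel {0..t} q"
  shows "set_integrable lborel {0..t} (\<lambda>s. p s * (\<integral>u\<in>{0..s}. q u \<partial>lborel))"
    and "(\<integral>s\<in>{0..t}. p s \<partial>lborel) * (\<integral>s\<in>{0..t}. q s \<partial>lborel) =
      (\<integral>s\<in>{0..t}. p s * (\<integral>u\<in>{0..s}. q u \<partial>lborel) \<partial>lborel) +
      (\<integral>s\<in>{0..t}. q s * (\<integral>u\<in>{0..s}. p u \<partial>lborel) \<partial>lborel)"
proof -
  define p' where "p' = (\<lambda>s. indicator {0..t} s * p s)"
  define q' where "q' = (\<lambda>s. indicator {0..t} s * q s)"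
  have p': "integrable lborel p'" and q': "integrable lborel q'"
    using p q by (simp_all add: p'_def q'_def set_integrable_def)
  note [measurable] = borel_measurable_integrable[OF p'] borel_measurable_integrable[OF q']
  have pq: "integrable (lborel \<Otimes>\<^sub>M lborel) (\<lambda>(a, b). p' a * q' b)"
    by (rule lborel_pair.Fubini_integrable)
      (use p' q' in \<open>auto simp: abs_mult\<close>)
  \<comment> \<open>The square is cut along the diagonal. Integrating the lower triangle first over
    \<open>b\<close> and the upper one first over \<open>a\<close> gives the two summands of the
    claim; in \<open>e2\<close> the closed interval \<open>{0..b}\<close> exceeds the true section
    by a null set.\<close>
  have lo: "integrable (lborel \<Otimes>\<^sub>M lborel) (\<lambda>(a, b). (if b \<le> a then p' a * q' b else 0))"
    by (rule Bochner_Integration.integrable_bound[OF pq])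
      (auto simp: split_beta' abs_mult split: split_indicator)
  have hi: "integrable (lborel \<Otimes>\<^sub>M lborel) (\<lambda>(a, b). (if a < b then p' a * q' b else 0))"
    by (rule Bochner_Integration.integrable_bound[OF pq])
      (auto simp: split_beta' abs_mult split: split_indicator)
  have e1: "(\<integral>b. (if b \<le> a then p' a * q' b else 0) \<partial>lborel) =
      indicator {0..t} a * (p a * (\<integral>u\<in>{0..a}. q u \<partial>lborel))" for a
  proof -
    have "(\<integral>b. (if b \<le> a then p' a * q' b else 0) \<partial>lborel)
        = (\<integral>b. p' a * (indicator {0..a} b * q b) \<partial>lborel)"
      by (rule Bochner_Integration.integral_cong)
        (auto simp: p'_def q'_def split: split_indicator)
    then show ?thesis
      by (simp add: p'_def set_lebesgue_integral_def)
  qed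
  have e2: "(\<integral>a. (if a < b then p' a * q' b else 0) \<partial>lborel) =
      indicator {0..t} b * (q b * (\<integral>u\<in>{0..b}. p u \<partial>lborel))" for b
  proof -
    have "(\<integral>a. (if a < b then p' a * q' b else 0) \<partial>lborel)
        = (\<integral>a. q' b * (indicator {0..b} a * p a) \<partial>lborel)"
    proof (rule integral_cong_AE)
      show "AE a in lborel. (if a < b then p' a * q' b else 0) = q' b * (indicator {0..b} a * p a)"
        using AE_lborel_singleton[of b]
        by eventually_elim (auto simp: p'_def q'_def split: split_indicator)
      \<comment> \<open>Only \<open>p'\<close> is known to be measurable. It may replace
        \<open>p\<close> here: either \<open>{0..b}\<close> is contained in \<open>{0..t}\<close>,
        or \<open>q' b = 0\<close> or \<open>{0..b}\<close> is empty.\<close>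
      have "(\<lambda>a. q' b * (indicator {0..b} a * p a)) = (\<lambda>a. q' b * (indicator {0..b} a * p' a))"
        by (auto simp: p'_def q'_def fun_eq_iff split: split_indicator)
      then show "(\<lambda>a. q' b * (indicator {0..b} a * p a)) \<in> borel_measurable lborel"
        by simp
    qed auto
    then show ?thesis
      by (simp add: q'_def set_lebesgue_integral_def)
  qed
  show "set_integrable lborel {0..t} (\<lambda>s. p s * (\<integral>u\<in>{0..s}. q u \<partial>lborel))"
    using lborel_pair.integrable_fst[OF lo] by (simp add: e1 set_integrable_def)
  have "(\<integral>s\<in>{0..t}. p s \<partial>lborel) * (\<integral>s\<in>{0..t}. q s \<partial>lborel)
      = (\<integral>a. (\<integral>b. p' a * q' b \<partial>lborel) \<partial>lborel)"
    by (simp add: p'_def q'_def set_lebesgue_integral_def)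
  also have "\<dots> = (\<integral>(a,b). p' a * q' b \<partial>(lborel \<Otimes>\<^sub>M lborel))"
    using lborel_pair.integral_fst[OF pq] by simp
  also have "\<dots> = (\<integral>x. (case x of (a,b) \<Rightarrow> (if b \<le> a then p' a * q' b else 0)) + (case x of (a,b) \<Rightarrow> (if a < b then p' a * q' b else 0)) \<partial>(lborel \<Otimes>\<^sub>M lborel))"
    by (rule Bochner_Integration.integral_cong) (auto split: split_indicator)
  also have "\<dots> = (\<integral>(a,b). (if b \<le> a then p' a * q' b else 0) \<partial>(lborel \<Otimes>\<^sub>M lborel)) +
      (\<integral>(a,b). (if a < b then p' a * q' b else 0) \<partial>(lborel \<Otimes>\<^sub>M lborel))"
    using lo hi by simp
  also have "(\<integral>(a,b). (if b \<le> a then p' a * q' b else 0) \<partial>(lborel \<Otimes>\<^sub>M lborel)) =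
      (\<integral>s\<in>{0..t}. p s * (\<integral>u\<in>{0..s}. q u \<partial>lborel) \<partial>lborel)"
    using lborel_pair.integral_fst[OF lo] by (simp add: e1 set_lebesgue_integral_def)
  also have "(\<integral>(a,b). (if a < b then p' a * q' b else 0) \<partial>(lborel \<Otimes>\<^sub>M lborel)) =
      (\<integral>s\<in>{0..t}. q s * (\<integral>u\<in>{0..s}. p u \<partial>lborel) \<partial>lborel)"
    using lborel_pair.integral_snd[OF hi] by (simp add: e2 set_lebesgue_integral_def)
  finally show "(\<integral>s\<in>{0..t}. p s \<partial>lborel) * (\<integral>s\<in>{0..t}. q s \<partial>lborel) =
      (\<integral>s\<in>{0..t}. p s * (\<integral>u\<in>{0..s}. q u \<partial>lborel) \<partial>lborel) +
      (\<integral>s\<in>{0..t}. q s * (\<integral>u\<in>{0..s}. p u \<partial>lborel) \<partial>lborel)" .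
qed

text \<open>Induction on \<open>n\<close>: the product rule is applied to \<open>p\<close> and
  \<open>p * P ^ n\<close>, where \<open>P\<close> is the primitive of \<open>p\<close>. The
  primitive of the second factor is given by the induction hypothesis, which is used at every
  smaller end point as well.\<close>

lemma indefinite_integral_power:
  fixes p :: "real \<Rightarrow> real"
  assumes "set_integrable lborel {0..t} p"
  shows "set_integrable lborel {0..t} (\<lambda>s. p s * (\<integral>u\<in>{0..s}. p u \<partial>lborel) ^ n)"
    and "(\<integral>s\<in>{0..t}. p s * (\<integral>u\<in>{0..s}. p u \<partial>lborel) ^ n \<partial>lborel) =
      (\<integral>u\<in>{0..t}. p u \<partial>lborel) ^ Suc n / real (Suc n)"
proof -
  let ?P = "\<lambda>s. \<integral>u\<in>{0..s}. p u \<partial>lborel"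
  have "set_integrable lborel {0..t} (\<lambda>s. p s * ?P s ^ n) \<and>
      (\<integral>s\<in>{0..t}. p s * ?P s ^ n \<partial>lborel) = ?P t ^ Suc n / real (Suc n)"
    if "set_integrable lborel {0..t} p" for t
    using that
  proof (induction n arbitrary: t)
    case 0
    then show ?case by simp
  next
    case (Suc n)
    have sub: "set_integrable lborel {0..s} p" if "s \<le> t" for s
      using that by (intro set_integrable_subset[OF Suc.prems]) auto
    have IH: "?P s ^ Suc n / real (Suc n) = (\<integral>u\<in>{0..s}. p u * ?P u ^ n \<partial>lborel)" if "s \<le> t" for s
      using Suc.IH[OF sub[OF that]] by simp
    have i1: "set_integrable lborel {0..t} (\<lambda>s. p s * ?P s ^ n)"
      using Suc by blast
    have 1: "set_integrable lborel {0..t} (\<lambda>s. p s * ?P s ^ Suc n)"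
    proof -
      have "set_integrable lborel {0..t} (\<lambda>s. real (Suc n) * (p s * (\<integral>u\<in>{0..s}. p u * ?P u ^ n \<partial>lborel)))"
        by (rule set_integrable_mult_right) (rule indefinite_integral_product(1)[OF Suc.prems i1])
      moreover have "indicator {0..t} s * (real (Suc n) * (p s * (\<integral>u\<in>{0..s}. p u * ?P u ^ n \<partial>lborel))) =
        indicator {0..t} s * (p s * ?P s ^ Suc n)" for s
        by (cases "s \<le> t") (auto simp: IH[symmetric] split: split_indicator)
      ultimately show ?thesis by (simp only: set_integrable_def real_scaleR_def)
    qed
    have "(\<integral>s\<in>{0..t}. p s \<partial>lborel) * (\<integral>s\<in>{0..t}. p s * ?P s ^ n \<partial>lborel) =
      (\<integral>s\<in>{0..t}. p s * (\<integral>u\<in>{0..s}. p u * ?P u ^ n \<partial>lborel) \<partial>lborel) +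
      (\<integral>s\<in>{0..t}. p s * ?P s ^ n * ?P s \<partial>lborel)"
      by (rule indefinite_integral_product(2)[OF Suc.prems i1])
    also have "(\<integral>s\<in>{0..t}. p s * (\<integral>u\<in>{0..s}. p u * ?P u ^ n \<partial>lborel) \<partial>lborel) =
       (\<integral>s\<in>{0..t}. p s * ?P s ^ Suc n / real (Suc n) \<partial>lborel)"
      by (rule set_lebesgue_integral_cong) (auto simp: IH[symmetric])
    also have "\<dots> = (\<integral>s\<in>{0..t}. p s * ?P s ^ Suc n \<partial>lborel) / real (Suc n)"
      by simp
    also have "(\<integral>s\<in>{0..t}. p s * ?P s ^ n * ?P s \<partial>lborel) = (\<integral>s\<in>{0..t}. p s * ?P s ^ Suc n \<partial>lborel)"
      by (simp add: mult_ac)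
    \<comment> \<open>The unknown integral now occurs with total factor
      \<open>1 + 1 / Suc n\<close>; solving for it gives the next power.\<close>
    finally have "?P t * (?P t ^ Suc n / real (Suc n)) =
      (\<integral>s\<in>{0..t}. p s * ?P s ^ Suc n \<partial>lborel) / real (Suc n) + (\<integral>s\<in>{0..t}. p s * ?P s ^ Suc n \<partial>lborel)"
      by (simp add: IH[symmetric])
    then have "(\<integral>s\<in>{0..t}. p s * ?P s ^ Suc n \<partial>lborel) = ?P t ^ Suc (Suc n) / real (Suc (Suc n))"
      by (simp add: field_simps)
    with 1 show ?case by blast
  qed
  with assms show "set_integrable lborel {0..t} (\<lambda>s. p s * ?P s ^ n)"
    "(\<integral>s\<in>{0..t}. p s * ?P s ^ n \<partial>lborel) = ?P t ^ Suc n / real (Suc n)" by blast+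
qed

text \<open>The chain rule for the exponential of an absolutely continuous function. The exponential
  series is integrated term by term; its terms are dominated by
  \<open>\<bar>p s\<bar> * B ^ n / fact n\<close>, where \<open>B\<close>, the L1 norm of
  \<open>p\<close>, bounds the primitive at all end points.\<close>

lemma indefinite_integral_exp:
  fixes p :: "real \<Rightarrow> real"
  assumes p: "set_integrable lborel {0..t} p"
  shows "set_integrable lborel {0..t} (\<lambda>s. p s * exp (\<integral>u\<in>{0..s}. p u \<partial>lborel))"
    and "(\<integral>s\<in>{0..t}. p s * exp (\<integral>u\<in>{0..s}. p u \<partial>lborel) \<partial>lborel) =
      exp (\<integral>u\<in>{0..t}. p u \<partial>lborel) - 1"
proof -
  let ?P = "\<lambda>s. \<integral>u\<in>{0..s}. p u \<partial>lborel"
  define B where "B = (\<integral>u\<in>{0..t}. \<bar>p u\<bar> \<partial>lborel)"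
  have absp: "set_integrable lborel {0..t} (\<lambda>s. \<bar>p s\<bar>)"
    using p by (rule set_integrable_abs)
  have P_le: "\<bar>?P s\<bar> \<le> B" if "s \<le> t" for s
  proof -
    have sub: "set_integrable lborel {0..s} p"
      using that by (intro set_integrable_subset[OF p]) auto
    have "\<bar>?P s\<bar> \<le> (\<integral>u\<in>{0..s}. \<bar>p u\<bar> \<partial>lborel)"
      using set_integral_norm_bound[OF sub] by simp
    also have "\<dots> \<le> B"
      unfolding B_def set_lebesgue_integral_def
      using set_integrable_subset[OF absp, of "{0..s}"] absp that
      by (intro integral_mono) (auto simp: set_integrable_def split: split_indicator)
    finally show ?thesis .
  qed
  define f where "f = (\<lambda>n s. indicator {0..t} s * (p s * ?P s ^ n) / fact n)"
  have fi: "integrable lborel (f n)" for n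
    using set_integrable_divide[OF indefinite_integral_power(1)[OF p, of n], of "fact n"]
    by (simp add: f_def set_integrable_def)
  have fs: "(\<lambda>n. f n s) sums (indicator {0..t} s * (p s * exp (?P s)))" for s
  proof -
    have "(\<lambda>n. (indicator {0..t} s * p s) * (?P s ^ n /\<^sub>R fact n)) sums ((indicator {0..t} s * p s) * exp (?P s))"
      by (rule sums_mult) (rule exp_converges)
    then show ?thesis by (simp add: f_def mult_ac divide_inverse)
  qed
  have fb: "norm (f n s) \<le> indicator {0..t} s * \<bar>p s\<bar> * (B ^ n / fact n)" for n s
  proof (cases "s \<in> {0..t}")
    case True
    then have "\<bar>?P s\<bar> ^ n \<le> B ^ n"
      by (intro power_mono P_le) auto
    then have "\<bar>p s\<bar> * \<bar>?P s\<bar> ^ n \<le> \<bar>p s\<bar> * B ^ n"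
      by (rule mult_left_mono) auto
    then show ?thesis using True
      by (simp add: f_def abs_mult power_abs divide_right_mono)
  qed (simp add: f_def)
  have sB: "summable (\<lambda>n. B ^ n / fact n)"
    using summable_exp_generic[of B] by (simp add: divide_inverse mult_ac)
  have fsum: "summable (\<lambda>n. norm (f n s))" for s
    by (rule summable_comparison_test'[OF summable_mult[OF sB], where N=0]) (subst real_norm_def, subst abs_norm_cancel, rule fb)
  have fisum: "summable (\<lambda>n. \<integral>s. norm (f n s) \<partial>lborel)"
  proof (rule summable_comparison_test'[where N=0 and g="\<lambda>n. B * (B ^ n / fact n)"])
    show "summable (\<lambda>n. B * (B ^ n / fact n))" using sB by (rule summable_mult)
    fix n
    have "(\<integral>s. norm (f n s) \<partial>lborel) \<le> (\<integral>s. indicator {0..t} s * \<bar>p s\<bar> * (B ^ n / fact n) \<partial>lborel)"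
      by (rule integral_mono[OF _ _ fb])
        (use fi absp in \<open>auto simp: set_integrable_def\<close>)
    also have "\<dots> = B * (B ^ n / fact n)"
      by (simp add: B_def set_lebesgue_integral_def)
    finally show "norm (\<integral>s. norm (f n s) \<partial>lborel) \<le> B * (B ^ n / fact n)" by simp
  qed
  have eq: "(\<Sum>n. f n s) = indicator {0..t} s * (p s * exp (?P s))" for s
    using fs by (simp add: sums_iff)
  show "set_integrable lborel {0..t} (\<lambda>s. p s * exp (?P s))"
    using integrable_suminf[OF fi _ fisum] fsum by (simp add: eq set_integrable_def)
  have "(\<lambda>n. \<integral>s. f n s \<partial>lborel) sums (\<integral>s. (\<Sum>n. f n s) \<partial>lborel)"
    by (rule sums_integral[OF fi _ fisum]) (rule AE_I2, rule fsum)
  moreover have "(\<integral>s. f n s \<partial>lborel) = ?P t ^ Suc n /\<^sub>R fact (Suc n)" for n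
  proof -
    have "(\<integral>s. f n s \<partial>lborel) = (\<integral>s\<in>{0..t}. p s * ?P s ^ n \<partial>lborel) / fact n"
      by (simp only: f_def set_lebesgue_integral_def real_scaleR_def integral_divide_zero)
    then show ?thesis
      by (simp add: indefinite_integral_power(2)[OF p] field_simps)
  qed
  moreover have "(\<lambda>n. ?P t ^ Suc n /\<^sub>R fact (Suc n)) sums (exp (?P t) - 1)"
    using exp_converges[of "?P t"] sums_Suc_iff[of "\<lambda>n. ?P t ^ n /\<^sub>R fact n"] by simp
  ultimately show "(\<integral>s\<in>{0..t}. p s * exp (?P s) \<partial>lborel) = exp (?P t) - 1"
    by (simp add: eq set_lebesgue_integral_def sums_iff)
qed

lemma set_integral_Icc_split:
  fixes f :: "real \<Rightarrow> real"
  assumes "0 \<le> r" "r \<le> t" and f: "set_integrable lborel {0..t} f"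
  shows "(\<integral>u\<in>{r..t}. f u \<partial>lborel) = (\<integral>u\<in>{0..t}. f u \<partial>lborel) - (\<integral>u\<in>{0..r}. f u \<partial>lborel)"
proof -
  have i: "set_integrable lborel {0..r} f" "set_integrable lborel {r..t} f"
    using assms by (auto intro: set_integrable_subset[OF f])
  have "(\<integral>u\<in>{0..t}. f u \<partial>lborel) = (\<integral>u\<in>{0..r} \<union> {r..t}. f u \<partial>lborel)"
    using assms(1,2) by (simp add: ivl_disj_un_two_touch(4))
  also have "\<dots> = (\<integral>u\<in>{0..r}. f u \<partial>lborel) + (\<integral>u\<in>{r..t}. f u \<partial>lborel)"
  proof (rule set_integral_Un_AE)
    show "AE x in lborel. \<not> (x \<in> {0..r} \<and> x \<in> {r..t})"
      using AE_lborel_singleton[of r] by eventually_elim auto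
  qed (use i in auto)
  finally show ?thesis by simp
qed

lemma (in prob_space) continuous_on_expectation:
  fixes f :: "real \<Rightarrow> 'a \<Rightarrow> real"
  assumes m: "\<And>x. x \<in> S \<Longrightarrow> f x \<in> borel_measurable M"
    and c: "\<And>\<omega>. \<omega> \<in> space M \<Longrightarrow> continuous_on S (\<lambda>x. f x \<omega>)"
    and b: "\<And>x \<omega>. x \<in> S \<Longrightarrow> \<omega> \<in> space M \<Longrightarrow> \<bar>f x \<omega>\<bar> \<le> C"
  shows "continuous_on S (\<lambda>x. \<integral>\<omega>. f x \<omega> \<partial>M)"
  unfolding continuous_on_sequentially o_def
proof (intro allI ballI impI, elim conjE)
  fix x a assume x: "\<forall>n. x n \<in> S" "x \<longlonglongrightarrow> a" and a: "a \<in> S"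
  show "(\<lambda>n. \<integral>\<omega>. f (x n) \<omega> \<partial>M) \<longlonglongrightarrow> (\<integral>\<omega>. f a \<omega> \<partial>M)"
  proof (rule integral_dominated_convergence[where w="\<lambda>_. C"])
    show "AE \<omega> in M. (\<lambda>n. f (x n) \<omega>) \<longlonglongrightarrow> f a \<omega>"
      using c a x unfolding continuous_on_sequentially o_def by (intro AE_I2) blast
  qed (use m b x a in auto)
qed

lemma set_integral_singleton: "(\<integral>u\<in>{a}. f u \<partial>lborel) = (0 :: real)" for a :: real
  unfolding set_lebesgue_integral_def
  by (rule integral_eq_zero_AE) (use AE_lborel_singleton[of a] in eventually_elim, simp)

text \<open>Turns an identity integrated over all initial intervals into a pointwise one. The
  derivative is taken within the closed interval, so that the right end point, where the result is
  applied later, is included.\<close>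

lemma set_integral_zero_imp_zero:
  fixes c :: "real \<Rightarrow> real"
  assumes c: "continuous_on {0..b} c" and "0 < b"
    and z: "\<And>x. x \<in> {0..b} \<Longrightarrow> (\<integral>u\<in>{0..x}. c u \<partial>lborel) = 0" and x: "x \<in> {0..b}"
  shows "c x = 0"
proof -
  have i: "set_integrable lborel {0..y} c" if "y \<in> {0..b}" for y
    by (rule borel_integrable_atLeastAtMost') (use that in \<open>auto intro: continuous_on_subset[OF c]\<close>)
  have "((\<lambda>y. integral {0..y} c) has_vector_derivative c x) (at x within {0..b})"
    by (rule integral_has_vector_derivative[OF c x])
  moreover have "integral {0..y} c = 0" if "y \<in> {0..b}" for y
    using set_borel_integral_eq_integral(2)[OF i[OF that]] z[OF that] by simp
  ultimately have "((\<lambda>y. 0) has_vector_derivative c x) (at x within {0..b})"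
    by (subst has_vector_derivative_transform[OF x, where f="\<lambda>y. integral {0..y} c"]) auto
  then show ?thesis
    using vector_derivative_unique_within_closed_interval[of 0 b x "\<lambda>_. 0" "c x" 0] \<open>0 < b\<close> x
    by (auto simp: has_vector_derivative_const)
qed

text \<open>The hypothesis forces \<open>h\<close> to be monotone, and the continuity of
  \<open>h\<close> serves as a modulus of continuity for \<open>f\<close>.\<close>

lemma continuous_on_dominated_increments:
  fixes f h :: "real \<Rightarrow> real"
  assumes h: "continuous_on S h" and f: "\<And>x y. x \<in> S \<Longrightarrow> y \<in> S \<Longrightarrow> x \<le> y \<Longrightarrow> \<bar>f y - f x\<bar> \<le> h y - h x"
  shows "continuous_on S f"
proof -
  have f': "\<bar>f y - f x\<bar> \<le> \<bar>h y - h x\<bar>" if "x \<in> S" "y \<in> S" for x y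
    using f[OF that] f[OF that(2,1)] by (cases x y rule: le_cases) auto
  show ?thesis unfolding continuous_on_def
  proof
    fix x assume x: "x \<in> S"
    have "((\<lambda>y. \<bar>h y - h x\<bar>) \<longlongrightarrow> \<bar>h x - h x\<bar>) (at x within S)"
      using h x unfolding continuous_on_def by (intro tendsto_intros) auto
    then have "((\<lambda>y. f y - f x) \<longlongrightarrow> 0) (at x within S)"
    proof (intro Lim_null_comparison[of "\<lambda>y. f y - f x" "\<lambda>y. \<bar>h y - h x\<bar>"])
      show "eventually (\<lambda>y. norm (f y - f x) \<le> \<bar>h y - h x\<bar>) (at x within S)"
        unfolding eventually_at_filter real_norm_def by (intro always_eventually allI impI f' x)
    qed simp
    then show "(f \<longlongrightarrow> f x) (at x within S)" by (rule LIM_zero_cancel)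
  qed
qed

section \<open>Measurability and functions on the one-point compactification\<close>

lemma dense_sequence:
  obtains d :: "nat \<Rightarrow> 'e::second_countable_topology"
  where "\<And>X. open X \<Longrightarrow> X \<noteq> {} \<Longrightarrow> \<exists>j. d j \<in> X"
proof -
  obtain D :: "'e set" where D: "countable D" "\<And>X. open X \<Longrightarrow> X \<noteq> {} \<Longrightarrow> \<exists>d\<in>D. d \<in> X"
    using countable_dense_setE by blast
  then show ?thesis
    by (intro that[of "from_nat_into D"]) (metis from_nat_into_surj)
qed

text \<open>The point \<open>x\<close> is replaced by the first member of a dense sequence within
  \<open>inverse (Suc n)\<close> of it. This makes the second argument countably valued, and the
  continuity of each \<open>h s\<close> recovers the limit.\<close>

lemma borel_measurable_caratheodory:
  fixes h :: "'s \<Rightarrow> 'e::{metric_space, second_countable_topology} \<Rightarrow> real"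
  assumes meas: "\<And>x. (\<lambda>s. h s x) \<in> borel_measurable S"
    and cont: "\<And>s. s \<in> space S \<Longrightarrow> continuous_on UNIV (h s)"
  shows "(\<lambda>(s, x). h s x) \<in> borel_measurable (S \<Otimes>\<^sub>M borel)"
proof -
  obtain d :: "nat \<Rightarrow> 'e" where d0: "\<And>X. open X \<Longrightarrow> X \<noteq> {} \<Longrightarrow> \<exists>j. d j \<in> X"
    using dense_sequence by blast
  have d: "\<exists>j. dist x (d j) < e" if "e > 0" for x e
    using d0[of "ball x e"] that by (auto simp: not_le)
  define j where "j = (\<lambda>n x. LEAST j. dist x (d j) < inverse (real (Suc n)))"
  have j: "dist x (d (j n x)) < inverse (real (Suc n))" for n x
    unfolding j_def by (rule LeastI_ex) (rule d, simp)
  have [measurable]: "j n \<in> measurable borel (count_space UNIV)" for n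
    unfolding j_def by measurable
  show ?thesis
  proof (rule borel_measurable_LIMSEQ_metric)
    fix n
    have "(\<lambda>p. h (fst p) (d (j n (snd p)))) \<in> borel_measurable (S \<Otimes>\<^sub>M borel)"
      by (intro measurable_compose_countable[where g="\<lambda>p. j n (snd p)" and f="\<lambda>i p. h (fst p) (d i)"]
          measurable_compose[OF measurable_fst meas]) measurable
    then show "(\<lambda>(s, x). h s (d (j n x))) \<in> borel_measurable (S \<Otimes>\<^sub>M borel)"
      by (simp add: split_beta')
  next
    fix p assume "p \<in> space (S \<Otimes>\<^sub>M (borel :: 'e measure))"
    then obtain s x where p: "p = (s, x)" "s \<in> space S" by (auto simp: space_pair_measure)
    have "(\<lambda>n. dist x (d (j n x))) \<longlonglongrightarrow> 0"
      by (rule tendsto_sandwich[OF _ _ tendsto_const LIMSEQ_inverse_real_of_nat])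
        (intro always_eventually allI zero_le_dist less_imp_le[OF j])+
    then have "(\<lambda>n. d (j n x)) \<longlonglongrightarrow> x"
      by (subst tendsto_dist_iff) (simp add: dist_commute)
    then have "(\<lambda>n. h s (d (j n x))) \<longlonglongrightarrow> h s x"
      using cont[OF p(2)] by (intro continuous_on_tendsto_compose[of UNIV "h s"]) auto
    then show "(\<lambda>n. case p of (s, x) \<Rightarrow> h s (d (j n x))) \<longlonglongrightarrow> (case p of (s, x) \<Rightarrow> h s x)"
      by (simp add: p)
  qed
qed

text \<open>Progressive measurability: clamping time to \<open>[0, u]\<close> means that only values
  up to \<open>u\<close> are read, so \<open>N\<close> may be the sigma-algebra of the filtration at
  time \<open>u\<close>.\<close>

lemma borel_measurable_right_continuous:
  fixes Y :: "real \<Rightarrow> 'w \<Rightarrow> real"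
  assumes meas: "\<And>v. 0 \<le> v \<Longrightarrow> v \<le> u \<Longrightarrow> Y v \<in> borel_measurable N"
    and u: "0 \<le> u"
    and rc: "\<And>v \<omega>. \<omega> \<in> space N \<Longrightarrow> 0 \<le> v \<Longrightarrow> v < u \<Longrightarrow> ((\<lambda>s. Y s \<omega>) \<longlongrightarrow> Y v \<omega>) (at_right v)"
  shows "(\<lambda>(v, \<omega>). Y (max 0 (min u v)) \<omega>) \<in> borel_measurable (borel \<Otimes>\<^sub>M N)"
proof (rule borel_measurable_LIMSEQ_metric)
  define c where "c = (\<lambda>v. max 0 (min u v))"
  have c: "0 \<le> c v" "c v \<le> u" for v using u by (auto simp: c_def)
  define k where "k = (\<lambda>n v. \<lfloor>real (Suc n) * v\<rfloor>)"
  \<comment> \<open>Floor plus one gives the next grid point strictly to the right of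
    \<open>v\<close>, so that right-continuity applies even when \<open>v\<close> itself lies on the
    grid. Clamping keeps the grid point inside \<open>[0, u]\<close>.\<close>
  define r where "r = (\<lambda>n (i::int). c ((of_int i + 1) / real (Suc n)))"
  have [measurable]: "k n \<in> measurable borel (count_space UNIV)" for n
    unfolding k_def by measurable
  fix n
  have "(\<lambda>p. Y (r n (k n (fst p))) (snd p)) \<in> borel_measurable (borel \<Otimes>\<^sub>M N)"
    by (intro measurable_compose_countable[where g="\<lambda>p. k n (fst p)" and f="\<lambda>i p. Y (r n i) (snd p)"])
      (use meas[OF c] in \<open>auto simp: r_def\<close>)
  then show "(\<lambda>(v::real, \<omega>). Y (max 0 (min u ((of_int \<lfloor>real (Suc n) * v\<rfloor> + 1) / real (Suc n)))) \<omega>) \<in> borel_measurable (borel \<Otimes>\<^sub>M N)"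
    by (simp add: split_beta' r_def k_def c_def)
next
  fix p :: "real \<times> 'w" assume "p \<in> space (borel \<Otimes>\<^sub>M N)"
  then obtain v \<omega> where p: "p = (v, \<omega>)" "\<omega> \<in> space N" by (auto simp: space_pair_measure)
  define c where "c = (\<lambda>v. max 0 (min u v))"
  define a where "a = (\<lambda>n. (of_int \<lfloor>real (Suc n) * v\<rfloor> + 1) / real (Suc n))"
  have a_gt: "v < a n" for n
    unfolding a_def by (simp add: field_simps) linarith
  have a_le: "a n \<le> v + inverse (real (Suc n))" for n
  proof -
    have "a n \<le> (real (Suc n) * v + 1) / real (Suc n)"
      unfolding a_def by (intro divide_right_mono add_right_mono of_int_floor_le) auto
    also have "\<dots> = v + inverse (real (Suc n))"
      by (simp add: add_divide_distrib inverse_eq_divide)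
    finally show ?thesis .
  qed
  have a_lim: "a \<longlonglongrightarrow> v"
    by (rule tendsto_sandwich[of "\<lambda>_. v" _ _ "\<lambda>n. v + inverse (real (Suc n))"])
      (use a_le LIMSEQ_inverse_real_of_nat_add[of v] in \<open>auto intro!: always_eventually less_imp_le[OF a_gt]\<close>)
  have "(\<lambda>n. Y (c (a n)) \<omega>) \<longlonglongrightarrow> Y (c v) \<omega>"
  proof (cases "0 \<le> v \<and> v < u")
    case True
    then have cv: "c v = v" by (simp add: c_def)
    have "(\<lambda>n. c (a n)) \<longlonglongrightarrow> c v" unfolding c_def
      by (intro tendsto_max tendsto_min tendsto_const a_lim)
    moreover have "c (a n) > v" for n using True a_gt[of n] by (auto simp: c_def)
    ultimately have "filterlim (\<lambda>n. c (a n)) (at_right v) sequentially"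
      by (auto simp: filterlim_at cv intro!: always_eventually)
    from filterlim_compose[OF rc[OF p(2)] this] True show ?thesis by (simp add: cv)
  next
    case False
    show ?thesis
    proof (cases "v < 0")
      case True
      have "eventually (\<lambda>n. a n < 0) sequentially"
        using a_lim True by (rule order_tendstoD)
      then have "eventually (\<lambda>n. Y (c v) \<omega> = Y (c (a n)) \<omega>) sequentially"
        by eventually_elim (use True in \<open>auto simp: c_def\<close>)
      then show ?thesis by (rule tendsto_eventually[OF eventually_mono]) auto
    next
      case False
      then have "u \<le> v" using \<open>\<not> (0 \<le> v \<and> v < u)\<close> by auto
      then have "c (a n) = c v" for n using a_gt[of n] by (auto simp: c_def)
      then show ?thesis by simp
    qed
  qed
  then show "(\<lambda>n. case p of (v::real, \<omega>) \<Rightarrow> Y (max 0 (min u ((of_int \<lfloor>real (Suc n) * v\<rfloor> + 1) / real (Suc n)))) \<omega>)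
      \<longlonglongrightarrow> (case p of (v::real, \<omega>) \<Rightarrow> Y (max 0 (min u v)) \<omega>)"
    by (simp add: p c_def a_def)
qed

section \<open>Functions in \<open>CDelta\<close> and their pairings with measures\<close>

lemma CDelta_continuous: "f \<in> CDelta \<Longrightarrow> continuous_on UNIV (\<lambda>x. f (Some x))"
  by (simp add: CDelta_def)

lemma CDelta_bounded:
  assumes "f \<in> CDelta"
  obtains B where "0 \<le> B" "\<And>x. \<bar>f x\<bar> \<le> B"
proof -
  obtain K where K: "compact K" "\<And>x. x \<notin> K \<Longrightarrow> \<bar>f (Some x) - f None\<bar> < 1"
    using assms unfolding CDelta_def mem_Collect_eq by (metis zero_less_one)
  have "compact ((\<lambda>x. f (Some x)) ` K)"
    using CDelta_continuous[OF assms] K(1) by (intro compact_continuous_image) (auto intro: continuous_on_subset)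
  then obtain b where b: "\<And>x. x \<in> K \<Longrightarrow> \<bar>f (Some x)\<bar> \<le> b"
    using compact_imp_bounded[of "(\<lambda>x. f (Some x)) ` K"] unfolding bounded_iff by auto
  have "\<bar>f x\<bar> \<le> max (\<bar>b\<bar> + 1) (\<bar>f None\<bar> + 1)" for x
  proof (cases x)
    case (Some y)
    then show ?thesis using b[of y] K(2)[of y] by (cases "y \<in> K") auto
  qed auto
  then show ?thesis by (intro that[of "max (\<bar>b\<bar> + 1) (\<bar>f None\<bar> + 1)"]) auto
qed

lemma CDelta_const: "(\<lambda>_. c) \<in> CDelta"
  by (auto simp: CDelta_def intro!: exI[of _ "{}"])

lemma Mplus_Delta_D:
  assumes "(\<mu>, c) \<in> Mplus_Delta"
  shows "finite_measure \<mu>" "sets \<mu> = sets borel" "space \<mu> = UNIV" "0 \<le> c"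
  using assms sets_eq_imp_space_eq[of \<mu> borel] by (auto simp: Mplus_Delta_def fin_meas_def)

lemma integrable_CDelta:
  assumes f: "f \<in> CDelta" and "(\<mu>, c) \<in> Mplus_Delta"
  shows "integrable \<mu> (\<lambda>x. f (Some x))"
proof -
  interpret finite_measure \<mu> using assms Mplus_Delta_D by blast
  obtain B where "\<And>x. \<bar>f x\<bar> \<le> B" using CDelta_bounded[OF f] by metis
  moreover have "(\<lambda>x. f (Some x)) \<in> borel_measurable \<mu>"
    using borel_measurable_continuous_onI[OF CDelta_continuous[OF f]] Mplus_Delta_D(2)[OF assms(2)]
    by (simp cong: measurable_cong_sets)
  ultimately show ?thesis by (intro integrable_const_bound[of _ B]) auto
qed

lemma pair_one_nonneg: "\<nu> \<in> Mplus_Delta \<Longrightarrow> 0 \<le> pair (\<lambda>_. 1) \<nu>"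
  by (cases \<nu>) (auto simp: pair_def dest: Mplus_Delta_D)

lemma abs_pair_le:
  assumes f: "f \<in> CDelta" and \<nu>: "\<nu> \<in> Mplus_Delta" and B: "\<And>x. \<bar>f x\<bar> \<le> B"
  shows "\<bar>pair f \<nu>\<bar> \<le> B * pair (\<lambda>_. 1) \<nu>"
proof (cases \<nu>)
  case (Pair \<mu> c)
  note \<mu> = \<nu>[unfolded Pair]
  interpret finite_measure \<mu> using \<mu> Mplus_Delta_D by blast
  have "\<bar>\<integral>x. f (Some x) \<partial>\<mu>\<bar> \<le> (\<integral>x. \<bar>f (Some x)\<bar> \<partial>\<mu>)" by simp
  also have "\<dots> \<le> (\<integral>x. B \<partial>\<mu>)"
    using integrable_CDelta[OF f \<mu>] B by (intro integral_mono) auto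
  also have "\<dots> = B * (\<integral>x. 1 \<partial>\<mu>)" by simp
  finally have 1: "\<bar>\<integral>x. f (Some x) \<partial>\<mu>\<bar> \<le> B * (\<integral>x. 1 \<partial>\<mu>)" .
  have 2: "\<bar>c * f None\<bar> \<le> B * c"
    using B[of None] Mplus_Delta_D(4)[OF \<mu>] by (simp add: abs_mult mult.commute[of B] mult_left_mono)
  show ?thesis
    using abs_triangle_ineq[of "\<integral>x. f (Some x) \<partial>\<mu>" "c * f None"] 1 2
    by (simp add: Pair pair_def algebra_simps)
qed

lemma pair_nonpos:
  assumes "\<And>x. f x \<le> 0" and "\<nu> \<in> Mplus_Delta"
  shows "pair f \<nu> \<le> 0"
proof (cases \<nu>)
  case (Pair \<mu> c)
  have "(\<integral>x. f (Some x) \<partial>\<mu>) \<le> 0"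
    using integral_nonneg_AE[of "\<lambda>x. - f (Some x)" \<mu>] assms(1) by simp
  moreover have "c * f None \<le> 0"
    using assms Pair Mplus_Delta_D(4)[of \<mu> c] by (simp add: mult_nonneg_nonpos)
  ultimately show ?thesis by (simp add: Pair pair_def)
qed

text \<open>One-sided limits bound \<open>f\<close> on either side of each point, and the value at
  the point bounds the rest of a neighbourhood. Compactness leaves finitely many local bounds, whose
  sum is a common bound.\<close>

lemma cadlag_bounded:
  fixes f :: "real \<Rightarrow> real"
  assumes r: "\<And>v. 0 \<le> v \<Longrightarrow> (f \<longlongrightarrow> f v) (at_right v)"
    and l: "\<And>v. 0 < v \<Longrightarrow> \<exists>l. (f \<longlongrightarrow> l) (at_left v)"
  obtains B where "\<And>v. v \<in> {0..t} \<Longrightarrow> \<bar>f v\<bar> \<le> B"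
proof -
  have "\<exists>U B. open U \<and> v \<in> U \<and> (\<forall>w\<in>U \<inter> {0..t}. \<bar>f w\<bar> \<le> B)" if v: "v \<in> {0..t}" for v
  proof -
    have "eventually (\<lambda>w. \<bar>f w\<bar> < \<bar>f v\<bar> + 1) (at_right v)"
      using v by (intro order_tendstoD(2)[OF tendsto_rabs[OF r]]) auto
    then obtain b where b: "v < b" "\<And>w. v < w \<Longrightarrow> w < b \<Longrightarrow> \<bar>f w\<bar> < \<bar>f v\<bar> + 1"
      by (auto simp: eventually_at_right_field)
    have "\<exists>a B. a < v \<and> (\<forall>w. a < w \<longrightarrow> w < v \<longrightarrow> 0 \<le> w \<longrightarrow> \<bar>f w\<bar> \<le> B)"
    proof (cases "v = 0")
      case True
      then show ?thesis by (intro exI[of _ "v - 1"]) auto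
    next
      case False
      then obtain l where l: "(f \<longlongrightarrow> l) (at_left v)" using assms(2)[of v] v by auto
      have "eventually (\<lambda>w. \<bar>f w\<bar> < \<bar>l\<bar> + 1) (at_left v)"
        by (rule order_tendstoD(2)[OF tendsto_rabs[OF l]]) simp
      then show ?thesis by (auto simp: eventually_at_left_field intro: less_imp_le)
    qed
    then obtain a B where a: "a < v" "\<And>w. a < w \<Longrightarrow> w < v \<Longrightarrow> 0 \<le> w \<Longrightarrow> \<bar>f w\<bar> \<le> B" by blast
    have "\<bar>f w\<bar> \<le> max B (\<bar>f v\<bar> + 1)" if "w \<in> {a<..<b} \<inter> {0..t}" for w
      using a(2)[of w] b(2)[of w] that by (cases w v rule: linorder_cases) auto
    then show ?thesis using a(1) b(1)
      by (intro exI[of _ "{a<..<b}"] exI[of _ "max B (\<bar>f v\<bar> + 1)"]) auto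
  qed
  then obtain U B where U: "\<And>v. v \<in> {0..t} \<Longrightarrow> open (U v)" "\<And>v. v \<in> {0..t} \<Longrightarrow> v \<in> U v"
    "\<And>v w. v \<in> {0..t} \<Longrightarrow> w \<in> U v \<inter> {0..t} \<Longrightarrow> \<bar>f w\<bar> \<le> B v"
    by metis
  obtain F where F: "F \<subseteq> {0..t}" "finite F" "{0..t} \<subseteq> (\<Union>v\<in>F. U v)"
    by (rule compactE_image[OF compact_Icc, of "{0..t}" U 0 t]) (use U in auto)
  have "\<bar>f v\<bar> \<le> (\<Sum>w\<in>F. \<bar>B w\<bar>)" if v: "v \<in> {0..t}" for v
  proof -
    obtain w where w: "w \<in> F" "v \<in> U w" using F(3) v by blast
    then have "\<bar>f v\<bar> \<le> \<bar>B w\<bar>" using U(3)[of w v] F(1) v by auto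
    also have "\<dots> \<le> (\<Sum>w\<in>F. \<bar>B w\<bar>)" using w(1) F(2) by (intro member_le_sum) auto
    finally show ?thesis .
  qed
  then show ?thesis by (rule that)
qed

text \<open>Testing with point masses, here at \<open>x\<close> and below at Delta, turns hypotheses
  on pairings into hypotheses on values; measurability and integrability of
  \<open>s \<mapsto> h s x\<close> are obtained in this way.\<close>

lemma dirac_Mplus_Delta:
  fixes x :: "'e::topological_space"
  shows "(return borel x, 0) \<in> Mplus_Delta"
    and "f \<in> CDelta \<Longrightarrow> pair f (return borel x, 0) = f (Some x)"
proof -
  show "(return borel x, 0) \<in> Mplus_Delta"
    using prob_space_return[of x borel] prob_space.finite_measure
    by (auto simp: Mplus_Delta_def fin_meas_def)
  show "pair f (return borel x, 0) = f (Some x)" if "f \<in> CDelta"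
    using borel_measurable_continuous_onI[OF CDelta_continuous[OF that]]
    by (simp add: pair_def integral_return)
qed

lemma dirac_infinity_Mplus_Delta:
  shows "(null_measure borel, 1) \<in> Mplus_Delta"
    and "pair f (null_measure borel, 1) = f None"
  by (auto simp: Mplus_Delta_def fin_meas_def pair_def intro!: finite_measureI)

section \<open>Compact sets in locally compact spaces\<close>

lemma ex_compact_nhd:
  fixes K :: "'e::topological_space set"
  assumes lc: "locally_compact_space (euclidean :: 'e topology)" and K: "compact K"
  obtains V C where "open V" "compact C" "K \<subseteq> V" "V \<subseteq> C"
proof -
  have "\<exists>U C. open U \<and> compact C \<and> x \<in> U \<and> U \<subseteq> C" for x :: 'e
    using lc by (simp add: locally_compact_space_def)
  then obtain U C where U: "\<And>x::'e. open (U x)" "\<And>x. compact (C x)" "\<And>x. x \<in> U x" "\<And>x. U x \<subseteq> C x"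
    by metis
  from K obtain F where "F \<subseteq> K" "finite F" "K \<subseteq> (\<Union>x\<in>F. U x)"
    by (rule compactE_image[of K K U]) (use U in auto)
  then show ?thesis
    by (intro that[of "\<Union>x\<in>F. U x" "\<Union>x\<in>F. C x"] open_UN compact_UN UN_mono ballI U) auto
qed

lemma compact_exhaustion:
  assumes lc: "locally_compact_space (euclidean :: 'e::second_countable_topology topology)"
  obtains A :: "nat \<Rightarrow> 'e::second_countable_topology set" where "\<And>n. compact (A n)" "incseq A" "(\<Union>n. A n) = UNIV"
proof -
  have "\<exists>U C. open U \<and> compact C \<and> x \<in> U \<and> U \<subseteq> C" for x :: 'e
    using lc by (simp add: locally_compact_space_def)
  then obtain U C where U: "\<And>x::'e. open (U x)" "\<And>x. compact (C x)" "\<And>x. x \<in> U x" "\<And>x. U x \<subseteq> C x"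
    by metis
  obtain F' where F': "F' \<subseteq> range U" "countable F'" "\<Union>F' = \<Union>(range U)"
    by (rule Lindelof[of "range U"]) (use U in auto)
  then obtain J where J: "countable J" "F' = U ` J"
    by (metis countable_subset_image)
  \<comment> \<open>\<open>from_nat_into\<close> enumerates nonempty sets only, and the cover is
    nonempty because a type has an element.\<close>
  have "\<Union>F' \<noteq> {}" unfolding F'(3) using U(3) by blast
  then have "J \<noteq> {}" using J by auto
  define A where "A = (\<lambda>n. \<Union>i\<le>n. C (from_nat_into J i))"
  show ?thesis
  proof (rule that)
    show "compact (A n)" for n unfolding A_def using U by (intro compact_UN) auto
    show "incseq A" unfolding incseq_def A_def by (intro allI impI UN_mono) auto
    show "(\<Union>n. A n) = UNIV"
    proof safe
      fix x
      have "x \<in> \<Union>F'" unfolding F'(3) using U(3)[of x] by blast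
      then obtain y where y: "y \<in> J" "x \<in> U y" using J by auto
      then obtain i where "from_nat_into J i = y" using from_nat_into_surj[OF J(1)] by metis
      then show "x \<in> (\<Union>n. A n)" using y U(4) by (auto simp: A_def)
    qed auto
  qed
qed

text \<open>Along an exhaustion every closed set is a countable union of compact ones. Compact sets
  form an intersection-stable generator whose indicators are limits of functions in
  \<open>CDelta\<close> vanishing at Delta, which makes them suitable for testing kernels.\<close>

lemma borel_eq_sigma_compact:
  assumes lc: "locally_compact_space (euclidean :: 'e::{t2_space, second_countable_topology} topology)"
  shows "sets (borel :: 'e::{t2_space, second_countable_topology} measure) = sigma_sets UNIV {K. compact K}"
proof
  interpret sigma_algebra UNIV "sigma_sets UNIV {K :: 'e set. compact K}"
    by (rule sigma_algebra_sigma_sets) auto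
  obtain A :: "nat \<Rightarrow> 'e set" where A: "\<And>n. compact (A n)" "(\<Union>n. A n) = UNIV"
    using compact_exhaustion[OF lc] by metis
  have "S \<in> sigma_sets UNIV {K. compact K}" if "closed S" for S :: "'e set"
  proof -
    have "(\<Union>n. S \<inter> A n) \<in> sigma_sets UNIV {K. compact K}"
      using A(1) that by (intro countable_UN) (auto intro!: sigma_sets.Basic closed_Int_compact)
    then show ?thesis using A(2) by (simp add: Int_UN_distrib[symmetric])
  qed
  then show "sets (borel :: 'e measure) \<subseteq> sigma_sets UNIV {K. compact K}"
    unfolding borel_eq_closed by (simp add: sets_measure_of_conv) (rule sigma_sets_mono, auto)
  show "sigma_sets UNIV {K :: 'e set. compact K} \<subseteq> sets borel"
    using sets.sigma_sets_subset[of "{K :: 'e set. compact K}" borel] by (auto intro: borel_compact)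
qed

text \<open>A quotient of distances is 1 on \<open>K\<close>, less than 1 off \<open>K\<close> and 0
  outside a relatively compact neighbourhood; its powers tend to the indicator and extend by 0 to
  Delta. Exponents start at 1 because the zeroth power would be the constant 1 on the space.\<close>

lemma compact_indicator_limit:
  fixes K :: "'e::metric_space set"
  assumes lc: "locally_compact_space (euclidean :: 'e topology)" and K: "compact K" "K \<noteq> {}"
  obtains f :: "'e \<Rightarrow> real"
  where "\<And>n. (\<lambda>x. case x of None \<Rightarrow> 0 | Some y \<Rightarrow> f y ^ Suc n) \<in> CDelta"
    "\<And>x. 0 \<le> f x" "\<And>x. f x \<le> 1" "\<And>x. (\<lambda>n. f x ^ Suc n) \<longlonglongrightarrow> indicator K x"
proof -
  obtain V C where V: "open V" "compact C" "K \<subseteq> V" "V \<subseteq> C" using ex_compact_nhd[OF lc K(1)] .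
  \<comment> \<open>\<open>infdist\<close> to the empty set is 0 by convention, which would destroy
    positivity when \<open>V\<close> is the whole space; the constant 1 is used in that
    case.\<close>
  define h where "h = (\<lambda>x. if - V = {} then 1 else infdist x (- V))"
  have cl: "closed K" "closed (- V)" using K V by (auto intro: compact_imp_closed)
  have h: "0 \<le> h x" "x \<notin> V \<Longrightarrow> h x = 0" "x \<in> K \<Longrightarrow> 0 < h x" for x
    using cl(2) V(3) infdist_pos_not_in_closed[of "- V" x] by (auto simp: h_def infdist_nonneg)
  have hc: "continuous_on UNIV h" unfolding h_def by (cases "- V = {}") (auto intro!: continuous_intros)
  have d: "0 \<le> infdist x K" "x \<in> K \<Longrightarrow> infdist x K = 0" "x \<notin> K \<Longrightarrow> 0 < infdist x K" for x
    using cl(1) K(2) infdist_pos_not_in_closed[of K x] by (auto simp: infdist_nonneg)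
  have pos: "0 < infdist x K + h x" for x
    using h[of x] d[of x] by (cases "x \<in> K") auto
  define f where "f = (\<lambda>x. h x / (infdist x K + h x))"
  have f0: "0 \<le> f x" "f x \<le> 1" for x using h(1)[of x] pos[of x] d(1)[of x] by (auto simp: f_def)
  have fc: "continuous_on UNIV f" unfolding f_def
    using pos by (intro continuous_intros hc) (metis less_irrefl)
  show ?thesis
  proof (rule that[of f])
    show "(\<lambda>n. f x ^ Suc n) \<longlonglongrightarrow> indicator K x" for x
    proof (cases "x \<in> K")
      case True
      then have "f x = 1" using pos[of x] d(2)[of x] by (simp add: f_def)
      then show ?thesis using True by simp
    next
      case False
      then have "f x < 1" using pos[of x] d(3)[of x] by (simp add: f_def)
      then show ?thesis using False f0[of x] by (simp add: LIMSEQ_Suc[OF LIMSEQ_power_zero] del: power_Suc)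
    qed
    show "(\<lambda>x. case x of None \<Rightarrow> 0 | Some y \<Rightarrow> f y ^ Suc n) \<in> CDelta" for n
    proof -
      have "f x = 0" if "x \<notin> C" for x using that V(4) h(2)[of x] by (auto simp: f_def)
      then show ?thesis unfolding CDelta_def
        using V(2) fc by (auto intro!: continuous_intros exI[of _ C] simp del: power_Suc)
    qed
  qed (use f0 in auto)
qed

text \<open>A pairing sees the part on the space and the atom at Delta together. Functions vanishing
  at Delta separate them: they give the measure of compact sets, an exhaustion gives the mass of the
  space, and the atom is what is left of the pairing with 1.\<close>

lemma emeasure_kernel_measurable:
  fixes \<xi> :: "'z \<Rightarrow> 'e::polish_space dmeas"
  assumes lc: "locally_compact_space (euclidean :: 'e topology)"
    and \<xi>: "\<And>z. z \<in> space Z \<Longrightarrow> \<xi> z \<in> Mplus_Delta"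
    and meas: "\<And>f. f \<in> CDelta \<Longrightarrow> (\<lambda>z. pair f (\<xi> z)) \<in> borel_measurable Z"
  shows "compact K \<Longrightarrow> (\<lambda>z. measure (fst (\<xi> z)) K) \<in> borel_measurable Z"
    and "(\<lambda>z. measure (fst (\<xi> z)) UNIV) \<in> borel_measurable Z"
    and "(\<lambda>z. snd (\<xi> z)) \<in> borel_measurable Z"
proof -
  have fm: "finite_measure (fst (\<xi> z))" "sets (fst (\<xi> z)) = sets borel" "space (fst (\<xi> z)) = UNIV"
    if "z \<in> space Z" for z
    using Mplus_Delta_D[of "fst (\<xi> z)" "snd (\<xi> z)"] \<xi>[OF that] by auto
  show cpt: "(\<lambda>z. measure (fst (\<xi> z)) K) \<in> borel_measurable Z" if K: "compact K" for K
  proof (cases "K = {}")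
    case False
    obtain f :: "'e \<Rightarrow> real" where f: "\<And>n. (\<lambda>x. case x of None \<Rightarrow> 0 | Some y \<Rightarrow> f y ^ Suc n) \<in> CDelta"
      "\<And>x. 0 \<le> f x" "\<And>x. f x \<le> 1" "\<And>x. (\<lambda>n. f x ^ Suc n) \<longlonglongrightarrow> indicator K x"
      using compact_indicator_limit[OF lc K False] by metis
    show ?thesis
    proof (rule borel_measurable_LIMSEQ_real)
      show "(\<lambda>z. pair (\<lambda>x. case x of None \<Rightarrow> 0 | Some y \<Rightarrow> f y ^ Suc n) (\<xi> z)) \<in> borel_measurable Z" for n
        by (rule meas[OF f(1)])
      fix z assume z: "z \<in> space Z"
      interpret finite_measure "fst (\<xi> z)" using fm[OF z] by simp
      have fmeas: "(\<lambda>y. f y ^ Suc n) \<in> borel_measurable (fst (\<xi> z))" for n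
        using borel_measurable_continuous_onI[OF CDelta_continuous[OF f(1)[of n]]] fm[OF z]
        by (simp cong: measurable_cong_sets)
      have "(\<lambda>n. \<integral>y. f y ^ Suc n \<partial>fst (\<xi> z)) \<longlonglongrightarrow> (\<integral>y. indicator K y \<partial>fst (\<xi> z))"
        by (rule integral_dominated_convergence[where w="\<lambda>_. 1"])
          (use f fmeas fm[OF z] borel_compact[OF K] in \<open>auto intro!: AE_I2 power_le_one simp del: power_Suc\<close>)
      also have "(\<integral>y. indicator K y \<partial>fst (\<xi> z)) = measure (fst (\<xi> z)) K"
        using fm[OF z] by simp
      finally show "(\<lambda>n. pair (\<lambda>x. case x of None \<Rightarrow> 0 | Some y \<Rightarrow> f y ^ Suc n) (\<xi> z)) \<longlonglongrightarrow> measure (fst (\<xi> z)) K"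
        by (simp add: pair_def del: power_Suc)
    qed
  qed simp
  obtain A :: "nat \<Rightarrow> 'e set" where A: "\<And>n. compact (A n)" "incseq A" "(\<Union>n. A n) = UNIV"
    using compact_exhaustion[OF lc] by blast
  show UN: "(\<lambda>z. measure (fst (\<xi> z)) UNIV) \<in> borel_measurable Z"
  proof (rule borel_measurable_LIMSEQ_real[OF _ cpt[OF A(1)]])
    fix z assume z: "z \<in> space Z"
    interpret finite_measure "fst (\<xi> z)" using fm[OF z] by simp
    show "(\<lambda>n. measure (fst (\<xi> z)) (A n)) \<longlonglongrightarrow> measure (fst (\<xi> z)) UNIV"
      using finite_Lim_measure_incseq[OF _ A(2)] A borel_compact[OF A(1)] fm(2)[OF z] by auto
  qed
  have "(\<lambda>z. pair (\<lambda>_. 1) (\<xi> z) - measure (fst (\<xi> z)) UNIV) \<in> borel_measurable Z"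
    by (intro borel_measurable_diff meas CDelta_const UN)
  moreover have "pair (\<lambda>_. 1) (\<xi> z) - measure (fst (\<xi> z)) UNIV = snd (\<xi> z)" if "z \<in> space Z" for z
    using fm[OF that] by (simp add: pair_def)
  ultimately show "(\<lambda>z. snd (\<xi> z)) \<in> borel_measurable Z"
    by (simp cong: measurable_cong)
qed

text \<open>Here the integrand varies with \<open>s\<close> and the measure with \<open>z\<close>.
  Continuity in the space variable makes \<open>h\<close> jointly measurable, and the random
  measure, once normalised, is a subprobability kernel, along which integration preserves
  measurability.\<close>

lemma pair_jointly_measurable:
  fixes \<xi> :: "'z \<Rightarrow> 'e::polish_space dmeas" and h :: "'s \<Rightarrow> 'e option \<Rightarrow> real"
  assumes lc: "locally_compact_space (euclidean :: 'e topology)"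
    and \<xi>: "\<And>z. z \<in> space Z \<Longrightarrow> \<xi> z \<in> Mplus_Delta"
    and meas: "\<And>f. f \<in> CDelta \<Longrightarrow> (\<lambda>z. pair f (\<xi> z)) \<in> borel_measurable Z"
    and h: "\<And>s. s \<in> space S \<Longrightarrow> h s \<in> CDelta"
    and hmeas: "\<And>\<nu>. \<nu> \<in> Mplus_Delta \<Longrightarrow> (\<lambda>s. pair (h s) \<nu>) \<in> borel_measurable S"
  shows "(\<lambda>(s, z). pair (h s) (\<xi> z)) \<in> borel_measurable (S \<Otimes>\<^sub>M Z)"
proof -
  have k: "compact K \<Longrightarrow> (\<lambda>z. measure (fst (\<xi> z)) K) \<in> borel_measurable Z"
    "(\<lambda>z. measure (fst (\<xi> z)) UNIV) \<in> borel_measurable Z"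
    "(\<lambda>z. snd (\<xi> z)) \<in> borel_measurable Z" for K
    using emeasure_kernel_measurable[of Z \<xi>, OF lc \<xi> meas] by blast+
  note [measurable] = k(2,3)
  have fm: "finite_measure (fst (\<xi> z))" "sets (fst (\<xi> z)) = sets borel" "space (fst (\<xi> z)) = UNIV"
    if "z \<in> space Z" for z
    using Mplus_Delta_D[of "fst (\<xi> z)" "snd (\<xi> z)"] \<xi>[OF that] by auto
  \<comment> \<open>Division by one plus the mass brings the total mass below 1 and is harmless for
    the zero measure.\<close>
  define m where "m = (\<lambda>z. 1 + measure (fst (\<xi> z)) UNIV)"
  have [measurable]: "m \<in> borel_measurable Z" unfolding m_def by measurable
  have m: "0 < m z" for z by (simp add: m_def add_pos_nonneg)
  define \<kappa> where "\<kappa> = (\<lambda>z. density (fst (\<xi> z)) (\<lambda>_. ennreal (1 / m z)))"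
  have \<kappa>em: "emeasure (\<kappa> z) A = ennreal (measure (fst (\<xi> z)) A / m z)"
    if "z \<in> space Z" "A \<in> sets borel" for z A
  proof -
    interpret finite_measure "fst (\<xi> z)" using fm[OF that(1)] by simp
    show ?thesis using that fm[OF that(1)] m[of z]
      by (simp add: \<kappa>_def emeasure_density_const emeasure_eq_measure ennreal_mult[symmetric])
  qed
  have [measurable]: "\<kappa> \<in> measurable Z (subprob_algebra borel)"
  proof (rule measurable_subprob_algebra_generated[OF borel_eq_sigma_compact[OF lc]])
    show "Int_stable {K :: 'e set. compact K}" by (auto simp: Int_stable_def)
    show "subprob_space (\<kappa> z)" if "z \<in> space Z" for z
    proof (rule subprob_spaceI)
      show "emeasure (\<kappa> z) (space (\<kappa> z)) \<le> 1"
        using \<kappa>em[OF that, of UNIV] fm[OF that] m[of z]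
        by (simp add: \<kappa>_def m_def ennreal_le_1)
    qed (use fm[OF that] in \<open>simp add: \<kappa>_def\<close>)
    show "sets (\<kappa> z) = sets borel" if "z \<in> space Z" for z
      using fm[OF that] by (simp add: \<kappa>_def)
    show "(\<lambda>z. emeasure (\<kappa> z) K) \<in> borel_measurable Z" if "K \<in> {K. compact K}" for K
    proof -
      have [measurable]: "(\<lambda>z. measure (fst (\<xi> z)) K) \<in> borel_measurable Z" using k(1) that by simp
      have "(\<lambda>z. ennreal (measure (fst (\<xi> z)) K / m z)) \<in> borel_measurable Z" by measurable
      then show ?thesis
        by (rule measurable_cong[THEN iffD1, rotated]) (simp add: \<kappa>em borel_compact[OF that[simplified]])
    qed
    have "(\<lambda>z. ennreal (measure (fst (\<xi> z)) UNIV / m z)) \<in> borel_measurable Z" by measurable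
    then show "(\<lambda>z. emeasure (\<kappa> z) UNIV) \<in> borel_measurable Z"
      by (rule measurable_cong[THEN iffD1, rotated]) (simp add: \<kappa>em)
  qed auto
  have hS: "(\<lambda>s. h s (Some x)) \<in> borel_measurable S" for x
    using hmeas[OF dirac_Mplus_Delta(1)[of x]]
    by (rule measurable_cong[THEN iffD1, rotated]) (rule dirac_Mplus_Delta(2)[OF h])
  have [measurable]: "(\<lambda>s. h s None) \<in> borel_measurable S"
    using hmeas[OF dirac_infinity_Mplus_Delta(1)] by (simp add: dirac_infinity_Mplus_Delta(2))
  have [measurable]: "(\<lambda>(s, x). h s (Some x)) \<in> borel_measurable (S \<Otimes>\<^sub>M borel)"
    by (rule borel_measurable_caratheodory[OF hS CDelta_continuous[OF h]])
  have "(\<lambda>q. case (fst (fst q), snd q) of (s, x) \<Rightarrow> h s (Some x)) \<in> borel_measurable ((S \<Otimes>\<^sub>M Z) \<Otimes>\<^sub>M borel)"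
    by measurable
  then have hm[measurable]: "(\<lambda>(p, x). h (fst p) (Some x)) \<in> borel_measurable ((S \<Otimes>\<^sub>M Z) \<Otimes>\<^sub>M borel)"
    by (simp add: split_beta')
  \<comment> \<open>Integration against a subprobability measure is measurable in the measure for a
    fixed function. The dependence of the integrand on \<open>p\<close> is therefore moved into the
    measure, by pushing it forward along \<open>x \<mapsto> (p, x)\<close>.\<close>
  note [measurable] = integral_measurable_subprob_algebra measurable_distr2
  have "(\<lambda>p. \<integral>q. (case q of (p, x) \<Rightarrow> h (fst p) (Some x)) \<partial>distr (\<kappa> (snd p)) ((S \<Otimes>\<^sub>M Z) \<Otimes>\<^sub>M borel) (\<lambda>x. (p, x)))
      \<in> borel_measurable (S \<Otimes>\<^sub>M Z)"
    by measurable
  then have "(\<lambda>p. m (snd p) * (\<integral>q. (case q of (p, x) \<Rightarrow> h (fst p) (Some x)) \<partial>distr (\<kappa> (snd p)) ((S \<Otimes>\<^sub>M Z) \<Otimes>\<^sub>M borel) (\<lambda>x. (p, x)))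
      + snd (\<xi> (snd p)) * h (fst p) None) \<in> borel_measurable (S \<Otimes>\<^sub>M Z)"
    by measurable
  moreover have "m (snd p) * (\<integral>q. (case q of (p, x) \<Rightarrow> h (fst p) (Some x)) \<partial>distr (\<kappa> (snd p)) ((S \<Otimes>\<^sub>M Z) \<Otimes>\<^sub>M borel) (\<lambda>x. (p, x)))
      + snd (\<xi> (snd p)) * h (fst p) None = pair (h (fst p)) (\<xi> (snd p))"
    if p: "p \<in> space (S \<Otimes>\<^sub>M Z)" for p
  proof -
    have z: "snd p \<in> space Z" and s: "fst p \<in> space S" using p by (auto simp: space_pair_measure)
    note b = borel_measurable_continuous_onI[OF CDelta_continuous[OF h[OF s]]]
    have "(\<integral>q. (case q of (p, x) \<Rightarrow> h (fst p) (Some x)) \<partial>distr (\<kappa> (snd p)) ((S \<Otimes>\<^sub>M Z) \<Otimes>\<^sub>M borel) (\<lambda>x. (p, x)))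
        = (\<integral>x. h (fst p) (Some x) \<partial>\<kappa> (snd p))"
    proof (subst integral_distr)
      have "sets (\<kappa> (snd p)) = sets borel" using fm[OF z] by (simp add: \<kappa>_def)
      moreover have "(\<lambda>x. (p, x)) \<in> measurable borel ((S \<Otimes>\<^sub>M Z) \<Otimes>\<^sub>M borel)" using p by measurable
      ultimately show "(\<lambda>x. (p, x)) \<in> measurable (\<kappa> (snd p)) ((S \<Otimes>\<^sub>M Z) \<Otimes>\<^sub>M borel)"
        by (simp cong: measurable_cong_sets)
    qed (simp_all add: hm)
    also have "\<dots> = (\<integral>x. h (fst p) (Some x) \<partial>fst (\<xi> (snd p))) / m (snd p)"
      unfolding \<kappa>_def using b fm[OF z] m[of "snd p"]
      by (subst integral_density) (auto cong: measurable_cong_sets)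
    finally show ?thesis using m[of "snd p"] by (simp add: pair_def)
  qed
  ultimately have "(\<lambda>p. pair (h (fst p)) (\<xi> (snd p))) \<in> borel_measurable (S \<Otimes>\<^sub>M Z)"
    by (rule measurable_cong[THEN iffD1, rotated])
  then show ?thesis by (simp add: split_beta')
qed

section \<open>Weakly integrable families\<close>

text \<open>The image of a weighted counting measure on the indices; repeated points simply add up
  their weights. These are the test measures of the boundedness argument below.\<close>

lemma weighted_dirac_sum:
  fixes x :: "nat \<Rightarrow> 'e::topological_space" and a :: "nat \<Rightarrow> real"
  assumes a: "\<And>i. 0 \<le> a i" "summable a"
  defines "\<nu> \<equiv> distr (density (count_space UNIV) (\<lambda>i. ennreal (a i))) borel x"
  shows "fin_meas \<nu>"
    and "\<lbrakk>f \<in> borel_measurable borel; \<And>y. \<bar>f y\<bar> \<le> B\<rbrakk> \<Longrightarrow> (\<lambda>i. a i * f (x i)) sums (\<integral>y. f y \<partial>\<nu>)"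
proof -
  have "emeasure \<nu> (space \<nu>) = (\<Sum>i. ennreal (a i))"
    by (simp add: \<nu>_def emeasure_distr emeasure_density nn_integral_count_space_nat)
  also have "\<dots> = ennreal (suminf a)"
    using a by (intro suminf_ennreal2) auto
  finally have "finite_measure \<nu>" by (intro finite_measureI) auto
  then show "fin_meas \<nu>" by (simp add: fin_meas_def \<nu>_def)
next
  assume f[measurable]: "f \<in> borel_measurable borel" and B: "\<And>y. \<bar>f y\<bar> \<le> B"
  have s: "summable (\<lambda>i. \<bar>a i * f (x i)\<bar>)"
    by (rule summable_comparison_test'[OF summable_mult[OF a(2), of B], where N=0])
      (use a(1) B in \<open>auto simp: abs_mult mult.commute[of B] intro: mult_left_mono\<close>)
  have "(\<integral>y. f y \<partial>\<nu>) = (\<integral>i. a i * f (x i) \<partial>count_space UNIV)"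
    using a(1) by (simp add: \<nu>_def integral_distr integral_density)
  also have "\<dots> = (\<Sum>i. a i * f (x i))"
    using s by (intro integral_count_space_nat) (auto simp: integrable_count_space_nat_iff)
  finally show "(\<lambda>i. a i * f (x i)) sums (\<integral>y. f y \<partial>\<nu>)"
    using s summable_rabs_cancel by (simp add: summable_sums)
qed

text \<open>A gliding hump: each new atom of the test measure is included or not according to which
  choice keeps the \<open>n\<close>-th truncated seminorm large, so that only positive measures are needed.\<close>

lemma weakly_integrable_imp_bounded:
  fixes k :: "'s \<Rightarrow> 'e::{metric_space, second_countable_topology} \<Rightarrow> real"
  assumes S: "finite_measure S"
    and cont: "\<And>s. s \<in> space S \<Longrightarrow> continuous_on UNIV (k s)"
    and bdd: "\<And>s. s \<in> space S \<Longrightarrow> \<exists>B. \<forall>x. \<bar>k s x\<bar> \<le> B"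
    and int: "\<And>\<nu>. fin_meas \<nu> \<Longrightarrow> integrable S (\<lambda>s. \<integral>x. k s x \<partial>\<nu>)"
  shows "\<exists>K. \<forall>x. (\<integral>s. \<bar>k s x\<bar> \<partial>S) \<le> K"
proof (rule ccontr)
  assume neg: "\<nexists>K. \<forall>x. (\<integral>s. \<bar>k s x\<bar> \<partial>S) \<le> K"
  interpret S: finite_measure S by fact
  have kint: "integrable S (\<lambda>s. k s x)" for x
  proof -
    have "fin_meas (return borel x)"
      unfolding fin_meas_def using prob_space_return[of x borel] prob_space.finite_measure by auto
    from int[OF this] have "integrable S (\<lambda>s. \<integral>y. k s y \<partial>return borel x)" .
    moreover have "(\<integral>y. k s y \<partial>return borel x) = k s x" if "s \<in> space S" for s
      using borel_measurable_continuous_onI[OF cont[OF that]] by (intro integral_return) auto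
    ultimately show ?thesis
      using Bochner_Integration.integrable_cong[of S S "\<lambda>s. \<integral>y. k s y \<partial>return borel x" "\<lambda>s. k s x"] by simp
  qed
  note [measurable] = borel_measurable_integrable[OF kint]
  obtain d :: "nat \<Rightarrow> 'e" where d: "\<And>X. open X \<Longrightarrow> X \<noteq> {} \<Longrightarrow> \<exists>j. d j \<in> X"
    using dense_sequence by blast
  \<comment> \<open>A supremum over all points is not obviously measurable in \<open>s\<close>. Over
    a dense sequence it is, and by continuity the bound extends to all points
    (\<open>GD\<close>).\<close>
  define G where "G = (\<lambda>m::nat. {s \<in> space S. \<forall>j. \<bar>k s (d j)\<bar> \<le> real m})"
  have G[measurable]: "G m \<in> sets S" for m
    unfolding G_def by measurable
  have GD: "\<bar>k s x\<bar> \<le> real m" if "s \<in> G m" for s m x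
  proof (rule ccontr)
    assume "\<not> \<bar>k s x\<bar> \<le> real m"
    have "open {y. real m < \<bar>k s y\<bar>}"
      using cont[of s] that by (intro open_Collect_less continuous_intros) (auto simp: G_def)
    moreover have "{y. real m < \<bar>k s y\<bar>} \<noteq> {}"
      using \<open>\<not> \<bar>k s x\<bar> \<le> real m\<close> unfolding not_le by blast
    ultimately obtain j where "real m < \<bar>k s (d j)\<bar>" using d by blast
    moreover have "\<bar>k s (d j)\<bar> \<le> real m" using that by (simp add: G_def)
    ultimately show False by simp
  qed
  have GI: "\<exists>m. \<forall>n\<ge>m. s \<in> G n" if "s \<in> space S" for s
  proof -
    obtain B where B: "\<And>x. \<bar>k s x\<bar> \<le> B" using bdd[OF \<open>s \<in> space S\<close>] by auto
    have "s \<in> G n" if "n \<ge> nat \<lceil>B\<rceil>" for n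
    proof -
      have "B \<le> real n" using that by linarith
      then have "\<bar>k s x\<bar> \<le> real n" for x by (rule order_trans[OF B])
      then show ?thesis using \<open>s \<in> space S\<close> by (simp add: G_def)
    qed
    then show ?thesis by blast
  qed
  \<comment> \<open>Truncation to \<open>G m\<close> makes the seminorm bounded in \<open>x\<close>,
    so that its supremum \<open>W m\<close> is finite and has near maximisers; as \<open>m\<close>
    grows the full L1 norm at \<open>x\<close> is recovered.\<close>
  define w where "w = (\<lambda>m x. \<integral>s. indicator (G m) s * \<bar>k s x\<bar> \<partial>S)"
  have gi: "integrable S (\<lambda>s. indicator (G m) s * \<bar>k s x\<bar>)" for m x
    by (rule Bochner_Integration.integrable_bound[OF kint[of x]]) (auto split: split_indicator)
  have w_nonneg: "0 \<le> w m x" for m x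
    unfolding w_def by (rule integral_nonneg_AE) (auto split: split_indicator)
  have w_lim: "(\<lambda>m. w m x) \<longlonglongrightarrow> (\<integral>s. \<bar>k s x\<bar> \<partial>S)" for x
    unfolding w_def
  proof (rule integral_dominated_convergence[where w="\<lambda>s. \<bar>k s x\<bar>"])
    show "AE s in S. (\<lambda>m. indicator (G m) s * \<bar>k s x\<bar>) \<longlonglongrightarrow> \<bar>k s x\<bar>"
    proof (rule AE_I2)
      fix s assume "s \<in> space S"
      then obtain m0 where "\<forall>n\<ge>m0. s \<in> G n" using GI by blast
      then have "eventually (\<lambda>m. indicator (G m) s * \<bar>k s x\<bar> = \<bar>k s x\<bar>) sequentially"
        unfolding eventually_sequentially by (intro exI[of _ m0]) simp
      then show "(\<lambda>m. indicator (G m) s * \<bar>k s x\<bar>) \<longlonglongrightarrow> \<bar>k s x\<bar>"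
        by (rule tendsto_eventually)
    qed
  qed (use kint in \<open>auto split: split_indicator\<close>)
  have w_bdd: "bdd_above (range (w m))" for m
  proof (rule bdd_aboveI2)
    fix x
    have "w m x \<le> (\<integral>s. real m \<partial>S)" unfolding w_def
      by (rule integral_mono[OF gi]) (auto split: split_indicator dest: GD)
    then show "w m x \<le> real m * measure S (space S)" by (simp add: mult.commute)
  qed
  define W where "W = (\<lambda>m. SUP x. w m x)"
  have w_le: "w m x \<le> W m" for m x
    unfolding W_def by (rule cSUP_upper[OF _ w_bdd]) simp
  \<comment> \<open>The assumed unboundedness passes to the truncated suprema, because
    \<open>w m x\<close> tends to the full norm. Finiteness of \<open>W m\<close> then yields a
    point reaching nine tenths of it.\<close>
  have ex: "\<exists>m x. C \<le> W m \<and> 9 / 10 * W m \<le> w m x" if "C > 0" for C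
  proof -
    obtain x where "C < (\<integral>s. \<bar>k s x\<bar> \<partial>S)" using neg by (meson not_le)
    then have "eventually (\<lambda>m. C < w m x) sequentially"
      using order_tendstoD(1)[OF w_lim] by blast
    then obtain m where m: "C < w m x" by (auto simp: eventually_sequentially)
    then have "C < W m" using w_le[of m x] by simp
    then have "9 / 10 * W m < W m" using that by simp
    then obtain y where "9 / 10 * W m < w m y" unfolding W_def
      using less_cSUP_iff[OF UNIV_not_empty w_bdd] by blast
    with \<open>C < W m\<close> show ?thesis by (intro exI[of _ m] exI[of _ y]) simp
  qed
  \<comment> \<open>With ratio 1/4 the weights after \<open>n\<close> sum to \<open>c n / 3\<close>.
    The final estimate then leaves \<open>(9/20 - 1/3) * c n * W (m n)\<close>, that is 7/60 of
    \<open>c n * W (m n)\<close>, which is at least \<open>Suc n\<close> because \<open>m n\<close>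
    is chosen with \<open>c n * W (m n)\<close> at least \<open>10 * Suc n\<close>.\<close>
  define c where "c = (\<lambda>n::nat. (1/4::real) ^ n)"
  have c: "c n > 0" for n by (simp add: c_def)
  have "\<exists>m x. 10 * real (Suc n) / c n \<le> W m \<and> 9 / 10 * W m \<le> w m x" for n
    by (rule ex) (use c[of n] in simp)
  then obtain m x where mW: "\<And>n. 10 * real (Suc n) / c n \<le> W (m n)"
      and mx: "\<And>n. 9 / 10 * W (m n) \<le> w (m n) (x n)"
    by metis
  define Q where "Q = (\<lambda>n (f :: 's \<Rightarrow> real). \<integral>s. indicator (G (m n)) s * \<bar>f s\<bar> \<partial>S)"
  define step where "step = (\<lambda>n f. c n * w (m n) (x n) / 2 \<le> Q n f)"
  define F where "F = rec_nat (\<lambda>s. 0) (\<lambda>n f. if step n f then f else (\<lambda>s. f s + c n * k s (x n)))"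
  define a where "a = (\<lambda>n. if step n (F n) then 0 else c n)"
  have F_Suc: "F (Suc n) = (\<lambda>s. F n s + a n * k s (x n))" for n
    by (simp add: F_def a_def)
  have F_eq: "F n s = (\<Sum>i<n. a i * k s (x i))" for n s
    proof (induction n)
    case 0
    show ?case by (simp add: F_def)
  qed (simp add: F_Suc)
  have Fint: "integrable S (F n)" for n
    unfolding F_eq[abs_def] using kint by auto
  have Qint: "integrable S (\<lambda>s. indicator (G l) s * \<bar>f s\<bar>)" if "integrable S f" for f :: "'s \<Rightarrow> real" and l
    using borel_measurable_integrable[OF that]
    by (intro Bochner_Integration.integrable_bound[OF that]) (auto split: split_indicator)
  \<comment> \<open>The two candidates \<open>F n\<close> and \<open>F n + c n * k (x n)\<close>
    differ by a function of seminorm \<open>c n * w (m n) (x n)\<close>. By the triangle inequality,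
    if the first falls short of half of that, the second reaches it.\<close>
  have F_large: "c n * w (m n) (x n) / 2 \<le> Q n (F (Suc n))" for n
  proof (cases "step n (F n)")
    case True
    then have "F (Suc n) = F n" by (simp add: F_Suc a_def)
    then show ?thesis using True by (simp add: step_def)
  next
    case False
    have Fs: "F (Suc n) s = F n s + c n * k s (x n)" for s using False by (simp add: F_Suc a_def)
    have "c n * w (m n) (x n) = (\<integral>s. c n * (indicator (G (m n)) s * \<bar>k s (x n)\<bar>) \<partial>S)"
      by (simp add: w_def)
    also have "\<dots> \<le> (\<integral>s. indicator (G (m n)) s * \<bar>F (Suc n) s\<bar> + indicator (G (m n)) s * \<bar>F n s\<bar> \<partial>S)"
    proof (rule integral_mono)
      fix s
      have "c n * \<bar>k s (x n)\<bar> = \<bar>F (Suc n) s - F n s\<bar>"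
        using c[of n] by (simp add: Fs abs_mult)
      also have "\<dots> \<le> \<bar>F (Suc n) s\<bar> + \<bar>F n s\<bar>" by (rule abs_triangle_ineq4)
      finally show "c n * (indicator (G (m n)) s * \<bar>k s (x n)\<bar>) \<le>
          indicator (G (m n)) s * \<bar>F (Suc n) s\<bar> + indicator (G (m n)) s * \<bar>F n s\<bar>"
        by (auto split: split_indicator)
    qed (use gi Qint Fint in auto)
    also have "\<dots> = Q n (F (Suc n)) + Q n (F n)"
      unfolding Q_def using Qint Fint by (intro Bochner_Integration.integral_add) auto
    finally show ?thesis using False by (simp add: step_def)
  qed
  have a: "0 \<le> a i" "a i \<le> c i" for i using c[of i] by (auto simp: a_def)
  have csum: "summable c" by (simp add: c_def summable_geometric)
  have asum: "summable a"
    by (rule summable_comparison_test'[OF csum, of 0]) (use a in auto)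
  define \<nu> where "\<nu> = distr (density (count_space UNIV) (\<lambda>i. ennreal (a i))) borel x"
  have \<nu>: "fin_meas \<nu>" unfolding \<nu>_def by (rule weighted_dirac_sum(1)[OF a(1) asum])
  define f where "f = (\<lambda>s. \<integral>y. k s y \<partial>\<nu>)"
  have fint: "integrable S f" unfolding f_def by (rule int[OF \<nu>])
  have fs: "(\<lambda>i. a i * k s (x i)) sums f s" if "s \<in> space S" for s
  proof -
    obtain B where "\<And>x. \<bar>k s x\<bar> \<le> B" using bdd[OF \<open>s \<in> space S\<close>] by auto
    then show ?thesis unfolding f_def \<nu>_def
      by (intro weighted_dirac_sum(2)[OF a(1) asum] borel_measurable_continuous_onI[OF cont[OF that]])
  qed
  have "real (Suc n) \<le> (\<integral>s. \<bar>f s\<bar> \<partial>S)" for n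
  proof -
    \<comment> \<open>A majorant for the atoms after \<open>n\<close>, restricted to
      \<open>G (m n)\<close>. There \<open>k\<close> is bounded by \<open>m n\<close>, so the series
      converges, and its integral is at most \<open>c n / 3 * W (m n)\<close> whatever the later
      choices are.\<close>
    define r where "r = (\<lambda>i s. c (i + Suc n) * (indicator (G (m n)) s * \<bar>k s (x (i + Suc n))\<bar>))"
    have rint: "integrable S (r i)" for i
      using integrable_mult_right[OF gi, of "c (i + Suc n)"] by (simp add: r_def)
    have r_integral: "(\<integral>s. r i s \<partial>S) = c (i + Suc n) * w (m n) (x (i + Suc n))" for i
      by (simp add: r_def w_def)
    have r_nonneg: "0 \<le> r i s" for i s using c[of "i + Suc n"] by (simp add: r_def)
    have csum': "(\<lambda>i. c (i + Suc n)) sums (c n / 3)"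
    proof -
      have "(\<lambda>i. (1/4) ^ Suc n * (1/4::real) ^ i) sums ((1/4) ^ Suc n * (1 / (1 - 1/4)))"
        by (intro sums_mult geometric_sums) simp
      then show ?thesis by (simp add: c_def power_add mult_ac)
    qed
    have r_le: "r i s \<le> c (i + Suc n) * real (m n)" for i s
      using c[of "i + Suc n"] GD[of s "m n"] by (auto simp: r_def split: split_indicator)
    have r_sum: "summable (\<lambda>i. norm (r i s))" for s
      by (rule summable_comparison_test'[OF summable_mult2[OF sums_summable[OF csum'], of "real (m n)"], of 0])
        (use r_nonneg r_le in auto)
    have ri_sum: "summable (\<lambda>i. c (i + Suc n) * W (m n))"
      by (rule summable_mult2[OF sums_summable[OF csum']])
    have ri_sum': "summable (\<lambda>i. \<integral>s. norm (r i s) \<partial>S)"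
      by (rule summable_comparison_test'[OF ri_sum, of 0])
        (use r_nonneg r_integral c w_le w_nonneg in \<open>auto intro!: mult_left_mono simp: less_imp_le\<close>)
    have R: "integrable S (\<lambda>s. \<Sum>i. r i s)"
      by (rule integrable_suminf[OF rint _ ri_sum']) (rule AE_I2, rule r_sum)
    have "(\<integral>s. (\<Sum>i. r i s) \<partial>S) = (\<Sum>i. \<integral>s. r i s \<partial>S)"
      by (rule integral_suminf[OF rint _ ri_sum']) (rule AE_I2, rule r_sum)
    also have "\<dots> \<le> (\<Sum>i. c (i + Suc n) * W (m n))"
      using ri_sum' r_nonneg by (intro suminf_le ri_sum) (auto simp: r_integral c less_imp_le w_le mult_left_mono)
    also have "\<dots> = c n / 3 * W (m n)"
      using sums_mult2[OF csum', of "W (m n)"] by (simp add: sums_iff)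
    finally have tail: "(\<integral>s. (\<Sum>i. r i s) \<partial>S) \<le> c n / 3 * W (m n)" .
    have "Q n (F (Suc n)) \<le> (\<integral>s. \<bar>f s\<bar> + (\<Sum>i. r i s) \<partial>S)"
      unfolding Q_def
    proof (rule integral_mono)
      fix s assume s: "s \<in> space S"
      have nonneg: "0 \<le> (\<Sum>i. r i s)" using r_sum[of s] r_nonneg by (intro suminf_nonneg) auto
      show "indicator (G (m n)) s * \<bar>F (Suc n) s\<bar> \<le> \<bar>f s\<bar> + (\<Sum>i. r i s)"
      proof (cases "s \<in> G (m n)")
        case True
        have "(\<lambda>i. a (i + Suc n) * k s (x (i + Suc n))) sums (f s - F (Suc n) s)"
          using sums_split_initial_segment[OF fs[OF s], of "Suc n"] by (simp only: F_eq)
        then have "\<bar>f s - F (Suc n) s\<bar> = \<bar>\<Sum>i. a (i + Suc n) * k s (x (i + Suc n))\<bar>"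
          by (simp add: sums_iff)
        also have "\<dots> \<le> (\<Sum>i. r i s)"
        proof -
          have le: "norm (a (i + Suc n) * k s (x (i + Suc n))) \<le> r i s" for i
            using True a[of "i + Suc n"] by (simp add: r_def abs_mult mult_right_mono)
          have "summable (\<lambda>i. r i s)" using r_sum[of s] r_nonneg by simp
          then show ?thesis
            using norm_suminf_le[OF le] by simp
        qed
        finally show ?thesis using True by simp
      qed (use nonneg in simp)
    qed (use Qint Fint fint R in auto)
    also have "\<dots> = (\<integral>s. \<bar>f s\<bar> \<partial>S) + (\<integral>s. (\<Sum>i. r i s) \<partial>S)"
      using fint R by simp
    also have "\<dots> \<le> (\<integral>s. \<bar>f s\<bar> \<partial>S) + c n / 3 * W (m n)"
      using tail by simp
    finally have "c n * w (m n) (x n) / 2 \<le> (\<integral>s. \<bar>f s\<bar> \<partial>S) + c n / 3 * W (m n)"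
      using F_large[of n] by simp
    moreover have "c n * (9 / 10 * W (m n)) \<le> c n * w (m n) (x n)"
      using mx[of n] c[of n] by (intro mult_left_mono) auto
    moreover have "10 * real (Suc n) \<le> c n * W (m n)"
      using mW[of n] c[of n] by (simp add: field_simps)
    ultimately show ?thesis by (simp add: field_simps)
  qed
  from this[of "nat \<lceil>\<integral>s. \<bar>f s\<bar> \<partial>S\<rceil>"] show False
    using real_nat_ceiling_ge[of "\<integral>s. \<bar>f s\<bar> \<partial>S"] unfolding of_nat_Suc by linarith
qed

text \<open>A bound on the L1 norms of \<open>s \<mapsto> h s x\<close> that is uniform in the point
  integrates against any measure by Fubini's theorem, which produces the linear dependence on the
  mass. Delta contributes one more number, hence the maximum in \<open>K'\<close>.\<close>

lemma pair_uniform_L1_bound: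
  fixes h :: "'s \<Rightarrow> 'e::polish_space option \<Rightarrow> real"
  assumes S: "finite_measure S"
    and h: "\<And>s. s \<in> space S \<Longrightarrow> h s \<in> CDelta"
    and int: "\<And>\<nu>. \<nu> \<in> Mplus_Delta \<Longrightarrow> integrable S (\<lambda>s. pair (h s) \<nu>)"
  shows "\<exists>K\<ge>0. \<forall>\<nu>\<in>Mplus_Delta. (\<integral>s. \<bar>pair (h s) \<nu>\<bar> \<partial>S) \<le> K * pair (\<lambda>_. 1) \<nu>"
proof -
  interpret S: finite_measure S by fact
  have hN: "integrable S (\<lambda>s. h s None)"
    using int[OF dirac_infinity_Mplus_Delta(1)] by (simp add: dirac_infinity_Mplus_Delta(2))
  have hS: "integrable S (\<lambda>s. h s (Some x))" for x
    using int[OF dirac_Mplus_Delta(1)[of x]]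
    by (rule Bochner_Integration.integrable_cong[THEN iffD1, OF refl, rotated]) (rule dirac_Mplus_Delta(2)[OF h])
  have "\<exists>K. \<forall>x. (\<integral>s. \<bar>h s (Some x)\<bar> \<partial>S) \<le> K"
  proof (rule weakly_integrable_imp_bounded[OF S CDelta_continuous[OF h]])
    show "\<exists>B. \<forall>x. \<bar>h s (Some x)\<bar> \<le> B" if "s \<in> space S" for s
      using CDelta_bounded[OF h[OF that]] by metis
    show "integrable S (\<lambda>s. \<integral>x. h s (Some x) \<partial>\<nu>)" if "fin_meas \<nu>" for \<nu>
      using int[of "(\<nu>, 0)"] that by (simp add: Mplus_Delta_def pair_def)
  qed
  then obtain K where K: "\<And>x. (\<integral>s. \<bar>h s (Some x)\<bar> \<partial>S) \<le> K" by auto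
  define K' where "K' = max K (\<integral>s. \<bar>h s None\<bar> \<partial>S)"
  have "0 \<le> (\<integral>s. \<bar>h s None\<bar> \<partial>S)" by (rule integral_nonneg_AE) auto
  then have K'0: "0 \<le> K'" unfolding K'_def by (rule max.coboundedI2)
  have KS: "(\<integral>s. \<bar>h s (Some x)\<bar> \<partial>S) \<le> K'" for x using K[of x] by (simp add: K'_def)
  have "(\<integral>s. \<bar>pair (h s) \<nu>\<bar> \<partial>S) \<le> K' * pair (\<lambda>_. 1) \<nu>" if \<nu>: "\<nu> \<in> Mplus_Delta" for \<nu>
  proof (cases \<nu>)
    case (Pair \<mu> c)
    note \<mu> = Mplus_Delta_D[OF \<nu>[unfolded Pair]]
    interpret \<mu>: finite_measure \<mu> by (rule \<mu>)
    interpret P: pair_sigma_finite S \<mu> ..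
    have "(\<lambda>(s, x). h s (Some x)) \<in> borel_measurable (S \<Otimes>\<^sub>M borel)"
      by (rule borel_measurable_caratheodory[OF borel_measurable_integrable[OF hS] CDelta_continuous[OF h]])
    then have hm[measurable]: "(\<lambda>(s, x). h s (Some x)) \<in> borel_measurable (S \<Otimes>\<^sub>M \<mu>)"
      using \<mu>(2) by (simp cong: measurable_cong_sets sets_pair_measure_cong)
    interpret Q: pair_sigma_finite \<mu> S ..
    have "integrable (\<mu> \<Otimes>\<^sub>M S) (\<lambda>(x, s). h s (Some x))"
    proof (rule Q.Fubini_integrable)
      show m: "(\<lambda>(x, s). h s (Some x)) \<in> borel_measurable (\<mu> \<Otimes>\<^sub>M S)"
        using measurable_pair_swap[OF hm] by (simp add: split_beta')
      have "(\<lambda>x. \<integral>s. norm (case (x, s) of (x, s) \<Rightarrow> h s (Some x)) \<partial>S) \<in> borel_measurable \<mu>"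
        using m by measurable
      then show "integrable \<mu> (\<lambda>x. \<integral>s. norm (case (x, s) of (x, s) \<Rightarrow> h s (Some x)) \<partial>S)"
        by (intro \<mu>.integrable_const_bound[of _ K'] AE_I2) (use KS in \<open>auto simp: integral_nonneg_AE\<close>)
    qed (use hS in auto)
    then have hi: "integrable (S \<Otimes>\<^sub>M \<mu>) (\<lambda>(s, x). h s (Some x))"
      using P.integrable_product_swap_iff[of "\<lambda>(s, x). h s (Some x)"] by (simp add: split_beta')
    then have hai: "integrable (S \<Otimes>\<^sub>M \<mu>) (\<lambda>(s, x). \<bar>h s (Some x)\<bar>)"
      using integrable_abs by (force simp: split_beta')
    have "(\<integral>s. \<bar>pair (h s) \<nu>\<bar> \<partial>S) \<le> (\<integral>s. (\<integral>x. \<bar>h s (Some x)\<bar> \<partial>\<mu>) + c * \<bar>h s None\<bar> \<partial>S)"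
    proof (rule integral_mono)
      show "integrable S (\<lambda>s. \<bar>pair (h s) \<nu>\<bar>)" using int[OF \<nu>] by simp
      show "integrable S (\<lambda>s. (\<integral>x. \<bar>h s (Some x)\<bar> \<partial>\<mu>) + c * \<bar>h s None\<bar>)"
        using P.integrable_fst[OF hai] hN by simp
      fix s
      have "\<bar>pair (h s) \<nu>\<bar> \<le> \<bar>\<integral>x. h s (Some x) \<partial>\<mu>\<bar> + \<bar>c * h s None\<bar>"
        unfolding Pair pair_def by simp
      also have "\<dots> \<le> (\<integral>x. \<bar>h s (Some x)\<bar> \<partial>\<mu>) + c * \<bar>h s None\<bar>"
        using \<mu>(4) by (simp add: abs_mult)
      finally show "\<bar>pair (h s) \<nu>\<bar> \<le> (\<integral>x. \<bar>h s (Some x)\<bar> \<partial>\<mu>) + c * \<bar>h s None\<bar>" .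
    qed
    also have "\<dots> = (\<integral>s. (\<integral>x. \<bar>h s (Some x)\<bar> \<partial>\<mu>) \<partial>S) + c * (\<integral>s. \<bar>h s None\<bar> \<partial>S)"
      using P.integrable_fst[OF hai] hN by simp
    also have "(\<integral>s. (\<integral>x. \<bar>h s (Some x)\<bar> \<partial>\<mu>) \<partial>S) = (\<integral>x. (\<integral>s. \<bar>h s (Some x)\<bar> \<partial>S) \<partial>\<mu>)"
      using P.Fubini_integral[OF hai] by simp
    also have "\<dots> \<le> (\<integral>x. K' \<partial>\<mu>)"
      using P.integrable_snd[OF hai] KS by (intro integral_mono) auto
    also have "c * (\<integral>s. \<bar>h s None\<bar> \<partial>S) \<le> c * K'"
      using \<mu>(4) by (intro mult_left_mono) (auto simp: K'_def)
    finally show ?thesis by (simp add: Pair pair_def algebra_simps)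
  qed
  with K'0 show ?thesis by blast
qed

section \<open>Discounted martingales\<close>

text \<open>Integration by parts \<open>\<integral> V dY = [Y V] - \<integral> Y dV\<close> for a martingale against an absolutely
  continuous adapted \<open>V\<close> reduces to Fubini and \<open>E[Y\<^sub>t | F\<^sub>u] = Y\<^sub>u\<close>.\<close>

lemma martingale_weighted_integral:
  fixes Y :: "real \<Rightarrow> 'w \<Rightarrow> real"
  assumes P: "prob_space M" and filt: "filtration_on M Fl" and Y: "martingale M Fl Y"
    and rc: "\<And>v \<omega>. \<omega> \<in> space M \<Longrightarrow> 0 \<le> v \<Longrightarrow> ((\<lambda>s. Y s \<omega>) \<longlongrightarrow> Y v \<omega>) (at_right v)"
    and r: "0 \<le> r" "r \<le> t" and A: "A \<in> sets (Fl r)"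
    and vm[measurable]: "(\<lambda>(u, \<omega>). v u \<omega>) \<in> borel_measurable (borel \<Otimes>\<^sub>M M)"
    and va: "\<And>u. r \<le> u \<Longrightarrow> u \<le> t \<Longrightarrow> v u \<in> borel_measurable (Fl u)"
    and vi: "\<And>\<omega>. \<omega> \<in> space M \<Longrightarrow> set_integrable lborel {r..t} (\<lambda>u. v u \<omega>)"
    and vB: "\<And>\<omega>. \<omega> \<in> space M \<Longrightarrow> (\<integral>u\<in>{r..t}. \<bar>v u \<omega>\<bar> \<partial>lborel) \<le> B"
  shows "integrable M (\<lambda>\<omega>. indicator A \<omega> * (\<integral>u\<in>{r..t}. Y u \<omega> * v u \<omega> \<partial>lborel))"
    and "(\<integral>\<omega>. indicator A \<omega> * (\<integral>u\<in>{r..t}. Y u \<omega> * v u \<omega> \<partial>lborel) \<partial>M) =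
      (\<integral>\<omega>. indicator A \<omega> * Y t \<omega> * (\<integral>u\<in>{r..t}. v u \<omega> \<partial>lborel) \<partial>M)"
proof -
  interpret prob_space M by fact
  interpret P: pair_sigma_finite M lborel ..
  interpret Q: pair_sigma_finite lborel M ..
  have sub: "subalgebra M (Fl u)" "sets (Fl r) \<subseteq> sets (Fl u)" if "r \<le> u" for u
    using filt that by (auto simp: filtration_on_def)
  have A'[measurable]: "A \<in> sets M" using A sub(1)[of r] by (auto simp: subalgebra_def)
  have Yt: "integrable M (Y t)" and Ya: "\<And>u. 0 \<le> u \<Longrightarrow> Y u \<in> borel_measurable (Fl u)"
    and Yc: "\<And>u. 0 \<le> u \<Longrightarrow> u \<le> t \<Longrightarrow> AE \<omega> in M. real_cond_exp M (Fl u) (Y t) \<omega> = Y u \<omega>"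
    using Y r by (auto simp: martingale_def)
  have YM: "Y u \<in> borel_measurable M" if "0 \<le> u" for u
    using measurable_from_subalg[OF _ Ya[OF that]] filt by (simp add: filtration_on_def)
  note [measurable] = borel_measurable_integrable[OF Yt]
  define Yc' where "Yc' = (\<lambda>u \<omega>. Y (max 0 (min t u)) \<omega>)"
  have [measurable]: "(\<lambda>(u, \<omega>). Yc' u \<omega>) \<in> borel_measurable (borel \<Otimes>\<^sub>M M)"
    unfolding Yc'_def by (rule borel_measurable_right_continuous) (use r rc YM in auto)
  \<comment> \<open>\<open>\<Phi>\<close> carries the terminal value \<open>Y t\<close>,
    \<open>\<Psi>\<close> the running value. Joint integrability of \<open>\<Phi>\<close> follows
    from the bound \<open>B\<close> on the weights; that of \<open>\<Psi>\<close> has to be obtained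
    by comparison with \<open>\<Phi>\<close>.\<close>
  define \<Phi> where "\<Phi> = (\<lambda>u \<omega>. indicator {r..t} u * (indicator A \<omega> * Y t \<omega> * v u \<omega>))"
  define \<Psi> where "\<Psi> = (\<lambda>u \<omega>. indicator {r..t} u * (indicator A \<omega> * Yc' u \<omega> * v u \<omega>))"
  have [measurable]: "(\<lambda>(u, \<omega>). \<Phi> u \<omega>) \<in> borel_measurable (lborel \<Otimes>\<^sub>M M)"
    "(\<lambda>(u, \<omega>). \<Psi> u \<omega>) \<in> borel_measurable (lborel \<Otimes>\<^sub>M M)"
    unfolding \<Phi>_def \<Psi>_def by measurable
  have [measurable]: "(\<lambda>(\<omega>, u). \<Phi> u \<omega>) \<in> borel_measurable (M \<Otimes>\<^sub>M lborel)"
    unfolding \<Phi>_def by measurable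
  have \<Phi>_eq: "\<Phi> u \<omega> = (indicator A \<omega> * Y t \<omega>) * (indicator {r..t} u * v u \<omega>)" for u \<omega>
    by (simp add: \<Phi>_def)
  have "integrable (M \<Otimes>\<^sub>M lborel) (\<lambda>(\<omega>, u). \<Phi> u \<omega>)"
  proof (rule P.Fubini_integrable)
    show "AE \<omega> in M. integrable lborel (\<lambda>u. case (\<omega>, u) of (\<omega>, u) \<Rightarrow> \<Phi> u \<omega>)"
      using vi by (intro AE_I2) (auto simp: \<Phi>_eq set_integrable_def)
    show "integrable M (\<lambda>\<omega>. \<integral>u. norm (case (\<omega>, u) of (\<omega>, u) \<Rightarrow> \<Phi> u \<omega>) \<partial>lborel)"
    proof (rule Bochner_Integration.integrable_bound)
      show "integrable M (\<lambda>\<omega>. B * Y t \<omega>)" using Yt by simp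
      show "AE \<omega> in M. norm (\<integral>u. norm (case (\<omega>, u) of (\<omega>, u) \<Rightarrow> \<Phi> u \<omega>) \<partial>lborel) \<le> norm (B * Y t \<omega>)"
      proof (rule AE_I2)
        fix \<omega> assume \<omega>: "\<omega> \<in> space M"
        have "0 \<le> (\<integral>u. indicator {r..t} u * \<bar>v u \<omega>\<bar> \<partial>lborel)" by (rule integral_nonneg_AE) auto
        moreover have "(\<integral>u. indicator {r..t} u * \<bar>v u \<omega>\<bar> \<partial>lborel) \<le> B"
          using vB[OF \<omega>] by (simp add: set_lebesgue_integral_def)
        moreover have "(\<integral>u. norm (\<Phi> u \<omega>) \<partial>lborel) = \<bar>indicator A \<omega> * Y t \<omega>\<bar> * (\<integral>u. indicator {r..t} u * \<bar>v u \<omega>\<bar> \<partial>lborel)"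
          by (simp add: \<Phi>_eq abs_mult)
        ultimately show "norm (\<integral>u. norm (case (\<omega>, u) of (\<omega>, u) \<Rightarrow> \<Phi> u \<omega>) \<partial>lborel) \<le> norm (B * Y t \<omega>)"
          by (auto simp: abs_mult mult.commute[of "\<bar>Y t \<omega>\<bar>"] intro!: mult_right_mono split: split_indicator)
      qed
    qed measurable
  qed measurable
  then have \<Phi>i: "integrable (lborel \<Otimes>\<^sub>M M) (\<lambda>(u, \<omega>). \<Phi> u \<omega>)"
    using Q.integrable_product_swap_iff[of "\<lambda>(u, \<omega>). \<Phi> u \<omega>"] by (simp add: split_beta')
  have key: "integrable M (\<Psi> u) \<and> (\<integral>\<omega>. norm (\<Psi> u \<omega>) \<partial>M) \<le> (\<integral>\<omega>. norm (\<Phi> u \<omega>) \<partial>M) \<and>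
      (\<integral>\<omega>. \<Psi> u \<omega> \<partial>M) = (\<integral>\<omega>. \<Phi> u \<omega> \<partial>M)" if "integrable M (\<Phi> u)" for u
  proof (cases "u \<in> {r..t}")
    case False
    then show ?thesis by (simp add: \<Phi>_def \<Psi>_def)
  next
    case True
    then have u: "r \<le> u" "u \<le> t" "0 \<le> u" using r by auto
    interpret fs: finite_measure_subalgebra M "Fl u"
      by unfold_locales (rule sub(1)[OF u(1)])
    have \<Psi>_u: "\<Psi> u \<omega> = (indicator A \<omega> * v u \<omega>) * Y u \<omega>" for \<omega> using u by (simp add: \<Psi>_def Yc'_def)
    have \<Phi>_u: "\<Phi> u \<omega> = (indicator A \<omega> * v u \<omega>) * Y t \<omega>" for \<omega> using u by (simp add: \<Phi>_def)
    have [measurable]: "A \<in> sets (Fl u)" using A sub(2)[OF u(1)] by auto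
    note [measurable] = va[OF u(1,2)] Ya[OF u(3)]
    note [measurable] = YM[OF u(3)] measurable_from_subalg[OF sub(1)[OF u(1)] va[OF u(1,2)]]
    have f: "(\<lambda>\<omega>. indicator A \<omega> * v u \<omega>) \<in> borel_measurable (Fl u)" by measurable
    have int: "integrable M (\<lambda>\<omega>. (indicator A \<omega> * v u \<omega>) * Y t \<omega>)"
      using that by (simp add: \<Phi>_u[abs_def])
    note ce = fs.real_cond_exp_intg[OF int f borel_measurable_integrable[OF Yt]]
    have 1: "integrable M (\<Psi> u)"
      unfolding \<Psi>_u[abs_def]
      by (rule integrable_cong_AE[THEN iffD1, OF _ _ _ ce(1)]) (use Yc[OF u(3,2)] in \<open>auto\<close>)
    have 2: "(\<integral>\<omega>. \<Psi> u \<omega> \<partial>M) = (\<integral>\<omega>. \<Phi> u \<omega> \<partial>M)"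
      unfolding \<Psi>_u \<Phi>_u ce(2)[symmetric]
      by (rule integral_cong_AE) (use Yc[OF u(3,2)] in \<open>auto\<close>)
    \<comment> \<open>The sign of \<open>Y u\<close> is known at time \<open>u\<close>, so it may be
      used as a weight: the expectation of \<open>\<bar>v u * Y u\<bar>\<close> on \<open>A\<close>
      equals that of \<open>sgn (Y u) * \<bar>v u\<bar> * Y t\<close>, which is at most that of
      \<open>\<bar>v u * Y t\<bar>\<close>. This is the comparison needed for
      \<open>\<Psi>\<close>.\<close>
    let ?f = "\<lambda>\<omega>. sgn (Y u \<omega>) * (indicator A \<omega> * \<bar>v u \<omega>\<bar>)"
    have f': "?f \<in> borel_measurable (Fl u)" by measurable
    have int': "integrable M (\<lambda>\<omega>. ?f \<omega> * Y t \<omega>)"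
    proof (rule Bochner_Integration.integrable_bound[OF int])
      show "AE x in M. norm (?f x * Y t x) \<le> norm (indicat_real A x * v u x * Y t x)"
        by (auto simp: abs_mult sgn_if split: split_indicator)
    qed measurable
    note ce' = fs.real_cond_exp_intg[OF int' f' borel_measurable_integrable[OF Yt]]
    have "(\<integral>\<omega>. norm (\<Psi> u \<omega>) \<partial>M) = (\<integral>\<omega>. ?f \<omega> * Y u \<omega> \<partial>M)"
      by (rule Bochner_Integration.integral_cong) (auto simp: \<Psi>_u abs_mult abs_sgn[of "Y u _"])
    also have "\<dots> = (\<integral>\<omega>. ?f \<omega> * Y t \<omega> \<partial>M)"
      unfolding ce'(2)[symmetric]
      by (rule integral_cong_AE) (use Yc[OF u(3,2)] in \<open>auto\<close>)
    also have "\<dots> \<le> (\<integral>\<omega>. norm (\<Phi> u \<omega>) \<partial>M)"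
    proof (rule integral_mono[OF int' integrable_norm[OF that]])
      fix \<omega>
      have "?f \<omega> * Y t \<omega> \<le> \<bar>?f \<omega> * Y t \<omega>\<bar>" by simp
      also have "\<dots> \<le> norm (\<Phi> u \<omega>)"
        by (auto simp: \<Phi>_u abs_mult sgn_if split: split_indicator)
      finally show "?f \<omega> * Y t \<omega> \<le> norm (\<Phi> u \<omega>)" .
    qed
    finally show ?thesis using 1 2 by blast
  qed
  have ae: "AE u in lborel. integrable M (\<Phi> u)"
    using Q.AE_integrable_fst[OF \<Phi>i] by simp
  have \<Psi>i: "integrable (lborel \<Otimes>\<^sub>M M) (\<lambda>(u, \<omega>). \<Psi> u \<omega>)"
  proof (rule Q.Fubini_integrable)
    show "AE u in lborel. integrable M (\<lambda>\<omega>. case (u, \<omega>) of (u, \<omega>) \<Rightarrow> \<Psi> u \<omega>)"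
      using ae by eventually_elim (use key in auto)
    show "integrable lborel (\<lambda>u. \<integral>\<omega>. norm (case (u, \<omega>) of (u, \<omega>) \<Rightarrow> \<Psi> u \<omega>) \<partial>M)"
    proof (rule Bochner_Integration.integrable_bound)
      show "integrable lborel (\<lambda>u. \<integral>\<omega>. norm (\<Phi> u \<omega>) \<partial>M)"
        using Q.integrable_fst[of "\<lambda>u \<omega>. norm (\<Phi> u \<omega>)"] integrable_norm[OF \<Phi>i]
        by (simp add: split_beta')
      show "AE u in lborel. norm (\<integral>\<omega>. norm (case (u, \<omega>) of (u, \<omega>) \<Rightarrow> \<Psi> u \<omega>) \<partial>M) \<le> norm (\<integral>\<omega>. norm (\<Phi> u \<omega>) \<partial>M)"
        using ae
      proof eventually_elim
        case (elim u)
        then show ?case using key[OF elim] integral_nonneg_AE[of "\<lambda>\<omega>. norm (\<Psi> u \<omega>)" M]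
          by (auto)
      qed
    qed measurable
  qed measurable
  have "integrable M (\<lambda>\<omega>. \<integral>u. \<Psi> u \<omega> \<partial>lborel)"
    using Q.integrable_snd[OF \<Psi>i] by simp
  moreover have \<Psi>_int: "(\<integral>u. \<Psi> u \<omega> \<partial>lborel) = indicator A \<omega> * (\<integral>u\<in>{r..t}. Y u \<omega> * v u \<omega> \<partial>lborel)" for \<omega>
  proof -
    have "(\<integral>u. \<Psi> u \<omega> \<partial>lborel) = (\<integral>u. indicator A \<omega> * (indicator {r..t} u * (Y u \<omega> * v u \<omega>)) \<partial>lborel)"
      using r by (intro Bochner_Integration.integral_cong) (auto simp: \<Psi>_def Yc'_def split: split_indicator)
    then show ?thesis by (simp add: set_lebesgue_integral_def)
  qed
  ultimately show "integrable M (\<lambda>\<omega>. indicator A \<omega> * (\<integral>u\<in>{r..t}. Y u \<omega> * v u \<omega> \<partial>lborel))"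
    by simp
  have "(\<integral>\<omega>. indicator A \<omega> * (\<integral>u\<in>{r..t}. Y u \<omega> * v u \<omega> \<partial>lborel) \<partial>M) = (\<integral>\<omega>. (\<integral>u. \<Psi> u \<omega> \<partial>lborel) \<partial>M)"
    by (simp add: \<Psi>_int)
  also have "\<dots> = (\<integral>u. (\<integral>\<omega>. \<Psi> u \<omega> \<partial>M) \<partial>lborel)"
    by (rule Q.Fubini_integral[OF \<Psi>i])
  also have "\<dots> = (\<integral>u. (\<integral>\<omega>. \<Phi> u \<omega> \<partial>M) \<partial>lborel)"
  proof (rule integral_cong_AE)
    show "AE u in lborel. (\<integral>\<omega>. \<Psi> u \<omega> \<partial>M) = (\<integral>\<omega>. \<Phi> u \<omega> \<partial>M)"
      using ae by eventually_elim (use key in auto)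
  qed measurable
  also have "\<dots> = (\<integral>\<omega>. (\<integral>u. \<Phi> u \<omega> \<partial>lborel) \<partial>M)"
    by (rule Q.Fubini_integral[OF \<Phi>i, symmetric])
  also have "\<dots> = (\<integral>\<omega>. indicator A \<omega> * Y t \<omega> * (\<integral>u\<in>{r..t}. v u \<omega> \<partial>lborel) \<partial>M)"
    by (simp add: \<Phi>_eq set_lebesgue_integral_def)
  finally show "(\<integral>\<omega>. indicator A \<omega> * (\<integral>u\<in>{r..t}. Y u \<omega> * v u \<omega> \<partial>lborel) \<partial>M) =
      (\<integral>\<omega>. indicator A \<omega> * Y t \<omega> * (\<integral>u\<in>{r..t}. v u \<omega> \<partial>lborel) \<partial>M)" .
qed

section \<open>Paths of the solution and the discount\<close>

locale affine_solution =
  fixes D :: "('e::polish_space option \<Rightarrow> real) set"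
    and L :: "('e dmeas \<Rightarrow> real) \<Rightarrow> ('e dmeas \<Rightarrow> real)"
    and F :: "('e option \<Rightarrow> real) \<Rightarrow> real"
    and R :: "('e option \<Rightarrow> real) \<Rightarrow> ('e option \<Rightarrow> real)"
    and M :: "'w measure" and Fl :: "real \<Rightarrow> 'w measure"
    and X :: "real \<Rightarrow> 'w \<Rightarrow> 'e dmeas"
  assumes lc: "locally_compact_space (euclidean :: 'e topology)"
    and dense: "dense_subspace D"
    and affine: "affine_type D L F R"
    and prob: "prob_space M"
    and filt: "filtration_on M Fl"
    and sol: "mp_solution D L M Fl X"
begin

sublocale prob_space M by (rule prob)

definition mass :: "real \<Rightarrow> 'w \<Rightarrow> real" where
  "mass u \<omega> = pair (\<lambda>_. 1) (X u \<omega>)"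

definition damp :: "real \<Rightarrow> real \<Rightarrow> 'w \<Rightarrow> real" where
  "damp \<epsilon> t \<omega> = exp (- \<epsilon> * (\<integral>u\<in>{0..t}. mass u \<omega> \<partial>lborel))"

lemma subalgebra_Fl: "subalgebra M (Fl t)"
  using filt by (simp add: filtration_on_def)

lemma Fl_mono: "s \<le> t \<Longrightarrow> sets (Fl s) \<subseteq> sets (Fl t)"
  using filt by (simp add: filtration_on_def)

lemma space_Fl: "space (Fl t) = space M"
  using subalgebra_Fl by (simp add: subalgebra_def)

lemma subalgebra_Fl_Fl: "s \<le> t \<Longrightarrow> subalgebra (Fl t) (Fl s)"
  using Fl_mono by (simp add: subalgebra_def space_Fl)

lemma X_Mplus: "0 \<le> t \<Longrightarrow> \<omega> \<in> space M \<Longrightarrow> X t \<omega> \<in> Mplus_Delta"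
  using sol by (simp add: mp_solution_def)

lemma pair_X_measurable_Fl:
  assumes "f \<in> CDelta" "0 \<le> s" "s \<le> t"
  shows "(\<lambda>\<omega>. pair f (X s \<omega>)) \<in> borel_measurable (Fl t)"
  by (rule measurable_from_subalg[OF subalgebra_Fl_Fl[OF assms(3)]])
    (use assms sol in \<open>simp add: mp_solution_def\<close>)

lemma pair_X_measurable:
  assumes "f \<in> CDelta" "0 \<le> s"
  shows "(\<lambda>\<omega>. pair f (X s \<omega>)) \<in> borel_measurable M"
  by (rule measurable_from_subalg[OF subalgebra_Fl pair_X_measurable_Fl[OF assms order_refl]])

lemma pair_X_right_continuous:
  "f \<in> CDelta \<Longrightarrow> \<omega> \<in> space M \<Longrightarrow> 0 \<le> t \<Longrightarrow> ((\<lambda>s. pair f (X s \<omega>)) \<longlongrightarrow> pair f (X t \<omega>)) (at_right t)"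
  using sol by (simp add: mp_solution_def cadlag_weak_def)

lemma pair_X_jointly_measurable:
  assumes f: "f \<in> CDelta" and t: "0 \<le> t"
  shows "(\<lambda>(u, \<omega>). pair f (X (max 0 (min t u)) \<omega>)) \<in> borel_measurable (borel \<Otimes>\<^sub>M Fl t)"
  by (rule borel_measurable_right_continuous)
    (use pair_X_measurable_Fl[OF f] pair_X_right_continuous[OF f] t in \<open>auto simp: space_Fl\<close>)

lemma pair_X_path_measurable:
  assumes f: "f \<in> CDelta" and t: "0 \<le> t" and \<omega>: "\<omega> \<in> space M"
  shows "(\<lambda>u. pair f (X (max 0 (min t u)) \<omega>)) \<in> borel_measurable borel"
  using measurable_compose[OF measurable_Pair2' pair_X_jointly_measurable[OF f t], of \<omega>] \<omega>
  by (simp add: space_Fl)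

lemma pair_X_bounded:
  assumes f: "f \<in> CDelta" and \<omega>: "\<omega> \<in> space M"
  obtains B where "\<And>v. v \<in> {0..t} \<Longrightarrow> \<bar>pair f (X v \<omega>)\<bar> \<le> B"
proof (rule cadlag_bounded[of "\<lambda>v. pair f (X v \<omega>)" t])
  show "\<exists>l. ((\<lambda>v. pair f (X v \<omega>)) \<longlongrightarrow> l) (at_left v)" if "0 < v" for v
    using sol that f \<omega> by (simp add: mp_solution_def cadlag_weak_def)
qed (use pair_X_right_continuous[OF f \<omega>] in auto)

lemma mass_nonneg: "0 \<le> t \<Longrightarrow> \<omega> \<in> space M \<Longrightarrow> 0 \<le> mass t \<omega>"
  unfolding mass_def by (rule pair_one_nonneg[OF X_Mplus])

lemma mass_integrable:
  assumes \<omega>: "\<omega> \<in> space M"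
  shows "set_integrable lborel {0..t} (\<lambda>u. c * mass u \<omega>)"
proof (cases "0 \<le> t")
  case t: True
  obtain B where B: "\<And>v. v \<in> {0..t} \<Longrightarrow> \<bar>mass v \<omega>\<bar> \<le> B"
    using pair_X_bounded[OF CDelta_const[of 1] \<omega>] unfolding mass_def by blast
  have [measurable]: "(\<lambda>u. mass (max 0 (min t u)) \<omega>) \<in> borel_measurable borel"
    unfolding mass_def by (rule pair_X_path_measurable[OF CDelta_const t \<omega>])
  have "set_integrable lborel {0..t} (\<lambda>u. c * mass (max 0 (min t u)) \<omega>)"
    unfolding set_integrable_def
  proof (rule integrableI_bounded_set_indicator[where B="\<bar>c\<bar> * B"])
    show "AE u in lborel. u \<in> {0..t} \<longrightarrow> norm (c * mass (max 0 (min t u)) \<omega>) \<le> \<bar>c\<bar> * B"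
      using B by (auto simp: abs_mult intro!: mult_left_mono AE_I2)
  qed (auto simp: emeasure_lborel_Icc_eq)
  then show ?thesis
    by (rule set_integrable_cong[THEN iffD1, rotated -1]) auto
next
  case False
  then have "{0..t} = {}" by simp
  then show ?thesis by (simp add: set_integrable_def)
qed

lemma damp_measurable_Fl:
  assumes "0 \<le> t"
  shows "damp \<epsilon> t \<in> borel_measurable (Fl t)"
proof -
  have [measurable]: "(\<lambda>(u, \<omega>). mass (max 0 (min t u)) \<omega>) \<in> borel_measurable (borel \<Otimes>\<^sub>M Fl t)"
    unfolding mass_def by (rule pair_X_jointly_measurable[OF CDelta_const assms])
  have "(\<lambda>\<omega>. exp (- \<epsilon> * (\<integral>u. indicator {0..t} u * mass (max 0 (min t u)) \<omega> \<partial>lborel))) \<in> borel_measurable (Fl t)"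
    by measurable
  moreover have "(\<integral>u. indicator {0..t} u * mass (max 0 (min t u)) \<omega> \<partial>lborel) = (\<integral>u\<in>{0..t}. mass u \<omega> \<partial>lborel)" for \<omega>
    unfolding set_lebesgue_integral_def
    by (rule Bochner_Integration.integral_cong) (auto split: split_indicator)
  ultimately show ?thesis by (simp add: damp_def[abs_def])
qed

lemma damp_measurable: "0 \<le> t \<Longrightarrow> damp \<epsilon> t \<in> borel_measurable M"
  by (rule measurable_from_subalg[OF subalgebra_Fl damp_measurable_Fl])

lemma damp_derivative:
  assumes \<omega>: "\<omega> \<in> space M"
  shows "set_integrable lborel {0..t} (\<lambda>u. - \<epsilon> * mass u \<omega> * damp \<epsilon> u \<omega>)"
    and "(\<integral>u\<in>{0..t}. - \<epsilon> * mass u \<omega> * damp \<epsilon> u \<omega> \<partial>lborel) = damp \<epsilon> t \<omega> - 1"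
proof -
  have "(\<integral>u\<in>{0..s}. - \<epsilon> * mass u \<omega> \<partial>lborel) = - \<epsilon> * (\<integral>u\<in>{0..s}. mass u \<omega> \<partial>lborel)" for s
    by (rule set_integral_mult_right)
  note * = indefinite_integral_exp[OF mass_integrable[OF \<omega>, of t "- \<epsilon>"], unfolded this, folded damp_def]
  show "set_integrable lborel {0..t} (\<lambda>u. - \<epsilon> * mass u \<omega> * damp \<epsilon> u \<omega>)"
    "(\<integral>u\<in>{0..t}. - \<epsilon> * mass u \<omega> * damp \<epsilon> u \<omega> \<partial>lborel) = damp \<epsilon> t \<omega> - 1"
    by (rule *)+
qed

lemma damp_mono:
  assumes \<omega>: "\<omega> \<in> space M" and "0 \<le> \<epsilon>" "s \<le> t"
  shows "damp \<epsilon> t \<omega> \<le> damp \<epsilon> s \<omega>"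
proof -
  have "(\<integral>u\<in>{0..s}. mass u \<omega> \<partial>lborel) \<le> (\<integral>u\<in>{0..t}. mass u \<omega> \<partial>lborel)"
    unfolding set_lebesgue_integral_def
    using mass_integrable[OF \<omega>, of s 1] mass_integrable[OF \<omega>, of t 1] mass_nonneg[OF _ \<omega>] assms
    by (intro integral_mono) (auto simp: set_integrable_def split: split_indicator)
  then show ?thesis using assms by (simp add: damp_def mult_left_mono)
qed

lemma damp_le_1: "\<omega> \<in> space M \<Longrightarrow> 0 \<le> \<epsilon> \<Longrightarrow> damp \<epsilon> t \<omega> \<le> 1"
proof -
  assume \<omega>: "\<omega> \<in> space M" and "0 \<le> \<epsilon>"
  have "0 \<le> (\<integral>u\<in>{0..t}. mass u \<omega> \<partial>lborel)"
    unfolding set_lebesgue_integral_def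
    using mass_nonneg[OF _ \<omega>]
    by (intro integral_nonneg_AE AE_I2) (auto split: split_indicator)
  then show ?thesis using \<open>0 \<le> \<epsilon>\<close> by (simp add: damp_def)
qed

lemma damp_pos: "0 < damp \<epsilon> t \<omega>"
  by (simp add: damp_def)

lemma damp_continuous:
  assumes \<omega>: "\<omega> \<in> space M"
  shows "continuous_on {0..t} (\<lambda>s. damp \<epsilon> s \<omega>)"
proof -
  have i: "set_integrable lborel {0..s} (\<lambda>u. mass u \<omega>)" for s
    using mass_integrable[OF \<omega>, of s 1] by simp
  have "continuous_on {0..t} (\<lambda>s. integral {0..s} (\<lambda>u. mass u \<omega>))"
    by (rule indefinite_integral_continuous_1[OF set_borel_integral_eq_integral(1)[OF i]])
  moreover have "integral {0..s} (\<lambda>u. mass u \<omega>) = (\<integral>u\<in>{0..s}. mass u \<omega> \<partial>lborel)" for s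
    using set_borel_integral_eq_integral(2)[OF i] by simp
  ultimately have "continuous_on {0..t} (\<lambda>s. \<integral>u\<in>{0..s}. mass u \<omega> \<partial>lborel)" by simp
  then show ?thesis
    unfolding damp_def by (intro continuous_intros)
qed

lemma damp_jointly_measurable:
  assumes t: "0 \<le> t"
  shows "(\<lambda>(u, \<omega>). damp \<epsilon> (max 0 (min t u)) \<omega>) \<in> borel_measurable (borel \<Otimes>\<^sub>M M)"
proof (rule borel_measurable_right_continuous[OF _ t])
  fix v \<omega> assume \<omega>: "\<omega> \<in> space M" and v: "0 \<le> v" "v < t"
  have "continuous_on {0..t} (\<lambda>s. damp \<epsilon> s \<omega>)" by (rule damp_continuous[OF \<omega>])
  then have "((\<lambda>s. damp \<epsilon> s \<omega>) \<longlongrightarrow> damp \<epsilon> v \<omega>) (at v within {0..t})"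
    using v by (auto simp: continuous_on_def)
  then have "((\<lambda>s. damp \<epsilon> s \<omega>) \<longlongrightarrow> damp \<epsilon> v \<omega>) (at v within {v..t})"
    by (rule tendsto_within_subset) (use v in auto)
  then show "((\<lambda>s. damp \<epsilon> s \<omega>) \<longlongrightarrow> damp \<epsilon> v \<omega>) (at_right v)"
    using v by (simp add: at_within_Icc_at_right)
qed (rule damp_measurable)

lemma Dminus_D:
  assumes "\<psi> \<in> Dminus D"
  shows "\<psi> \<in> CDelta" "\<And>x. \<psi> x \<le> 0" "R \<psi> \<in> CDelta" "(\<lambda>\<nu>. exp (pair \<psi> \<nu>)) \<in> DomL D"
  using assms dense affine by (auto simp: Dminus_def dense_subspace_def affine_type_def DomL_def)

lemma exp_pair_le_1: "\<psi> \<in> Dminus D \<Longrightarrow> \<nu> \<in> Mplus_Delta \<Longrightarrow> exp (pair \<psi> \<nu>) \<le> 1"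
  using pair_nonpos[OF Dminus_D(2)] by simp

lemma L_exp:
  assumes "\<psi> \<in> Dminus D" "\<nu> \<in> Mplus_Delta"
  shows "L (\<lambda>\<mu>. exp (pair \<psi> \<mu>)) \<nu> = (F \<psi> + pair (R \<psi>) \<nu>) * exp (pair \<psi> \<nu>)"
  using affine assms by (simp add: affine_type_def)

text \<open>Product rule on a single path for the discount and a compensated path frozen at
  \<open>c\<close>. Its point is that the plain integral of \<open>l\<close>, for which no
  integrable bound is available, disappears: on the right the drift occurs only under the
  discount.\<close>

lemma stopped_by_parts:
  fixes y l :: "real \<Rightarrow> real"
  assumes \<omega>: "\<omega> \<in> space M" and c: "0 \<le> c" "c \<le> t" and l: "set_integrable lborel {0..t} l"
    and y: "set_integrable lborel {0..t} (\<lambda>u. y (min u c) * (- \<epsilon> * mass u \<omega> * damp \<epsilon> u \<omega>))"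
  shows "set_integrable lborel {0..t}
      (\<lambda>u. (y (min u c) - y 0 - (\<integral>s\<in>{0..min u c}. l s \<partial>lborel)) * (- \<epsilon> * mass u \<omega> * damp \<epsilon> u \<omega>))"
    and "(y c - y 0 - (\<integral>u\<in>{0..c}. l u \<partial>lborel)) * damp \<epsilon> t \<omega>
      - (\<integral>u\<in>{0..t}. (y (min u c) - y 0 - (\<integral>s\<in>{0..min u c}. l s \<partial>lborel)) * (- \<epsilon> * mass u \<omega> * damp \<epsilon> u \<omega>) \<partial>lborel)
    = y c * damp \<epsilon> t \<omega> - y 0
      - (\<integral>u\<in>{0..t}. y (min u c) * (- \<epsilon> * mass u \<omega> * damp \<epsilon> u \<omega>) \<partial>lborel)
      - (\<integral>u\<in>{0..c}. l u * damp \<epsilon> u \<omega> \<partial>lborel)"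
proof -
  let ?v = "\<lambda>u. - \<epsilon> * mass u \<omega> * damp \<epsilon> u \<omega>"
  \<comment> \<open>Cutting \<open>l\<close> off at \<open>c\<close> turns the integral frozen at
    \<open>c\<close> into an ordinary primitive, that of \<open>l'\<close>, to which the product
    rule applies.\<close>
  define l' where "l' = (\<lambda>u. indicator {..c} u * l u)"
  have ind: "indicator {0..s} u * (indicator {..c} u * x) = indicator {0..min s c} u * (x :: real)" for s u x
    by (auto split: split_indicator)
  have l'_int: "(\<integral>u\<in>{0..s}. l' u \<partial>lborel) = (\<integral>u\<in>{0..min s c}. l u \<partial>lborel)" for s
    by (simp add: set_lebesgue_integral_def l'_def ind)
  have l'_int2: "(\<integral>u\<in>{0..t}. l' u * damp \<epsilon> u \<omega> \<partial>lborel) = (\<integral>u\<in>{0..c}. l u * damp \<epsilon> u \<omega> \<partial>lborel)"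
    using c by (simp add: set_lebesgue_integral_def l'_def ind mult.assoc min_absorb2)
  have l': "set_integrable lborel {0..t} l'"
    using set_integrable_subset[OF l, of "{0..c}"] c by (simp add: set_integrable_def l'_def ind min_absorb2)
  note v = damp_derivative[OF \<omega>]
  note p1 = indefinite_integral_product[OF l' v(1)[of t \<epsilon>]]
  note p2 = indefinite_integral_product(1)[OF v(1)[of t \<epsilon>] l']
  have i1: "set_integrable lborel {0..t} (\<lambda>u. l' u * (damp \<epsilon> u \<omega> - 1))"
    using p1(1) unfolding v(2) .
  have "set_integrable lborel {0..t} (\<lambda>u. l' u * (damp \<epsilon> u \<omega> - 1) + l' u)"
    using i1 l' by (rule set_integral_add)
  then have i2: "set_integrable lborel {0..t} (\<lambda>u. l' u * damp \<epsilon> u \<omega>)"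
    by (simp add: algebra_simps)
  have "(\<integral>u\<in>{0..t}. l' u * (damp \<epsilon> u \<omega> - 1) \<partial>lborel) = (\<integral>u\<in>{0..t}. l' u * damp \<epsilon> u \<omega> \<partial>lborel) - (\<integral>u\<in>{0..t}. l' u \<partial>lborel)"
    using set_integral_diff(2)[OF i2 l'] by (simp add: algebra_simps)
  \<comment> \<open>The primitive of the discount's density is \<open>damp - 1\<close>; the two
    contributions of \<open>- 1\<close> cancel.\<close>
  with p1(2) have e: "(\<integral>u\<in>{0..t}. l' u \<partial>lborel) * damp \<epsilon> t \<omega> =
      (\<integral>u\<in>{0..t}. l' u * damp \<epsilon> u \<omega> \<partial>lborel) + (\<integral>u\<in>{0..t}. ?v u * (\<integral>s\<in>{0..u}. l' s \<partial>lborel) \<partial>lborel)"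
    unfolding v(2) by (simp add: algebra_simps)
  have split: "(y (min u c) - y 0 - (\<integral>s\<in>{0..min u c}. l s \<partial>lborel)) * ?v u
    = y (min u c) * ?v u - y 0 * ?v u - ?v u * (\<integral>s\<in>{0..u}. l' s \<partial>lborel)" for u
    unfolding l'_int by (simp add: algebra_simps)
  show "set_integrable lborel {0..t} (\<lambda>u. (y (min u c) - y 0 - (\<integral>s\<in>{0..min u c}. l s \<partial>lborel)) * ?v u)"
    unfolding split
    by (rule set_integral_diff(1)[OF set_integral_diff(1)[OF y set_integrable_mult_right[OF v(1)]] p2])
  have "(\<integral>u\<in>{0..t}. (y (min u c) - y 0 - (\<integral>s\<in>{0..min u c}. l s \<partial>lborel)) * ?v u \<partial>lborel)
    = (\<integral>u\<in>{0..t}. y (min u c) * ?v u - y 0 * ?v u - ?v u * (\<integral>s\<in>{0..u}. l' s \<partial>lborel) \<partial>lborel)"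
    unfolding split ..
  also have "\<dots> = (\<integral>u\<in>{0..t}. y (min u c) * ?v u - y 0 * ?v u \<partial>lborel) - (\<integral>u\<in>{0..t}. ?v u * (\<integral>s\<in>{0..u}. l' s \<partial>lborel) \<partial>lborel)"
    by (rule set_integral_diff(2)[OF set_integral_diff(1)[OF y set_integrable_mult_right[OF v(1)]] p2])
  also have "(\<integral>u\<in>{0..t}. y (min u c) * ?v u - y 0 * ?v u \<partial>lborel) = (\<integral>u\<in>{0..t}. y (min u c) * ?v u \<partial>lborel) - (\<integral>u\<in>{0..t}. y 0 * ?v u \<partial>lborel)"
    by (rule set_integral_diff(2)[OF y set_integrable_mult_right[OF v(1)]])
  also have "(\<integral>u\<in>{0..t}. y 0 * ?v u \<partial>lborel) = y 0 * (damp \<epsilon> t \<omega> - 1)"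
    by (simp only: set_integral_mult_right v(2))
  finally show "(y c - y 0 - (\<integral>u\<in>{0..c}. l u \<partial>lborel)) * damp \<epsilon> t \<omega>
      - (\<integral>u\<in>{0..t}. (y (min u c) - y 0 - (\<integral>s\<in>{0..min u c}. l s \<partial>lborel)) * ?v u \<partial>lborel)
    = y c * damp \<epsilon> t \<omega> - y 0 - (\<integral>u\<in>{0..t}. y (min u c) * ?v u \<partial>lborel)
      - (\<integral>u\<in>{0..c}. l u * damp \<epsilon> u \<omega> \<partial>lborel)"
    using e c unfolding l'_int l'_int2 by (simp add: algebra_simps min_absorb2)
qed

section \<open>Exponentials of the process under the discount\<close>

abbreviation cut :: "real \<Rightarrow> real \<Rightarrow> real" where
  "cut t u \<equiv> max 0 (min t u)"

lemma pair_X_jointly_measurable_M: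
  assumes f: "f \<in> CDelta" and t: "0 \<le> t"
  shows "(\<lambda>(u, \<omega>). pair f (X (cut t u) \<omega>)) \<in> borel_measurable (borel \<Otimes>\<^sub>M M)"
  by (rule borel_measurable_right_continuous)
    (use pair_X_measurable[OF f] pair_X_right_continuous[OF f] t in auto)

lemma mass_jointly_measurable:
  "0 \<le> t \<Longrightarrow> (\<lambda>(u, \<omega>). mass (cut t u) \<omega>) \<in> borel_measurable (borel \<Otimes>\<^sub>M M)"
  unfolding mass_def by (rule pair_X_jointly_measurable_M[OF CDelta_const])

lemma mass_measurable_Fl: "0 \<le> t \<Longrightarrow> mass t \<in> borel_measurable (Fl t)"
  using pair_X_measurable_Fl[OF CDelta_const, of t t 1] by (simp add: mass_def[abs_def])

definition expX :: "('e option \<Rightarrow> real) \<Rightarrow> real \<Rightarrow> 'w \<Rightarrow> real" where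
  "expX \<psi> u \<omega> = exp (pair \<psi> (X u \<omega>))"

definition genX :: "('e option \<Rightarrow> real) \<Rightarrow> real \<Rightarrow> 'w \<Rightarrow> real" where
  "genX \<psi> u \<omega> = (F \<psi> + pair (R \<psi>) (X u \<omega>)) * expX \<psi> u \<omega>"

lemma expX_bounds:
  assumes "\<psi> \<in> Dminus D" "0 \<le> u" "\<omega> \<in> space M"
  shows "0 < expX \<psi> u \<omega>" "expX \<psi> u \<omega> \<le> 1" "\<bar>expX \<psi> u \<omega>\<bar> \<le> 1"
  using exp_pair_le_1[OF assms(1) X_Mplus[OF assms(2,3)]] by (simp_all add: expX_def)

lemma expX_jointly_measurable:
  assumes \<psi>: "\<psi> \<in> Dminus D" and t: "0 \<le> t"
  shows "(\<lambda>(u, \<omega>). expX \<psi> (cut t u) \<omega>) \<in> borel_measurable (borel \<Otimes>\<^sub>M M)"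
proof -
  note [measurable] = pair_X_jointly_measurable_M[OF Dminus_D(1)[OF \<psi>] t]
  show ?thesis unfolding expX_def by measurable
qed

lemma genX_jointly_measurable:
  assumes \<psi>: "\<psi> \<in> Dminus D" and t: "0 \<le> t"
  shows "(\<lambda>(u, \<omega>). genX \<psi> (cut t u) \<omega>) \<in> borel_measurable (borel \<Otimes>\<^sub>M M)"
proof -
  note [measurable] = pair_X_jointly_measurable_M[OF Dminus_D(3)[OF \<psi>] t] expX_jointly_measurable[OF \<psi> t]
  show ?thesis unfolding genX_def by measurable
qed

lemma expX_measurable_Fl:
  assumes \<psi>: "\<psi> \<in> Dminus D" and t: "0 \<le> t"
  shows "expX \<psi> t \<in> borel_measurable (Fl t)"
proof -
  note [measurable] = pair_X_measurable_Fl[OF Dminus_D(1)[OF \<psi>] t order_refl]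
  show ?thesis unfolding expX_def by measurable
qed

lemma expX_measurable: "\<psi> \<in> Dminus D \<Longrightarrow> 0 \<le> t \<Longrightarrow> expX \<psi> t \<in> borel_measurable M"
  by (rule measurable_from_subalg[OF subalgebra_Fl expX_measurable_Fl])

lemma mass_damp_integral:
  assumes \<omega>: "\<omega> \<in> space M" and \<epsilon>: "0 < \<epsilon>"
  shows "set_integrable lborel {0..t} (\<lambda>u. mass u \<omega> * damp \<epsilon> u \<omega>)"
    and "(\<integral>u\<in>{0..t}. mass u \<omega> * damp \<epsilon> u \<omega> \<partial>lborel) = (1 - damp \<epsilon> t \<omega>) / \<epsilon>"
proof -
  note v = damp_derivative[OF \<omega>, of t \<epsilon>]
  show i: "set_integrable lborel {0..t} (\<lambda>u. mass u \<omega> * damp \<epsilon> u \<omega>)"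
    using set_integrable_mult_right[OF v(1), of "- 1 / \<epsilon>"] \<epsilon> by simp
  have "- \<epsilon> * (\<integral>u\<in>{0..t}. mass u \<omega> * damp \<epsilon> u \<omega> \<partial>lborel) = damp \<epsilon> t \<omega> - 1"
    unfolding v(2)[symmetric] set_integral_mult_right[symmetric] by (simp add: mult.assoc)
  then show "(\<integral>u\<in>{0..t}. mass u \<omega> * damp \<epsilon> u \<omega> \<partial>lborel) = (1 - damp \<epsilon> t \<omega>) / \<epsilon>"
    using \<epsilon> by (simp add: field_simps)
qed

text \<open>The exponential is at most 1 because \<open>\<psi>\<close> is nonpositive, and the
  pairing with \<open>R \<psi>\<close> is linear in the mass. The constant depends on the supremum
  of \<open>R \<psi>\<close>, so this serves for one \<open>\<psi>\<close> at a time; along the flow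
  a bound integrated over \<open>s\<close> takes its place.\<close>

lemma genX_damp_bound:
  assumes \<psi>: "\<psi> \<in> Dminus D" and \<epsilon>: "0 < \<epsilon>"
  obtains B where "0 \<le> B"
    "\<And>u \<omega>. \<omega> \<in> space M \<Longrightarrow> 0 \<le> u \<Longrightarrow> \<bar>genX \<psi> u \<omega> * damp \<epsilon> u \<omega>\<bar> \<le> \<bar>F \<psi>\<bar> + B * (mass u \<omega> * damp \<epsilon> u \<omega>)"
proof -
  obtain B where B: "0 \<le> B" "\<And>x. \<bar>R \<psi> x\<bar> \<le> B" using CDelta_bounded[OF Dminus_D(3)[OF \<psi>]] by metis
  have "\<bar>genX \<psi> u \<omega> * damp \<epsilon> u \<omega>\<bar> \<le> \<bar>F \<psi>\<bar> + B * (mass u \<omega> * damp \<epsilon> u \<omega>)"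
    if \<omega>: "\<omega> \<in> space M" and u: "0 \<le> u" for u \<omega>
  proof -
    have "\<bar>pair (R \<psi>) (X u \<omega>)\<bar> \<le> B * mass u \<omega>"
      unfolding mass_def by (rule abs_pair_le[OF Dminus_D(3)[OF \<psi>] X_Mplus[OF u \<omega>] B(2)])
    then have 1: "\<bar>F \<psi> + pair (R \<psi>) (X u \<omega>)\<bar> \<le> \<bar>F \<psi>\<bar> + B * mass u \<omega>" by linarith
    have d: "0 \<le> damp \<epsilon> u \<omega>" "damp \<epsilon> u \<omega> \<le> 1"
      using damp_pos[of \<epsilon> u \<omega>] damp_le_1[OF \<omega>, of \<epsilon> u] \<epsilon> by auto
    have "\<bar>genX \<psi> u \<omega>\<bar> \<le> \<bar>F \<psi> + pair (R \<psi>) (X u \<omega>)\<bar> * 1"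
      unfolding genX_def abs_mult using expX_bounds(3)[OF \<psi> u \<omega>] by (intro mult_left_mono) auto
    then have "\<bar>genX \<psi> u \<omega>\<bar> \<le> \<bar>F \<psi>\<bar> + B * mass u \<omega>" using 1 by simp
    then have "\<bar>genX \<psi> u \<omega>\<bar> * damp \<epsilon> u \<omega> \<le> (\<bar>F \<psi>\<bar> + B * mass u \<omega>) * damp \<epsilon> u \<omega>"
      using d(1) by (rule mult_right_mono)
    also have "\<dots> \<le> \<bar>F \<psi>\<bar> + B * (mass u \<omega> * damp \<epsilon> u \<omega>)"
      using d mult_left_mono[OF d(2), of "\<bar>F \<psi>\<bar>"] by (simp add: algebra_simps)
    finally show ?thesis using d by (simp add: abs_mult)
  qed
  with B(1) show ?thesis by (rule that)
qed

text \<open>Only the mass accumulated under the discount enters the bounds, which are therefore uniform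
  in the localising sequence; no optional stopping is needed.\<close>

lemma damped_dynkin:
  assumes \<psi>: "\<psi> \<in> Dminus D" and \<epsilon>: "0 < \<epsilon>" and r: "0 \<le> r" "r \<le> t" and A: "A \<in> sets (Fl r)"
  shows "(\<integral>\<omega>. indicator A \<omega> * (expX \<psi> t \<omega> * damp \<epsilon> t \<omega> - expX \<psi> r \<omega> * damp \<epsilon> r \<omega>) \<partial>M) =
    (\<integral>\<omega>. indicator A \<omega> * (\<integral>u\<in>{r..t}. genX \<psi> u \<omega> * damp \<epsilon> u \<omega> - \<epsilon> * mass u \<omega> * damp \<epsilon> u \<omega> * expX \<psi> u \<omega> \<partial>lborel) \<partial>M)"
proof -
  have t: "0 \<le> t" using r by simp
  let ?v = "\<lambda>u \<omega>. - \<epsilon> * mass u \<omega> * damp \<epsilon> u \<omega>"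
  have A'[measurable]: "A \<in> sets M" using A subalgebra_Fl by (auto simp: subalgebra_def)
  note [measurable] = mass_jointly_measurable[OF t] damp_jointly_measurable[OF t]
    expX_jointly_measurable[OF \<psi> t] genX_jointly_measurable[OF \<psi> t]
    damp_measurable[OF t] damp_measurable[OF r(1)] expX_measurable[OF \<psi> t] expX_measurable[OF \<psi> r(1)]
  obtain B where B: "0 \<le> B" "\<And>u \<omega>. \<omega> \<in> space M \<Longrightarrow> 0 \<le> u \<Longrightarrow>
      \<bar>genX \<psi> u \<omega> * damp \<epsilon> u \<omega>\<bar> \<le> \<bar>F \<psi>\<bar> + B * (mass u \<omega> * damp \<epsilon> u \<omega>)"
    using genX_damp_bound[OF \<psi> \<epsilon>] by metis
  have dom: "set_integrable lborel {0..s} (\<lambda>u. \<bar>F \<psi>\<bar> + B * (mass u \<omega> * damp \<epsilon> u \<omega>))"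
    if \<omega>: "\<omega> \<in> space M" for \<omega> s
    by (intro set_integral_add(1) set_integrable_mult_right mass_damp_integral(1)[OF \<omega> \<epsilon>])
      (auto simp: set_integrable_def emeasure_lborel_Icc_eq intro!: integrable_real_indicator)
  have gen_path: "set_borel_measurable lborel {0..t} (\<lambda>u. genX \<psi> u \<omega> * damp \<epsilon> u \<omega>)"
    if \<omega>: "\<omega> \<in> space M" for \<omega>
  proof -
    have "(\<lambda>u. genX \<psi> (cut t u) \<omega> * damp \<epsilon> (cut t u) \<omega>) \<in> borel_measurable borel"
      using \<omega> by measurable
    then have "(\<lambda>u. indicator {0..t} u * (genX \<psi> (cut t u) \<omega> * damp \<epsilon> (cut t u) \<omega>)) \<in> borel_measurable lborel"
      by measurable
    moreover have "indicator {0..t} u * (genX \<psi> (cut t u) \<omega> * damp \<epsilon> (cut t u) \<omega>)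
        = indicator {0..t} u * (genX \<psi> u \<omega> * damp \<epsilon> u \<omega>)" for u
      by (auto split: split_indicator)
    ultimately show ?thesis by (simp add: set_borel_measurable_def)
  qed
  have gi: "set_integrable lborel {0..t} (\<lambda>u. genX \<psi> u \<omega> * damp \<epsilon> u \<omega>)" if \<omega>: "\<omega> \<in> space M" for \<omega>
    by (rule set_integrable_bound[OF dom[OF \<omega>, of t] gen_path[OF \<omega>]])
      (use B \<omega> mass_nonneg[OF _ \<omega>] damp_pos in \<open>auto intro!: AE_I2 order_trans[OF _ abs_ge_self]\<close>)
  \<comment> \<open>Independent of the path and of any localising time, since the discounted mass
    integrates to at most \<open>1 / \<epsilon>\<close>.\<close>
  define K where "K = \<bar>F \<psi>\<bar> * t + B / \<epsilon>"
  have gK: "\<bar>\<integral>u\<in>{0..s}. genX \<psi> u \<omega> * damp \<epsilon> u \<omega> \<partial>lborel\<bar> \<le> K"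
    if \<omega>: "\<omega> \<in> space M" and s: "0 \<le> s" "s \<le> t" for \<omega> s
  proof -
    have gs: "set_integrable lborel {0..s} (\<lambda>u. genX \<psi> u \<omega> * damp \<epsilon> u \<omega>)"
      using s by (intro set_integrable_subset[OF gi[OF \<omega>]]) auto
    have "\<bar>\<integral>u\<in>{0..s}. genX \<psi> u \<omega> * damp \<epsilon> u \<omega> \<partial>lborel\<bar> \<le> (\<integral>u\<in>{0..s}. \<bar>genX \<psi> u \<omega> * damp \<epsilon> u \<omega>\<bar> \<partial>lborel)"
      using set_integral_norm_bound[OF gs] by simp
    also have "\<dots> \<le> (\<integral>u\<in>{0..s}. \<bar>F \<psi>\<bar> + B * (mass u \<omega> * damp \<epsilon> u \<omega>) \<partial>lborel)"
      using set_integrable_abs[OF gs] dom[OF \<omega>, of s] B(2)[OF \<omega>]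
      by (intro set_integral_mono) auto
    also have "\<dots> = (\<integral>u\<in>{0..s}. \<bar>F \<psi>\<bar> \<partial>lborel) + (\<integral>u\<in>{0..s}. B * (mass u \<omega> * damp \<epsilon> u \<omega>) \<partial>lborel)"
      by (intro set_integral_add(2) set_integrable_mult_right mass_damp_integral(1)[OF \<omega> \<epsilon>])
        (auto simp: set_integrable_def emeasure_lborel_Icc_eq intro!: integrable_real_indicator)
    also have "(\<integral>u\<in>{0..s}. \<bar>F \<psi>\<bar> \<partial>lborel) = \<bar>F \<psi>\<bar> * s"
      using s by (simp add: set_lebesgue_integral_def)
    also have "(\<integral>u\<in>{0..s}. B * (mass u \<omega> * damp \<epsilon> u \<omega>) \<partial>lborel) = B * ((1 - damp \<epsilon> s \<omega>) / \<epsilon>)"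
      by (simp only: set_integral_mult_right mass_damp_integral(2)[OF \<omega> \<epsilon>])
    also have "\<bar>F \<psi>\<bar> * s + B * ((1 - damp \<epsilon> s \<omega>) / \<epsilon>) \<le> \<bar>F \<psi>\<bar> * t + B * (1 / \<epsilon>)"
      using s B(1) \<epsilon> damp_pos[of \<epsilon> s \<omega>]
      by (intro add_mono mult_left_mono divide_right_mono) auto
    also have "\<dots> = K" by (simp add: K_def)
    finally show ?thesis .
  qed
  have vi: "set_integrable lborel {r..t} (\<lambda>u. ?v u \<omega>)"
    and v_int: "(\<integral>u\<in>{r..t}. ?v u \<omega> \<partial>lborel) = damp \<epsilon> t \<omega> - damp \<epsilon> r \<omega>" if \<omega>: "\<omega> \<in> space M" for \<omega>
  proof -
    show "set_integrable lborel {r..t} (\<lambda>u. ?v u \<omega>)"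
      using r by (intro set_integrable_subset[OF damp_derivative(1)[OF \<omega>, of t \<epsilon>]]) auto
    show "(\<integral>u\<in>{r..t}. ?v u \<omega> \<partial>lborel) = damp \<epsilon> t \<omega> - damp \<epsilon> r \<omega>"
      unfolding set_integral_Icc_split[OF r damp_derivative(1)[OF \<omega>]] damp_derivative(2)[OF \<omega>] by simp
  qed
  \<comment> \<open>The discount is decreasing, so the total variation of the weight telescopes and
    is at most 1; this is the bound under which the martingale is integrated against it.\<close>
  have v_abs: "(\<integral>u\<in>{r..t}. \<bar>?v u \<omega>\<bar> \<partial>lborel) = damp \<epsilon> r \<omega> - damp \<epsilon> t \<omega>" if \<omega>: "\<omega> \<in> space M" for \<omega>
  proof -
    have "(\<integral>u\<in>{r..t}. \<bar>?v u \<omega>\<bar> \<partial>lborel) = (\<integral>u\<in>{r..t}. - 1 * ?v u \<omega> \<partial>lborel)"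
      using r mass_nonneg[OF _ \<omega>] \<epsilon> damp_pos
      by (intro set_lebesgue_integral_cong) (auto simp: abs_mult less_imp_le)
    also have "\<dots> = - 1 * (\<integral>u\<in>{r..t}. ?v u \<omega> \<partial>lborel)" by (rule set_integral_mult_right)
    finally show ?thesis using v_int[OF \<omega>] by simp
  qed
  let ?f = "\<lambda>\<mu>. exp (pair \<psi> \<mu>)"
  define N where "N = (\<lambda>s \<omega>. ?f (X s \<omega>) - ?f (X 0 \<omega>) - (\<integral>u\<in>{0..s}. L ?f (X u \<omega>) \<partial>lborel))"
  have Li: "set_integrable lborel {0..s} (\<lambda>u. genX \<psi> u \<omega>)" if "\<omega> \<in> space M" "0 \<le> s" for s \<omega>
  proof -
    have "set_integrable lborel {0..s} (\<lambda>u. L ?f (X u \<omega>))"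
      using sol Dminus_D(4)[OF \<psi>] that by (simp add: mp_solution_def)
    then show ?thesis
      by (rule set_integrable_cong[THEN iffD1, rotated -1])
        (use L_exp[OF \<psi> X_Mplus] that in \<open>auto simp: genX_def expX_def\<close>)
  qed
  have N_eq: "N s \<omega> = expX \<psi> s \<omega> - expX \<psi> 0 \<omega> - (\<integral>u\<in>{0..s}. genX \<psi> u \<omega> \<partial>lborel)" if "\<omega> \<in> space M" "0 \<le> s" for s \<omega>
  proof -
    have "(\<integral>u\<in>{0..s}. L ?f (X u \<omega>) \<partial>lborel) = (\<integral>u\<in>{0..s}. genX \<psi> u \<omega> \<partial>lborel)"
      by (rule set_lebesgue_integral_cong) (use L_exp[OF \<psi> X_Mplus] that in \<open>auto simp: genX_def expX_def\<close>)
    then show ?thesis by (simp add: N_def expX_def)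
  qed
  have N_rc: "((\<lambda>s. N s \<omega>) \<longlongrightarrow> N s \<omega>) (at_right s)" if \<omega>: "\<omega> \<in> space M" and s: "0 \<le> s" for s \<omega>
  proof -
    have 1: "((\<lambda>s. expX \<psi> s \<omega>) \<longlongrightarrow> expX \<psi> s \<omega>) (at_right s)"
      unfolding expX_def by (intro tendsto_exp pair_X_right_continuous Dminus_D(1)[OF \<psi>] \<omega> s)
    have i: "set_integrable lborel {0..u} (\<lambda>u. genX \<psi> u \<omega>)" if "0 \<le> u" for u using Li[OF \<omega> that] .
    have "continuous_on {0..s + 1} (\<lambda>u. integral {0..u} (\<lambda>u. genX \<psi> u \<omega>))"
      using s by (intro indefinite_integral_continuous_1 set_borel_integral_eq_integral(1)[OF i]) auto
    then have "((\<lambda>u. integral {0..u} (\<lambda>u. genX \<psi> u \<omega>)) \<longlongrightarrow> integral {0..s} (\<lambda>u. genX \<psi> u \<omega>)) (at s within {0..s + 1})"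
      using s by (auto simp: continuous_on_def)
    then have "((\<lambda>u. integral {0..u} (\<lambda>u. genX \<psi> u \<omega>)) \<longlongrightarrow> integral {0..s} (\<lambda>u. genX \<psi> u \<omega>)) (at s within {s..s + 1})"
      by (rule tendsto_within_subset) (use s in auto)
    then have 2: "((\<lambda>u. integral {0..u} (\<lambda>u. genX \<psi> u \<omega>)) \<longlongrightarrow> integral {0..s} (\<lambda>u. genX \<psi> u \<omega>)) (at_right s)"
      by (simp add: at_within_Icc_at_right)
    have N': "N u \<omega> = expX \<psi> u \<omega> - expX \<psi> 0 \<omega> - integral {0..u} (\<lambda>u. genX \<psi> u \<omega>)" if "0 \<le> u" for u
      using N_eq[OF \<omega> that] set_borel_integral_eq_integral(2)[OF i[OF that]] by simp
    have "((\<lambda>u. expX \<psi> u \<omega> - expX \<psi> 0 \<omega> - integral {0..u} (\<lambda>u. genX \<psi> u \<omega>)) \<longlongrightarrow> N s \<omega>) (at_right s)"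
      unfolding N'[OF s] by (intro tendsto_diff 1 2 tendsto_const)
    then show ?thesis
    proof (rule Lim_transform_eventually)
      show "eventually (\<lambda>u. expX \<psi> u \<omega> - expX \<psi> 0 \<omega> - integral {0..u} (\<lambda>u. genX \<psi> u \<omega>) = N u \<omega>) (at_right s)"
        using eventually_at_right_less[of s] by eventually_elim (use s N' in auto)
    qed
  qed
  have "\<forall>f\<in>DomL D. local_martingale M Fl
      (\<lambda>t \<omega>. f (X t \<omega>) - f (X 0 \<omega>) - (\<integral>s\<in>{0..t}. L f (X s \<omega>) \<partial>lborel))"
    using sol unfolding mp_solution_def by blast
  from bspec[OF this Dminus_D(4)[OF \<psi>]] have "local_martingale M Fl N"
    unfolding N_def .
  then obtain \<tau> :: "nat \<Rightarrow> 'w \<Rightarrow> ereal" where \<tau>: "\<And>n. is_stopping_time Fl (\<tau> n)"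
      "AE \<omega> in M. (\<lambda>n. \<tau> n \<omega>) \<longlonglongrightarrow> \<infinity>" "\<And>n. martingale M Fl (stopped N (\<tau> n))"
    by (auto simp: local_martingale_def)
  have \<tau>0: "0 \<le> \<tau> n \<omega>" for n \<omega> using \<tau>(1)[of n] by (simp add: is_stopping_time_def)
  \<comment> \<open>The minimum of \<open>\<tau> n\<close> and \<open>t\<close> as a real number;
    the case distinction takes care of an infinite \<open>\<tau> n\<close>.\<close>
  define c where "c = (\<lambda>n \<omega>. if \<tau> n \<omega> \<le> ereal t then real_of_ereal (\<tau> n \<omega>) else t)"
  have c: "0 \<le> c n \<omega>" "c n \<omega> \<le> t" for n \<omega>
    using \<tau>0[of n \<omega>] t by (cases "\<tau> n \<omega>"; auto simp: c_def)+
  have Yc: "stopped N (\<tau> n) u \<omega> = N (min u (c n \<omega>)) \<omega>" if "0 \<le> u" "u \<le> t" for n u \<omega>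
    using \<tau>0[of n \<omega>] that by (cases "\<tau> n \<omega>") (auto simp: c_def stopped_def min_def)
  \<comment> \<open>The outcome of integration by parts between \<open>r\<close> and
    \<open>t\<close> for \<open>N\<close> frozen at \<open>c\<close>. Every drift integral in it is
    discounted, so it obeys a bound that \<open>N\<close> itself need not obey.\<close>
  define Z where "Z = (\<lambda>c \<omega>. expX \<psi> c \<omega> * damp \<epsilon> t \<omega> - expX \<psi> (min r c) \<omega> * damp \<epsilon> r \<omega>
      - (\<integral>u\<in>{r..t}. expX \<psi> (min u c) \<omega> * ?v u \<omega> \<partial>lborel)
      - ((\<integral>u\<in>{0..c}. genX \<psi> u \<omega> * damp \<epsilon> u \<omega> \<partial>lborel) - (\<integral>u\<in>{0..min r c}. genX \<psi> u \<omega> * damp \<epsilon> u \<omega> \<partial>lborel)))"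
  have yvi: "set_integrable lborel {0..t} (\<lambda>u. expX \<psi> (min u c) \<omega> * ?v u \<omega>)"
    if \<omega>: "\<omega> \<in> space M" and c: "0 \<le> c" "c \<le> t" for c \<omega>
  proof (rule set_integrable_bound[OF damp_derivative(1)[OF \<omega>, of t \<epsilon>]])
    have "(\<lambda>u. expX \<psi> (cut t (min u c)) \<omega> * (- \<epsilon> * mass (cut t u) \<omega> * damp \<epsilon> (cut t u) \<omega>)) \<in> borel_measurable borel"
    proof -
      have "(\<lambda>u. case (min u c, \<omega>) of (u, \<omega>) \<Rightarrow> expX \<psi> (cut t u) \<omega>) \<in> borel_measurable borel"
        using \<omega> by measurable
      then have [measurable]: "(\<lambda>u. expX \<psi> (cut t (min u c)) \<omega>) \<in> borel_measurable borel" by simp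
      show ?thesis using \<omega> by measurable
    qed
    then have "(\<lambda>u. indicator {0..t} u * (expX \<psi> (cut t (min u c)) \<omega> * (- \<epsilon> * mass (cut t u) \<omega> * damp \<epsilon> (cut t u) \<omega>))) \<in> borel_measurable lborel"
      by measurable
    moreover have "indicator {0..t} u * (expX \<psi> (cut t (min u c)) \<omega> * (- \<epsilon> * mass (cut t u) \<omega> * damp \<epsilon> (cut t u) \<omega>))
      = indicator {0..t} u * (expX \<psi> (min u c) \<omega> * ?v u \<omega>)" for u
      using c by (auto split: split_indicator simp: min_def)
    ultimately show "set_borel_measurable lborel {0..t} (\<lambda>u. expX \<psi> (min u c) \<omega> * ?v u \<omega>)"
      by (simp only: set_borel_measurable_def real_scaleR_def)
    show "AE u in lborel. u \<in> {0..t} \<longrightarrow> norm (expX \<psi> (min u c) \<omega> * ?v u \<omega>) \<le> norm (?v u \<omega>)"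
    proof (intro AE_I2 impI)
      fix u assume "u \<in> {0..t}"
      then have "\<bar>expX \<psi> (min u c) \<omega>\<bar> \<le> 1" using c by (intro expX_bounds(3)[OF \<psi> _ \<omega>]) auto
      from mult_right_mono[OF this, of "\<bar>?v u \<omega>\<bar>"]
      show "norm (expX \<psi> (min u c) \<omega> * ?v u \<omega>) \<le> norm (?v u \<omega>)" by (simp add: abs_mult)
    qed
  qed
  have Z_path: "N c \<omega> * damp \<epsilon> t \<omega> - N (min r c) \<omega> * damp \<epsilon> r \<omega> - (\<integral>u\<in>{r..t}. N (min u c) \<omega> * ?v u \<omega> \<partial>lborel) = Z c \<omega>"
    if \<omega>: "\<omega> \<in> space M" and c: "0 \<le> c" "c \<le> t" for c \<omega>
  proof -
    \<comment> \<open>Integration by parts is carried out on \<open>[0, t]\<close> with freezing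
      time \<open>c\<close> and on \<open>[0, r]\<close> with freezing time \<open>min r c\<close>,
      and the results are subtracted.\<close>
    let ?y = "\<lambda>u. expX \<psi> u \<omega>" and ?l = "\<lambda>u. genX \<psi> u \<omega>"
    have minc: "min u (min r c) = min u c" if "u \<in> {0..r}" for u using that by auto
    have yr: "set_integrable lborel {0..r} (\<lambda>u. ?y (min u (min r c)) * ?v u \<omega>)"
      by (rule set_integrable_cong[THEN iffD1, OF refl refl _ set_integrable_subset[OF yvi[OF \<omega> c], of "{0..r}"]])
        (use minc r in auto)
    note bt = stopped_by_parts[OF \<omega> c Li[OF \<omega> t], of ?y \<epsilon>, OF yvi[OF \<omega> c]]
    have rc: "0 \<le> min r c" "min r c \<le> r" using r c by auto
    note br = stopped_by_parts(2)[OF \<omega> rc Li[OF \<omega> r(1)], of ?y \<epsilon>, OF yr]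
    have e1: "(\<integral>u\<in>{0..r}. (?y (min u (min r c)) - ?y 0 - (\<integral>s\<in>{0..min u (min r c)}. ?l s \<partial>lborel)) * ?v u \<omega> \<partial>lborel)
      = (\<integral>u\<in>{0..r}. (?y (min u c) - ?y 0 - (\<integral>s\<in>{0..min u c}. ?l s \<partial>lborel)) * ?v u \<omega> \<partial>lborel)"
      by (rule set_lebesgue_integral_cong) (use minc in auto)
    have e2: "(\<integral>u\<in>{0..r}. ?y (min u (min r c)) * ?v u \<omega> \<partial>lborel) = (\<integral>u\<in>{0..r}. ?y (min u c) * ?v u \<omega> \<partial>lborel)"
      by (rule set_lebesgue_integral_cong) (use minc in auto)
    have e3: "(\<integral>u\<in>{r..t}. N (min u c) \<omega> * ?v u \<omega> \<partial>lborel)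
      = (\<integral>u\<in>{r..t}. (?y (min u c) - ?y 0 - (\<integral>s\<in>{0..min u c}. ?l s \<partial>lborel)) * ?v u \<omega> \<partial>lborel)"
      by (rule set_lebesgue_integral_cong) (use N_eq[OF \<omega>] r c in auto)
    show ?thesis
      unfolding Z_def e3 N_eq[OF \<omega> c(1)] N_eq[OF \<omega> rc(1)]
        set_integral_Icc_split[OF r bt(1)] set_integral_Icc_split[OF r yvi[OF \<omega> c]]
      using bt(2) br[unfolded e1 e2] by linarith
  qed
  have E0: "(\<integral>\<omega>. indicator A \<omega> * Z (c n \<omega>) \<omega> \<partial>M) = 0"
    and Zi: "integrable M (\<lambda>\<omega>. indicator A \<omega> * Z (c n \<omega>) \<omega>)" for n
  proof -
    define Y where "Y = stopped N (\<tau> n)"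
    have Y: "martingale M Fl Y" unfolding Y_def by (rule \<tau>(3))
    have Y_rc: "((\<lambda>s. Y s \<omega>) \<longlongrightarrow> Y s \<omega>) (at_right s)" if \<omega>: "\<omega> \<in> space M" and s: "0 \<le> s" for s \<omega>
    proof (cases "\<tau> n \<omega> \<le> ereal s")
      case True
      have "eventually (\<lambda>u. Y u \<omega> = Y s \<omega>) (at_right s)"
        using eventually_at_right_less[of s]
      proof eventually_elim
        case (elim u)
        then have "\<tau> n \<omega> \<le> ereal u" using True by (metis ereal_less_eq(3) less_imp_le order_trans)
        then show ?case using True by (simp add: Y_def stopped_def)
      qed
      then show ?thesis by (rule tendsto_eventually)
    next
      case False
      then obtain b where b: "s < b" "ereal b \<le> \<tau> n \<omega>"
        by (cases "\<tau> n \<omega>") (auto simp: not_le intro: that[of "s + 1"])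
      have "eventually (\<lambda>u. u < b) (at_right s)"
        using b(1) unfolding eventually_at_right_field by blast
      then have "eventually (\<lambda>u. N u \<omega> = Y u \<omega>) (at_right s)"
      proof (rule eventually_mono)
        fix u assume "u < b"
        then have "\<not> \<tau> n \<omega> \<le> ereal u" using b(2) by (metis ereal_less_eq(3) not_le order_trans)
        then show "N u \<omega> = Y u \<omega>" by (simp add: Y_def stopped_def)
      qed
      from Lim_transform_eventually[OF N_rc[OF \<omega> s] this] False
      show ?thesis by (simp add: Y_def stopped_def)
    qed
    define v where "v = (\<lambda>u \<omega>. - \<epsilon> * mass (cut t u) \<omega> * damp \<epsilon> (cut t u) \<omega>)"
    have v_eq: "v u \<omega> = ?v u \<omega>" if "u \<in> {r..t}" for u \<omega> using that r by (simp add: v_def)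
    have v_cong: "(\<integral>u\<in>{r..t}. h u (v u \<omega>) \<partial>lborel) = (\<integral>u\<in>{r..t}. h u (?v u \<omega>) \<partial>lborel)" for h :: "real \<Rightarrow> real \<Rightarrow> real" and \<omega>
      by (rule set_lebesgue_integral_cong) (use v_eq in auto)
    have prems: "(\<lambda>(u, \<omega>). v u \<omega>) \<in> borel_measurable (borel \<Otimes>\<^sub>M M)"
      "\<And>u. r \<le> u \<Longrightarrow> u \<le> t \<Longrightarrow> v u \<in> borel_measurable (Fl u)"
      "\<And>\<omega>. \<omega> \<in> space M \<Longrightarrow> set_integrable lborel {r..t} (\<lambda>u. v u \<omega>)"
      "\<And>\<omega>. \<omega> \<in> space M \<Longrightarrow> (\<integral>u\<in>{r..t}. \<bar>v u \<omega>\<bar> \<partial>lborel) \<le> 1"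
    proof -
      show "(\<lambda>(u, \<omega>). v u \<omega>) \<in> borel_measurable (borel \<Otimes>\<^sub>M M)" unfolding v_def by measurable
      show "v u \<in> borel_measurable (Fl u)" if u: "r \<le> u" "u \<le> t" for u
      proof -
        have u0: "0 \<le> u" using u r by simp
        note [measurable] = mass_measurable_Fl[OF u0] damp_measurable_Fl[OF u0]
        have "(\<lambda>\<omega>. - \<epsilon> * mass u \<omega> * damp \<epsilon> u \<omega>) \<in> borel_measurable (Fl u)" by measurable
        then show ?thesis using u u0 by (simp add: v_def[abs_def])
      qed
      show "set_integrable lborel {r..t} (\<lambda>u. v u \<omega>)" if "\<omega> \<in> space M" for \<omega>
        by (rule set_integrable_cong[THEN iffD1, OF refl refl _ vi[OF that]]) (use v_eq in auto)
      show "(\<integral>u\<in>{r..t}. \<bar>v u \<omega>\<bar> \<partial>lborel) \<le> 1" if "\<omega> \<in> space M" for \<omega>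
        using v_cong[of "\<lambda>_. abs" \<omega>] v_abs[OF that] damp_pos[of \<epsilon> t \<omega>] damp_le_1[OF that, of \<epsilon> r] \<epsilon> by simp
    qed
    note mw = martingale_weighted_integral[OF prob filt Y Y_rc r A prems]
    have Yt: "integrable M (Y t)" and Yr: "integrable M (Y r)" and Yr_meas: "Y r \<in> borel_measurable (Fl r)"
      and Yce: "AE \<omega> in M. real_cond_exp M (Fl r) (Y t) \<omega> = Y r \<omega>"
      using Y r t by (auto simp: martingale_def)
    note [measurable] = borel_measurable_integrable[OF Yt] borel_measurable_integrable[OF Yr]
    have i: "integrable M (\<lambda>\<omega>. indicator A \<omega> * (Y s' \<omega> * damp \<epsilon> s \<omega>))"
      if "integrable M (Y s')" "0 \<le> s" for s s'
    proof (rule Bochner_Integration.integrable_bound[OF that(1)])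
      show "(\<lambda>\<omega>. indicator A \<omega> * (Y s' \<omega> * damp \<epsilon> s \<omega>)) \<in> borel_measurable M"
        using damp_measurable[OF that(2), of \<epsilon>] borel_measurable_integrable[OF that(1)] by measurable
      show "AE \<omega> in M. norm (indicator A \<omega> * (Y s' \<omega> * damp \<epsilon> s \<omega>)) \<le> norm (Y s' \<omega>)"
        using \<epsilon> damp_le_1[of _ \<epsilon> s] damp_pos[of \<epsilon> s]
        by (intro AE_I2) (auto simp: abs_mult mult_left_le less_imp_le split: split_indicator)
    qed
    note i1 = i[OF Yt t] and i2 = i[OF Yt r(1)] and i3 = i[OF Yr r(1)]
    have Zeq: "indicator A \<omega> * Z (c n \<omega>) \<omega> = indicator A \<omega> * (Y t \<omega> * damp \<epsilon> t \<omega>)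
        - indicator A \<omega> * (Y r \<omega> * damp \<epsilon> r \<omega>) - indicator A \<omega> * (\<integral>u\<in>{r..t}. Y u \<omega> * v u \<omega> \<partial>lborel)"
      if \<omega>: "\<omega> \<in> space M" for \<omega>
    proof -
      have "(\<integral>u\<in>{r..t}. Y u \<omega> * v u \<omega> \<partial>lborel) = (\<integral>u\<in>{r..t}. N (min u (c n \<omega>)) \<omega> * ?v u \<omega> \<partial>lborel)"
        by (rule set_lebesgue_integral_cong) (use v_eq Yc r in \<open>auto simp: Y_def\<close>)
      moreover have "Y t \<omega> = N (c n \<omega>) \<omega>" "Y r \<omega> = N (min r (c n \<omega>)) \<omega>"
        using Yc[of t n \<omega>] Yc[of r n \<omega>] r t c[of n \<omega>] by (auto simp: Y_def min_absorb2)
      ultimately show ?thesis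
        using Z_path[OF \<omega> c[of n \<omega>]] by (simp add: algebra_simps)
    qed
    have "integrable M (\<lambda>\<omega>. indicator A \<omega> * (Y t \<omega> * damp \<epsilon> t \<omega>)
        - indicator A \<omega> * (Y r \<omega> * damp \<epsilon> r \<omega>) - indicator A \<omega> * (\<integral>u\<in>{r..t}. Y u \<omega> * v u \<omega> \<partial>lborel))"
      by (intro Bochner_Integration.integrable_diff i1 i3 mw(1))
    then show "integrable M (\<lambda>\<omega>. indicator A \<omega> * Z (c n \<omega>) \<omega>)"
      by (rule Bochner_Integration.integrable_cong[THEN iffD1, OF refl, rotated]) (simp add: Zeq)
    interpret fs: finite_measure_subalgebra M "Fl r"
      by unfold_locales (rule subalgebra_Fl)
    note [measurable] = A damp_measurable_Fl[OF r(1)]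
    \<comment> \<open>The weight \<open>indicator A * damp \<epsilon> r\<close> is known at time
      \<open>r\<close>, so \<open>Y r\<close> may be replaced by \<open>Y t\<close>. With
      \<open>m2\<close> all three terms then contain \<open>Y t\<close>, with coefficients
      \<open>damp t\<close>, \<open>- damp r\<close> and \<open>- (damp t - damp r)\<close>, which
      sum to 0.\<close>
    have "(\<lambda>\<omega>. indicator A \<omega> * damp \<epsilon> r \<omega>) \<in> borel_measurable (Fl r)"
      by measurable
    moreover have "integrable M (\<lambda>\<omega>. (indicator A \<omega> * damp \<epsilon> r \<omega>) * Y t \<omega>)"
      using i2 by (simp add: mult_ac)
    ultimately have "(\<integral>\<omega>. (indicator A \<omega> * damp \<epsilon> r \<omega>) * real_cond_exp M (Fl r) (Y t) \<omega> \<partial>M)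
        = (\<integral>\<omega>. (indicator A \<omega> * damp \<epsilon> r \<omega>) * Y t \<omega> \<partial>M)"
      by (intro fs.real_cond_exp_intg(2)) auto
    moreover have "(\<integral>\<omega>. (indicator A \<omega> * damp \<epsilon> r \<omega>) * real_cond_exp M (Fl r) (Y t) \<omega> \<partial>M)
        = (\<integral>\<omega>. (indicator A \<omega> * damp \<epsilon> r \<omega>) * Y r \<omega> \<partial>M)"
      by (rule integral_cong_AE) (use Yce in auto)
    ultimately have ce: "(\<integral>\<omega>. indicator A \<omega> * (Y r \<omega> * damp \<epsilon> r \<omega>) \<partial>M) = (\<integral>\<omega>. indicator A \<omega> * (Y t \<omega> * damp \<epsilon> r \<omega>) \<partial>M)"
      by (simp add: mult_ac)
    have v_int': "(\<integral>u\<in>{r..t}. v u \<omega> \<partial>lborel) = damp \<epsilon> t \<omega> - damp \<epsilon> r \<omega>" if "\<omega> \<in> space M" for \<omega>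
      by (rule trans[OF v_cong[of "\<lambda>_ x. x"] v_int[OF that]])
    have "(\<integral>\<omega>. indicator A \<omega> * Y t \<omega> * (\<integral>u\<in>{r..t}. v u \<omega> \<partial>lborel) \<partial>M)
        = (\<integral>\<omega>. indicator A \<omega> * (Y t \<omega> * damp \<epsilon> t \<omega>) - indicator A \<omega> * (Y t \<omega> * damp \<epsilon> r \<omega>) \<partial>M)"
      by (rule Bochner_Integration.integral_cong)
        (auto simp: v_int' algebra_simps)
    also have "\<dots> = (\<integral>\<omega>. indicator A \<omega> * (Y t \<omega> * damp \<epsilon> t \<omega>) \<partial>M) - (\<integral>\<omega>. indicator A \<omega> * (Y t \<omega> * damp \<epsilon> r \<omega>) \<partial>M)"
      by (rule Bochner_Integration.integral_diff[OF i1 i2])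
    finally have m2: "(\<integral>\<omega>. indicator A \<omega> * (\<integral>u\<in>{r..t}. Y u \<omega> * v u \<omega> \<partial>lborel) \<partial>M) = \<dots>"
      using mw(2) by simp
    have "(\<integral>\<omega>. indicator A \<omega> * Z (c n \<omega>) \<omega> \<partial>M) = (\<integral>\<omega>. indicator A \<omega> * (Y t \<omega> * damp \<epsilon> t \<omega>)
        - indicator A \<omega> * (Y r \<omega> * damp \<epsilon> r \<omega>) - indicator A \<omega> * (\<integral>u\<in>{r..t}. Y u \<omega> * v u \<omega> \<partial>lborel) \<partial>M)"
      by (rule Bochner_Integration.integral_cong) (auto simp: Zeq)
    also have "\<dots> = (\<integral>\<omega>. indicator A \<omega> * (Y t \<omega> * damp \<epsilon> t \<omega>) \<partial>M)
        - (\<integral>\<omega>. indicator A \<omega> * (Y r \<omega> * damp \<epsilon> r \<omega>) \<partial>M) - (\<integral>\<omega>. indicator A \<omega> * (\<integral>u\<in>{r..t}. Y u \<omega> * v u \<omega> \<partial>lborel) \<partial>M)"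
      using i1 i3 mw(1) by (simp only: Bochner_Integration.integral_diff Bochner_Integration.integrable_diff)
    finally show "(\<integral>\<omega>. indicator A \<omega> * Z (c n \<omega>) \<omega> \<partial>M) = 0"
      using m2 ce by simp
  qed
  \<comment> \<open>The two boundary terms and the integral against the weight contribute at most 1
    each, the two drift integrals at most \<open>K\<close> each.\<close>
  have Z_bound: "\<bar>Z c \<omega>\<bar> \<le> 3 + 2 * K" if \<omega>: "\<omega> \<in> space M" and c: "0 \<le> c" "c \<le> t" for c \<omega>
  proof -
    have dm: "0 \<le> damp \<epsilon> s \<omega>" "damp \<epsilon> s \<omega> \<le> 1" for s
      using damp_pos[of \<epsilon> s \<omega>] damp_le_1[OF \<omega>, of \<epsilon> s] \<epsilon> by auto
    have yd: "\<bar>expX \<psi> a \<omega> * damp \<epsilon> s \<omega>\<bar> \<le> 1" if "0 \<le> a" for a s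
      using expX_bounds[OF \<psi> that \<omega>] dm[of s] by (simp add: abs_mult mult_le_one)
    have yv: "set_integrable lborel {r..t} (\<lambda>u. expX \<psi> (min u c) \<omega> * ?v u \<omega>)"
      using r by (intro set_integrable_subset[OF yvi[OF \<omega> c]]) auto
    have "\<bar>\<integral>u\<in>{r..t}. expX \<psi> (min u c) \<omega> * ?v u \<omega> \<partial>lborel\<bar> \<le> (\<integral>u\<in>{r..t}. \<bar>expX \<psi> (min u c) \<omega> * ?v u \<omega>\<bar> \<partial>lborel)"
      using set_integral_norm_bound[OF yv] by simp
    also have "\<dots> \<le> (\<integral>u\<in>{r..t}. \<bar>?v u \<omega>\<bar> \<partial>lborel)"
    proof (rule set_integral_mono[OF set_integrable_abs[OF yv] set_integrable_abs[OF vi[OF \<omega>]]])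
      fix u assume "u \<in> {r..t}"
      then have "\<bar>expX \<psi> (min u c) \<omega>\<bar> \<le> 1" using c r by (intro expX_bounds(3)[OF \<psi> _ \<omega>]) auto
      from mult_right_mono[OF this, of "\<bar>?v u \<omega>\<bar>"]
      show "\<bar>expX \<psi> (min u c) \<omega> * ?v u \<omega>\<bar> \<le> \<bar>?v u \<omega>\<bar>" by (simp add: abs_mult)
    qed
    also have "\<dots> \<le> 1" using v_abs[OF \<omega>] dm[of r] dm[of t] by simp
    finally show ?thesis
      unfolding Z_def
      using yd[of c t] yd[of "min r c" r] gK[OF \<omega> c] gK[OF \<omega>, of "min r c"] r c by linarith
  qed
  define G where "G = (\<lambda>\<omega>. (\<integral>u\<in>{r..t}. genX \<psi> u \<omega> * damp \<epsilon> u \<omega> - \<epsilon> * mass u \<omega> * damp \<epsilon> u \<omega> * expX \<psi> u \<omega> \<partial>lborel))"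
  have Zt: "Z t \<omega> = (expX \<psi> t \<omega> * damp \<epsilon> t \<omega> - expX \<psi> r \<omega> * damp \<epsilon> r \<omega>) - G \<omega>" if \<omega>: "\<omega> \<in> space M" for \<omega>
  proof -
    have yv: "set_integrable lborel {r..t} (\<lambda>u. expX \<psi> (min u t) \<omega> * ?v u \<omega>)"
      using r t by (intro set_integrable_subset[OF yvi[OF \<omega>]]) auto
    have gr: "set_integrable lborel {r..t} (\<lambda>u. genX \<psi> u \<omega> * damp \<epsilon> u \<omega>)"
      using r by (intro set_integrable_subset[OF gi[OF \<omega>]]) auto
    have "G \<omega> = (\<integral>u\<in>{r..t}. genX \<psi> u \<omega> * damp \<epsilon> u \<omega> + expX \<psi> (min u t) \<omega> * ?v u \<omega> \<partial>lborel)"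
      unfolding G_def by (rule set_lebesgue_integral_cong) auto
    also have "\<dots> = (\<integral>u\<in>{r..t}. genX \<psi> u \<omega> * damp \<epsilon> u \<omega> \<partial>lborel) + (\<integral>u\<in>{r..t}. expX \<psi> (min u t) \<omega> * ?v u \<omega> \<partial>lborel)"
      by (rule set_integral_add(2)[OF gr yv])
    finally show ?thesis
      using r by (simp add: Z_def set_integral_Icc_split[OF r gi[OF \<omega>]] min_absorb1)
  qed
  have Gm[measurable]: "G \<in> borel_measurable M"
  proof -
    have "(\<lambda>\<omega>. \<integral>u. indicator {r..t} u * (genX \<psi> (cut t u) \<omega> * damp \<epsilon> (cut t u) \<omega>
        - \<epsilon> * mass (cut t u) \<omega> * damp \<epsilon> (cut t u) \<omega> * expX \<psi> (cut t u) \<omega>) \<partial>lborel) \<in> borel_measurable M"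
      by measurable
    moreover have "G \<omega> = (\<integral>u. indicator {r..t} u * (genX \<psi> (cut t u) \<omega> * damp \<epsilon> (cut t u) \<omega>
        - \<epsilon> * mass (cut t u) \<omega> * damp \<epsilon> (cut t u) \<omega> * expX \<psi> (cut t u) \<omega>) \<partial>lborel)" for \<omega>
      unfolding G_def set_lebesgue_integral_def
      using r by (intro Bochner_Integration.integral_cong) (auto split: split_indicator)
    ultimately show ?thesis by (simp cong: measurable_cong)
  qed
  \<comment> \<open>As soon as \<open>\<tau> n\<close> exceeds \<open>t\<close> the freezing time is
    \<open>t\<close>. On almost every path the integrands are thus eventually constant, and the
    uniform bound lets the expectation follow.\<close>
  have "(\<lambda>n. \<integral>\<omega>. indicator A \<omega> * Z (c n \<omega>) \<omega> \<partial>M) \<longlonglongrightarrow> (\<integral>\<omega>. indicator A \<omega> * Z t \<omega> \<partial>M)"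
  proof (rule integral_dominated_convergence[where w="\<lambda>_. 3 + 2 * K"])
    have "(\<lambda>\<omega>. indicator A \<omega> * ((expX \<psi> t \<omega> * damp \<epsilon> t \<omega> - expX \<psi> r \<omega> * damp \<epsilon> r \<omega>) - G \<omega>)) \<in> borel_measurable M"
      by measurable
    then show "(\<lambda>\<omega>. indicator A \<omega> * Z t \<omega>) \<in> borel_measurable M"
      by (rule measurable_cong[THEN iffD1, rotated]) (simp add: Zt)
    show "AE \<omega> in M. (\<lambda>n. indicator A \<omega> * Z (c n \<omega>) \<omega>) \<longlonglongrightarrow> indicator A \<omega> * Z t \<omega>"
      using \<tau>(2)
    proof eventually_elim
      case (elim \<omega>)
      have "eventually (\<lambda>n. ereal t < \<tau> n \<omega>) sequentially"
        using elim by (rule order_tendstoD) simp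
      then have "eventually (\<lambda>n. indicator A \<omega> * Z (c n \<omega>) \<omega> = indicator A \<omega> * Z t \<omega>) sequentially"
        by eventually_elim (simp add: c_def not_le[symmetric])
      then show ?case by (rule tendsto_eventually)
    qed
    show "AE \<omega> in M. norm (indicator A \<omega> * Z (c n \<omega>) \<omega>) \<le> 3 + 2 * K" for n
    proof (rule AE_I2)
      fix \<omega> assume "\<omega> \<in> space M"
      from Z_bound[OF this c[of n \<omega>]]
      show "norm (indicator A \<omega> * Z (c n \<omega>) \<omega>) \<le> 3 + 2 * K"
        by (auto split: split_indicator)
    qed
  qed (use Zi in auto)
  then have lim0: "(\<integral>\<omega>. indicator A \<omega> * Z t \<omega> \<partial>M) = 0"
    unfolding E0 using LIMSEQ_unique tendsto_const by blast
  have i1: "integrable M (\<lambda>\<omega>. indicator A \<omega> * (expX \<psi> t \<omega> * damp \<epsilon> t \<omega> - expX \<psi> r \<omega> * damp \<epsilon> r \<omega>))"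
  proof (rule integrable_const_bound[where B=2])
    show "AE \<omega> in M. norm (indicator A \<omega> * (expX \<psi> t \<omega> * damp \<epsilon> t \<omega> - expX \<psi> r \<omega> * damp \<epsilon> r \<omega>)) \<le> 2"
    proof (rule AE_I2)
      fix \<omega> assume \<omega>: "\<omega> \<in> space M"
      have yd: "\<bar>expX \<psi> s \<omega> * damp \<epsilon> s \<omega>\<bar> \<le> 1" if "0 \<le> s" for s
        using expX_bounds[OF \<psi> that \<omega>] damp_pos[of \<epsilon> s \<omega>] damp_le_1[OF \<omega>, of \<epsilon> s] \<epsilon> by (simp add: abs_mult mult_le_one)
      show "norm (indicator A \<omega> * (expX \<psi> t \<omega> * damp \<epsilon> t \<omega> - expX \<psi> r \<omega> * damp \<epsilon> r \<omega>)) \<le> 2"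
        using yd[OF t] yd[OF r(1)] by (auto split: split_indicator)
    qed
  qed measurable
  \<comment> \<open>\<open>G\<close> is the difference of the boundary terms, at most 2 in absolute
    value, and \<open>Z t\<close>, at most \<open>3 + 2 * K\<close>.\<close>
  have i2: "integrable M (\<lambda>\<omega>. indicator A \<omega> * G \<omega>)"
  proof (rule integrable_const_bound[where B="5 + 2 * K"])
    show "AE \<omega> in M. norm (indicator A \<omega> * G \<omega>) \<le> 5 + 2 * K"
    proof (rule AE_I2)
      fix \<omega> assume \<omega>: "\<omega> \<in> space M"
      have yd: "\<bar>expX \<psi> s \<omega> * damp \<epsilon> s \<omega>\<bar> \<le> 1" if "0 \<le> s" for s
        using expX_bounds[OF \<psi> that \<omega>] damp_pos[of \<epsilon> s \<omega>] damp_le_1[OF \<omega>, of \<epsilon> s] \<epsilon> by (simp add: abs_mult mult_le_one)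
      have "\<bar>G \<omega>\<bar> \<le> 5 + 2 * K"
        using yd[OF t] yd[OF r(1)] Zt[OF \<omega>] Z_bound[OF \<omega> t order_refl] by linarith
      moreover have "0 \<le> K" using gK[OF \<omega> t order_refl] by linarith
      ultimately show "norm (indicator A \<omega> * G \<omega>) \<le> 5 + 2 * K"
        by (auto split: split_indicator)
    qed
  qed measurable
  have "(\<integral>\<omega>. indicator A \<omega> * Z t \<omega> \<partial>M) = (\<integral>\<omega>. indicator A \<omega> * (expX \<psi> t \<omega> * damp \<epsilon> t \<omega> - expX \<psi> r \<omega> * damp \<epsilon> r \<omega>) - indicator A \<omega> * G \<omega> \<partial>M)"
    by (rule Bochner_Integration.integral_cong) (auto simp: Zt algebra_simps)
  also have "\<dots> = (\<integral>\<omega>. indicator A \<omega> * (expX \<psi> t \<omega> * damp \<epsilon> t \<omega> - expX \<psi> r \<omega> * damp \<epsilon> r \<omega>) \<partial>M) - (\<integral>\<omega>. indicator A \<omega> * G \<omega> \<partial>M)"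
    by (rule Bochner_Integration.integral_diff[OF i1 i2])
  finally show ?thesis using lim0 by (simp add: G_def)
qed

end

section \<open>Transport along the Riccati flow\<close>

locale affine_riccati = affine_solution D L F R M Fl X
  for D :: "('e::polish_space option \<Rightarrow> real) set" and L F R
    and M :: "'w measure" and Fl and X +
  fixes g :: "'e option \<Rightarrow> real" and \<psi> :: "real \<Rightarrow> 'e option \<Rightarrow> real" and T :: real
  assumes T_pos: "0 < T"
    and \<psi>_val: "\<And>t. t \<in> {0..T} \<Longrightarrow> \<psi> t \<in> Dminus D"
    and \<psi>0: "\<psi> 0 = g"
    and \<psi>_int: "\<And>\<nu> t. \<nu> \<in> Mplus_Delta \<Longrightarrow> t \<in> {0<..T} \<Longrightarrow>
                  set_integrable lborel {0..t} (\<lambda>s. pair (R (\<psi> s)) \<nu>)"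
    and \<psi>_ode: "\<And>\<nu> t. \<nu> \<in> Mplus_Delta \<Longrightarrow> t \<in> {0<..T} \<Longrightarrow>
                  pair (\<psi> t) \<nu> = pair g \<nu> + (\<integral>s\<in>{0..t}. pair (R (\<psi> s)) \<nu> \<partial>lborel)"
    and \<phi>_int: "\<And>t. t \<in> {0..T} \<Longrightarrow> set_integrable lborel {0..t} (\<lambda>s. F (\<psi> s))"
    and \<phi>_neg: "\<And>t. t \<in> {0..T} \<Longrightarrow> (\<integral>s\<in>{0..t}. F (\<psi> s) \<partial>lborel) \<le> 0"
begin

definition \<phi> :: "real \<Rightarrow> real" where
  "\<phi> t = (\<integral>s\<in>{0..t}. F (\<psi> s) \<partial>lborel)"

text \<open>The time arguments are clamped to \<open>[0, T]\<close>, so that all measurability statements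
  can be made on the whole line.\<close>

definition trf :: "real \<Rightarrow> 'e dmeas \<Rightarrow> real" where
  "trf s \<nu> = exp (\<phi> (cut T s) + pair (\<psi> (cut T s)) \<nu>)"

text \<open>Cut off rather than clamped: outside \<open>[0, T]\<close> the clamped
  \<open>trf\<close> is constant in \<open>s\<close>, so its logarithmic derivative, which is
  \<open>rate\<close>, has to vanish there. This also makes \<open>rate\<close> integrable over the
  whole line.\<close>

definition R' :: "real \<Rightarrow> 'e option \<Rightarrow> real" where
  "R' s = (if s \<in> {0..T} then R (\<psi> s) else (\<lambda>_. 0))"

definition rate :: "real \<Rightarrow> 'e dmeas \<Rightarrow> real" where
  "rate s \<nu> = indicator {0..T} s * F (\<psi> s) + pair (R' s) \<nu>"

lemma cut_mem: "cut T s \<in> {0..T}"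
  using T_pos by auto

lemma R'_CDelta: "R' s \<in> CDelta"
  using Dminus_D(3)[OF \<psi>_val] by (simp add: R'_def CDelta_const)

lemma R'_integrable:
  assumes "\<nu> \<in> Mplus_Delta"
  shows "integrable lborel (\<lambda>s. pair (R' s) \<nu>)"
proof -
  have "indicator {0..T} s *\<^sub>R pair (R (\<psi> s)) \<nu> = pair (R' s) \<nu>" for s
    by (auto simp: R'_def pair_def split: split_indicator)
  with \<psi>_int[OF assms, of T] T_pos show ?thesis by (simp add: set_integrable_def)
qed

lemma F_integrable: "integrable lborel (\<lambda>s. indicator {0..T} s * F (\<psi> s))"
  using \<phi>_int[of T] T_pos by (simp add: set_integrable_def)

lemma rate_integrable: "\<nu> \<in> Mplus_Delta \<Longrightarrow> integrable lborel (\<lambda>s. rate s \<nu>)"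
  unfolding rate_def using R'_integrable F_integrable by simp

text \<open>The boundedness result is applied to Lebesgue measure on \<open>[0, T]\<close>, a finite
  measure. The contribution of \<open>F\<close> does not involve the measure \<open>\<nu>\<close>,
  hence an affine bound in the mass.\<close>

lemma rate_uniform_bound:
  "\<exists>K\<ge>0. \<exists>c\<ge>0. \<forall>\<nu>\<in>Mplus_Delta. (\<integral>s. \<bar>rate s \<nu>\<bar> \<partial>lborel) \<le> c + K * pair (\<lambda>_. 1) \<nu>"
proof -
  let ?S = "restrict_space lborel {0..T} :: real measure"
  have fin: "finite_measure ?S"
    using T_pos by (intro finite_measureI) (simp add: emeasure_restrict_space space_restrict_space)
  have "integrable ?S (\<lambda>s. pair (R' s) \<nu>)" if "\<nu> \<in> Mplus_Delta" for \<nu>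
    using integrable_mult_indicator[OF _ R'_integrable[OF that], of "{0..T}"]
    by (subst integrable_restrict_space) auto
  from pair_uniform_L1_bound[OF fin R'_CDelta this]
  obtain K where K: "0 \<le> K" "\<And>\<nu>. \<nu> \<in> Mplus_Delta \<Longrightarrow> (\<integral>s. \<bar>pair (R' s) \<nu>\<bar> \<partial>?S) \<le> K * pair (\<lambda>_. 1) \<nu>"
    by blast
  define c where "c = (\<integral>s. \<bar>indicator {0..T} s * F (\<psi> s)\<bar> \<partial>lborel)"
  have "(\<integral>s. \<bar>rate s \<nu>\<bar> \<partial>lborel) \<le> c + K * pair (\<lambda>_. 1) \<nu>" if \<nu>: "\<nu> \<in> Mplus_Delta" for \<nu>
  proof -
    have "(\<integral>s. \<bar>rate s \<nu>\<bar> \<partial>lborel) \<le> (\<integral>s. \<bar>indicator {0..T} s * F (\<psi> s)\<bar> + \<bar>pair (R' s) \<nu>\<bar> \<partial>lborel)"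
      using rate_integrable[OF \<nu>] F_integrable R'_integrable[OF \<nu>]
      by (intro integral_mono) (auto simp: rate_def intro: abs_triangle_ineq)
    also have "\<dots> = c + (\<integral>s. \<bar>pair (R' s) \<nu>\<bar> \<partial>lborel)"
      unfolding c_def using F_integrable R'_integrable[OF \<nu>]
      by (intro Bochner_Integration.integral_add) auto
    also have "(\<integral>s. \<bar>pair (R' s) \<nu>\<bar> \<partial>lborel) = (\<integral>s. indicator {0..T} s *\<^sub>R \<bar>pair (R' s) \<nu>\<bar> \<partial>lborel)"
      by (rule Bochner_Integration.integral_cong) (auto simp: R'_def pair_def split: split_indicator)
    also have "\<dots> = (\<integral>s. \<bar>pair (R' s) \<nu>\<bar> \<partial>?S)"
      by (rule integral_restrict_space[symmetric]) simp
    finally show ?thesis using K(2)[OF \<nu>] by simp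
  qed
  moreover have "0 \<le> c" unfolding c_def by (rule integral_nonneg_AE) simp
  ultimately show ?thesis using K(1) by blast
qed

section \<open>The Riccati equation for the exponential\<close>

lemma trf_exponent:
  assumes \<nu>: "\<nu> \<in> Mplus_Delta" and s: "s \<in> {0..T}"
  shows "\<phi> s + pair (\<psi> s) \<nu> = pair g \<nu> + (\<integral>u\<in>{0..s}. rate u \<nu> \<partial>lborel)"
proof (cases "s = 0")
  case True
  then show ?thesis by (simp add: \<phi>_def \<psi>0 set_integral_singleton)
next
  case False
  then have s': "s \<in> {0<..T}" using s by auto
  have "(\<integral>u\<in>{0..s}. rate u \<nu> \<partial>lborel) = (\<integral>u\<in>{0..s}. F (\<psi> u) + pair (R (\<psi> u)) \<nu> \<partial>lborel)"
    using s by (intro set_lebesgue_integral_cong) (auto simp: rate_def R'_def)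
  also have "\<dots> = \<phi> s + (\<integral>u\<in>{0..s}. pair (R (\<psi> u)) \<nu> \<partial>lborel)"
    unfolding \<phi>_def by (rule set_integral_add(2)[OF \<phi>_int[OF s] \<psi>_int[OF \<nu> s']])
  finally show ?thesis using \<psi>_ode[OF \<nu> s'] by simp
qed

text \<open>Up to the factor \<open>exp (pair g \<nu>)\<close>, \<open>trf\<close> is the
  exponential of the primitive of \<open>rate\<close>, so the chain rule for indefinite integrals
  applies. By the affine form of \<open>L\<close>, the integrand is the generator applied to the
  exponential.\<close>

lemma trf_derivative:
  assumes \<nu>: "\<nu> \<in> Mplus_Delta" and s: "s \<in> {0..T}"
  shows "(\<integral>u\<in>{0..s}. rate u \<nu> * trf u \<nu> \<partial>lborel) = trf s \<nu> - trf 0 \<nu>"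
proof -
  have trf: "trf u \<nu> = exp (pair g \<nu>) * exp (\<integral>v\<in>{0..u}. rate v \<nu> \<partial>lborel)" if "u \<in> {0..T}" for u
    using trf_exponent[OF \<nu> that] that by (simp add: trf_def exp_add)
  have "set_integrable lborel {0..s} (\<lambda>u. rate u \<nu>)"
    using integrable_mult_indicator[OF _ rate_integrable[OF \<nu>], of "{0..s}"] by (simp add: set_integrable_def)
  note e = indefinite_integral_exp(2)[OF this]
  have "(\<integral>u\<in>{0..s}. rate u \<nu> * trf u \<nu> \<partial>lborel) =
      (\<integral>u\<in>{0..s}. exp (pair g \<nu>) * (rate u \<nu> * exp (\<integral>v\<in>{0..u}. rate v \<nu> \<partial>lborel)) \<partial>lborel)"
    using s by (intro set_lebesgue_integral_cong) (auto simp: trf)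
  also have "\<dots> = exp (pair g \<nu>) * (exp (\<integral>v\<in>{0..s}. rate v \<nu> \<partial>lborel) - 1)"
    unfolding set_integral_mult_right e ..
  also have "\<dots> = trf s \<nu> - trf 0 \<nu>"
    using trf[OF s] T_pos by (simp add: trf_def \<psi>0 \<phi>_def algebra_simps set_integral_singleton)
  finally show ?thesis .
qed

lemma trf_0: "trf 0 \<nu> = exp (pair g \<nu>)"
  using T_pos by (simp add: trf_def \<psi>0 \<phi>_def set_integral_singleton)

lemma trf_continuous:
  assumes \<nu>: "\<nu> \<in> Mplus_Delta"
  shows "continuous_on UNIV (\<lambda>s. trf s \<nu>)"
proof -
  have i: "set_integrable lborel {0..s} (\<lambda>u. rate u \<nu>)" for s
    using integrable_mult_indicator[OF _ rate_integrable[OF \<nu>], of "{0..s}"] by (simp add: set_integrable_def)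
  have "continuous_on {0..T} (\<lambda>s. integral {0..s} (\<lambda>u. rate u \<nu>))"
    by (rule indefinite_integral_continuous_1[OF set_borel_integral_eq_integral(1)[OF i]])
  then have "continuous_on {0..T} (\<lambda>s. exp (pair g \<nu> + (\<integral>u\<in>{0..s}. rate u \<nu> \<partial>lborel)))"
    using set_borel_integral_eq_integral(2)[OF i] by (auto intro!: continuous_intros)
  moreover have "continuous_on UNIV (cut T)" by (intro continuous_intros)
  ultimately have "continuous_on UNIV (\<lambda>s. exp (pair g \<nu> + (\<integral>u\<in>{0..cut T s}. rate u \<nu> \<partial>lborel)))"
    by (rule continuous_on_compose2) (use cut_mem in blast)
  then show ?thesis
    using trf_exponent[OF \<nu> cut_mem] by (simp add: trf_def)
qed

text \<open>The signs of the integral of \<open>F\<close> and of the flow enter here; the constant 1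
  is the dominating function for the expectations of \<open>trf\<close>.\<close>

lemma trf_bounds:
  assumes \<nu>: "\<nu> \<in> Mplus_Delta"
  shows "0 < trf s \<nu>" "trf s \<nu> \<le> 1"
proof -
  show "0 < trf s \<nu>" by (simp add: trf_def)
  have "\<phi> (cut T s) \<le> 0" unfolding \<phi>_def by (rule \<phi>_neg[OF cut_mem])
  moreover have "pair (\<psi> (cut T s)) \<nu> \<le> 0"
    by (rule pair_nonpos[OF Dminus_D(2)[OF \<psi>_val[OF cut_mem]] \<nu>])
  ultimately show "trf s \<nu> \<le> 1" by (simp add: trf_def)
qed

lemma trf_expX: "s \<in> {0..T} \<Longrightarrow> trf s (X u \<omega>) = exp (\<phi> s) * expX (\<psi> s) u \<omega>"
  by (simp add: trf_def expX_def exp_add)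

section \<open>Joint measurability along the process\<close>

lemma X_cut_Mplus: "\<omega> \<in> space M \<Longrightarrow> X (cut T u) \<omega> \<in> Mplus_Delta"
  by (rule X_Mplus) auto

lemma pair_X_cut_measurable:
  assumes h: "\<And>s. h s \<in> CDelta" and hm: "\<And>\<nu>. \<nu> \<in> Mplus_Delta \<Longrightarrow> (\<lambda>s. pair (h s) \<nu>) \<in> borel_measurable borel"
  shows "(\<lambda>(s, u, \<omega>). pair (h s) (X (cut T u) \<omega>)) \<in> borel_measurable (borel \<Otimes>\<^sub>M (borel \<Otimes>\<^sub>M M))"
proof -
  have "(\<lambda>(s, z). pair (h s) (case z of (u, \<omega>) \<Rightarrow> X (cut T u) \<omega>)) \<in> borel_measurable (borel \<Otimes>\<^sub>M (borel \<Otimes>\<^sub>M M))"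
  proof (rule pair_jointly_measurable[OF lc])
    show "(case z of (u, \<omega>) \<Rightarrow> X (cut T u) \<omega>) \<in> Mplus_Delta" if "z \<in> space (borel \<Otimes>\<^sub>M M)" for z
      using that X_cut_Mplus by (auto simp: space_pair_measure)
    show "(\<lambda>z. pair f (case z of (u, \<omega>) \<Rightarrow> X (cut T u) \<omega>)) \<in> borel_measurable (borel \<Otimes>\<^sub>M M)" if "f \<in> CDelta" for f
      using pair_X_jointly_measurable_M[OF that, of T] T_pos by (simp add: split_beta')
  qed (use h hm in auto)
  then show ?thesis by (simp add: split_beta')
qed

lemma rate_measurable:
  "(\<lambda>(s, u, \<omega>). rate s (X (cut T u) \<omega>)) \<in> borel_measurable (borel \<Otimes>\<^sub>M (borel \<Otimes>\<^sub>M M))"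
proof -
  have 1: "(\<lambda>(s, u, \<omega>). pair (R' s) (X (cut T u) \<omega>)) \<in> borel_measurable (borel \<Otimes>\<^sub>M (borel \<Otimes>\<^sub>M M))"
    by (rule pair_X_cut_measurable[OF R'_CDelta]) (use borel_measurable_integrable[OF R'_integrable] in simp)
  have 2: "(\<lambda>s. indicator {0..T} s * F (\<psi> s)) \<in> borel_measurable borel"
    using borel_measurable_integrable[OF F_integrable] by simp
  show ?thesis
    using borel_measurable_add[OF measurable_compose[OF measurable_fst 2] 1]
    by (simp add: rate_def split_beta')
qed

lemma trf_measurable:
  "(\<lambda>(s, u, \<omega>). trf s (X (cut T u) \<omega>)) \<in> borel_measurable (borel \<Otimes>\<^sub>M (borel \<Otimes>\<^sub>M M))"
proof -
  \<comment> \<open>At the zero measure the exponent reduces to \<open>\<phi>\<close>, so continuity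
    of \<open>\<phi>\<close> is a special case of that of \<open>trf\<close>. The pairing with the
    flow is then a difference of two continuous functions.\<close>
  have "continuous_on UNIV (\<lambda>s. trf s (null_measure borel, 0))"
    by (rule trf_continuous) (auto simp: Mplus_Delta_def fin_meas_def intro!: finite_measureI)
  then have "continuous_on UNIV (\<lambda>s. ln (trf s (null_measure borel, 0)))"
    by (intro continuous_on_ln) (auto simp: trf_def)
  then have \<phi>c: "continuous_on UNIV (\<lambda>s. \<phi> (cut T s))"
    by (simp add: trf_def pair_def)
  then have 1: "(\<lambda>s. \<phi> (cut T s)) \<in> borel_measurable borel"
    by (rule borel_measurable_continuous_onI)
  have "(\<lambda>s. pair (\<psi> (cut T s)) \<nu>) \<in> borel_measurable borel" if "\<nu> \<in> Mplus_Delta" for \<nu>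
  proof -
    have "continuous_on UNIV (\<lambda>s. ln (trf s \<nu>) - \<phi> (cut T s))"
      by (intro continuous_intros trf_continuous \<phi>c that) (auto simp: trf_def)
    then have "(\<lambda>s. ln (trf s \<nu>) - \<phi> (cut T s)) \<in> borel_measurable borel"
      by (rule borel_measurable_continuous_onI)
    then show ?thesis by (simp add: trf_def)
  qed
  then have 2: "(\<lambda>(s, u, \<omega>). pair (\<psi> (cut T s)) (X (cut T u) \<omega>)) \<in> borel_measurable (borel \<Otimes>\<^sub>M (borel \<Otimes>\<^sub>M M))"
    by (rule pair_X_cut_measurable[OF Dminus_D(1)[OF \<psi>_val[OF cut_mem]]])
  show ?thesis
    using measurable_compose[OF borel_measurable_add[OF measurable_compose[OF measurable_fst 1] 2] borel_measurable_exp]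
    by (simp add: trf_def split_beta')
qed

text \<open>The discounted version of the function \<open>G(s, t)\<close> from the overview;
  \<open>\<epsilon> = 0\<close> gives the function without discount.\<close>

definition dtrf :: "'w set \<Rightarrow> real \<Rightarrow> real \<Rightarrow> real \<Rightarrow> real" where
  "dtrf A \<epsilon> s t = (\<integral>\<omega>. indicator A \<omega> * (trf s (X (cut T t) \<omega>) * damp \<epsilon> (cut T t) \<omega>) \<partial>M)"

lemma damp_cut_bounds:
  assumes "\<omega> \<in> space M" "0 \<le> \<epsilon>"
  shows "0 < damp \<epsilon> t \<omega>" "damp \<epsilon> t \<omega> \<le> 1"
  using damp_pos damp_le_1 assms by auto

lemma dtrf_integrand_bounds:
  assumes "\<omega> \<in> space M" "0 \<le> \<epsilon>"
  shows "0 \<le> indicator A \<omega> * (trf s (X (cut T t) \<omega>) * damp \<epsilon> (cut T t) \<omega>)"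
    "\<bar>indicator A \<omega> * (trf s (X (cut T t) \<omega>) * damp \<epsilon> (cut T t) \<omega>)\<bar> \<le> 1"
proof -
  have "0 \<le> trf s (X (cut T t) \<omega>) * damp \<epsilon> (cut T t) \<omega> \<and> trf s (X (cut T t) \<omega>) * damp \<epsilon> (cut T t) \<omega> \<le> 1"
    using trf_bounds[OF X_cut_Mplus[OF assms(1)], of s t] damp_cut_bounds[OF assms, of "cut T t"]
    by (simp add: mult_le_one less_imp_le)
  then show "0 \<le> indicator A \<omega> * (trf s (X (cut T t) \<omega>) * damp \<epsilon> (cut T t) \<omega>)"
    "\<bar>indicator A \<omega> * (trf s (X (cut T t) \<omega>) * damp \<epsilon> (cut T t) \<omega>)\<bar> \<le> 1"
    by (auto split: split_indicator)
qed

lemma dtrf_measurable: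
  assumes "A \<in> sets M"
  shows "(\<lambda>(s, t). dtrf A \<epsilon> s t) \<in> borel_measurable (borel \<Otimes>\<^sub>M borel)"
    and "(\<lambda>\<omega>. indicator A \<omega> * (trf s (X (cut T t) \<omega>) * damp \<epsilon> (cut T t) \<omega>)) \<in> borel_measurable M"
proof -
  note [measurable] = assms trf_measurable damp_jointly_measurable[OF less_imp_le[OF T_pos]]
  have *: "(\<lambda>((s, t), \<omega>). indicator A \<omega> * (trf s (X (cut T t) \<omega>) * damp \<epsilon> (cut T t) \<omega>))
    \<in> borel_measurable ((borel \<Otimes>\<^sub>M borel) \<Otimes>\<^sub>M M)"
  proof -
    have [measurable]: "(\<lambda>p. case (fst (fst p), snd (fst p), snd p) of (s, u, \<omega>) \<Rightarrow> trf s (X (cut T u) \<omega>))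
        \<in> borel_measurable ((borel \<Otimes>\<^sub>M borel) \<Otimes>\<^sub>M M)" by measurable
    have "(\<lambda>p. indicator A (snd p) * ((case (fst (fst p), snd (fst p), snd p) of (s, u, \<omega>) \<Rightarrow> trf s (X (cut T u) \<omega>))
        * (case (snd (fst p), snd p) of (u, \<omega>) \<Rightarrow> damp \<epsilon> (cut T u) \<omega>))) \<in> borel_measurable ((borel \<Otimes>\<^sub>M borel) \<Otimes>\<^sub>M M)"
      by measurable
    then show ?thesis by (simp add: split_beta')
  qed
  show "(\<lambda>(s, t). dtrf A \<epsilon> s t) \<in> borel_measurable (borel \<Otimes>\<^sub>M borel)"
    unfolding dtrf_def split_beta' using * by (intro borel_measurable_lebesgue_integral) (simp add: split_beta')
  show "(\<lambda>\<omega>. indicator A \<omega> * (trf s (X (cut T t) \<omega>) * damp \<epsilon> (cut T t) \<omega>)) \<in> borel_measurable M"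
    using measurable_compose[OF measurable_Pair1' *, of "(s, t)"] by simp
qed

lemma dtrf_integrable:
  assumes "A \<in> sets M" "0 \<le> \<epsilon>"
  shows "integrable M (\<lambda>\<omega>. indicator A \<omega> * (trf s (X (cut T t) \<omega>) * damp \<epsilon> (cut T t) \<omega>))"
  by (rule integrable_const_bound[where B=1])
    (use dtrf_measurable(2)[OF assms(1)] dtrf_integrand_bounds(2)[OF _ assms(2)] in auto)

lemma dtrf_bounded:
  assumes "A \<in> sets M" "0 \<le> \<epsilon>"
  shows "\<bar>dtrf A \<epsilon> s t\<bar> \<le> 1"
proof -
  have "\<bar>dtrf A \<epsilon> s t\<bar> \<le> (\<integral>\<omega>. \<bar>indicator A \<omega> * (trf s (X (cut T t) \<omega>) * damp \<epsilon> (cut T t) \<omega>)\<bar> \<partial>M)"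
    unfolding dtrf_def by simp
  also have "\<dots> \<le> (\<integral>\<omega>. 1 \<partial>M)"
    using dtrf_integrable[OF assms, THEN integrable_abs] dtrf_integrand_bounds(2)[OF _ assms(2)]
    by (intro integral_mono) auto
  finally show ?thesis by (simp add: prob_space)
qed

text \<open>Used twice below: with the constants of \<open>rate_uniform_bound\<close> it is the
  dominating function that justifies Fubini's theorem, and with \<open>c = 0\<close>,
  \<open>K = \<epsilon>\<close> it computes the total loss caused by the discount.\<close>

lemma weight_integrable:
  assumes r: "0 \<le> r" "r \<le> t" "t \<le> T" and \<epsilon>: "0 < \<epsilon>" and K: "0 \<le> c" "0 \<le> K"
  shows "integrable (lborel \<Otimes>\<^sub>M M) (\<lambda>(u, \<omega>). indicator {r..t} u * (c + K * (mass (cut T u) \<omega> * damp \<epsilon> (cut T u) \<omega>)))"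
    and "(\<integral>p. (case p of (u, \<omega>) \<Rightarrow> indicator {r..t} u * (c + K * (mass (cut T u) \<omega> * damp \<epsilon> (cut T u) \<omega>))) \<partial>(lborel \<Otimes>\<^sub>M M))
      = (\<integral>\<omega>. c * (t - r) + K * ((damp \<epsilon> r \<omega> - damp \<epsilon> t \<omega>) / \<epsilon>) \<partial>M)"
proof -
  interpret P: pair_sigma_finite M lborel ..
  interpret Q: pair_sigma_finite lborel M ..
  note T0 = less_imp_le[OF T_pos]
  note [measurable] = mass_jointly_measurable[OF T0] damp_jointly_measurable[OF T0]
  let ?w = "\<lambda>u \<omega>. indicator {r..t} u * (c + K * (mass (cut T u) \<omega> * damp \<epsilon> (cut T u) \<omega>))"
  have w: "integrable lborel (\<lambda>u. ?w u \<omega>)"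
    and wi: "(\<integral>u. ?w u \<omega> \<partial>lborel) = c * (t - r) + K * ((damp \<epsilon> r \<omega> - damp \<epsilon> t \<omega>) / \<epsilon>)"
    if \<omega>: "\<omega> \<in> space M" for \<omega>
  proof -
    have eq: "?w u \<omega> = indicator {r..t} u *\<^sub>R (c + K * (mass u \<omega> * damp \<epsilon> u \<omega>))" for u
      using r by (auto split: split_indicator)
    have md: "set_integrable lborel {r..t} (\<lambda>u. mass u \<omega> * damp \<epsilon> u \<omega>)"
      using r by (intro set_integrable_subset[OF mass_damp_integral(1)[OF \<omega> \<epsilon>, of t]]) auto
    have cc: "set_integrable lborel {r..t} (\<lambda>u. c)"
      using r by (auto simp: set_integrable_def emeasure_lborel_Icc_eq intro!: integrable_real_indicator)
    show "integrable lborel (\<lambda>u. ?w u \<omega>)"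
      unfolding eq set_integrable_def[symmetric]
      by (intro set_integral_add(1) set_integrable_mult_right md cc)
    have "(\<integral>u. ?w u \<omega> \<partial>lborel) = (\<integral>u\<in>{r..t}. c \<partial>lborel) + (\<integral>u\<in>{r..t}. K * (mass u \<omega> * damp \<epsilon> u \<omega>) \<partial>lborel)"
      unfolding eq set_lebesgue_integral_def[symmetric]
      by (intro set_integral_add(2) set_integrable_mult_right md cc)
    also have "(\<integral>u\<in>{r..t}. c \<partial>lborel) = c * (t - r)"
      using r by (simp add: set_lebesgue_integral_def)
    also have "(\<integral>u\<in>{r..t}. K * (mass u \<omega> * damp \<epsilon> u \<omega>) \<partial>lborel) = K * (\<integral>u\<in>{r..t}. mass u \<omega> * damp \<epsilon> u \<omega> \<partial>lborel)"
      by (rule set_integral_mult_right)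
    also have "(\<integral>u\<in>{r..t}. mass u \<omega> * damp \<epsilon> u \<omega> \<partial>lborel) = (damp \<epsilon> r \<omega> - damp \<epsilon> t \<omega>) / \<epsilon>"
      unfolding set_integral_Icc_split[OF r(1,2) mass_damp_integral(1)[OF \<omega> \<epsilon>]] mass_damp_integral(2)[OF \<omega> \<epsilon>]
      by (simp add: diff_divide_distrib)
    finally show "(\<integral>u. ?w u \<omega> \<partial>lborel) = c * (t - r) + K * ((damp \<epsilon> r \<omega> - damp \<epsilon> t \<omega>) / \<epsilon>)" .
  qed
  have w0: "0 \<le> ?w u \<omega>" if \<omega>: "\<omega> \<in> space M" for u \<omega>
    using K mass_nonneg[OF _ \<omega>, of "cut T u"] damp_pos[of \<epsilon> "cut T u" \<omega>] by (auto split: split_indicator)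
  have iP: "integrable (M \<Otimes>\<^sub>M lborel) (\<lambda>(\<omega>, u). ?w u \<omega>)"
  proof (rule P.Fubini_integrable)
    show "AE \<omega> in M. integrable lborel (\<lambda>u. case (\<omega>, u) of (\<omega>, u) \<Rightarrow> ?w u \<omega>)"
      using w by (intro AE_I2) simp
    have "integrable M (\<lambda>\<omega>. c * (t - r) + K * ((damp \<epsilon> r \<omega> - damp \<epsilon> t \<omega>) / \<epsilon>))"
    proof (rule integrable_const_bound[where B="c * (t - r) + K * (1 / \<epsilon>)"])
      show "(\<lambda>\<omega>. c * (t - r) + K * ((damp \<epsilon> r \<omega> - damp \<epsilon> t \<omega>) / \<epsilon>)) \<in> borel_measurable M"
        using borel_measurable_diff[OF damp_measurable[of r \<epsilon>] damp_measurable[of t \<epsilon>]] r by simp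
      show "AE \<omega> in M. norm (c * (t - r) + K * ((damp \<epsilon> r \<omega> - damp \<epsilon> t \<omega>) / \<epsilon>)) \<le> c * (t - r) + K * (1 / \<epsilon>)"
      proof (rule AE_I2)
        fix \<omega> assume \<omega>: "\<omega> \<in> space M"
        have "0 \<le> (damp \<epsilon> r \<omega> - damp \<epsilon> t \<omega>) / \<epsilon>" "(damp \<epsilon> r \<omega> - damp \<epsilon> t \<omega>) / \<epsilon> \<le> 1 / \<epsilon>"
          using damp_mono[OF \<omega>, of \<epsilon> r t] damp_le_1[OF \<omega>, of \<epsilon> r] damp_pos[of \<epsilon> t \<omega>] \<epsilon> r
          by (auto intro!: divide_right_mono)
        then have "0 \<le> K * ((damp \<epsilon> r \<omega> - damp \<epsilon> t \<omega>) / \<epsilon>)" "K * ((damp \<epsilon> r \<omega> - damp \<epsilon> t \<omega>) / \<epsilon>) \<le> K * (1 / \<epsilon>)"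
          using K by (auto simp only: mult_nonneg_nonneg intro: mult_left_mono)
        moreover have "0 \<le> c * (t - r)" using K r by simp
        ultimately show "norm (c * (t - r) + K * ((damp \<epsilon> r \<omega> - damp \<epsilon> t \<omega>) / \<epsilon>)) \<le> c * (t - r) + K * (1 / \<epsilon>)"
          unfolding real_norm_def by linarith
      qed
    qed
    then show "integrable M (\<lambda>\<omega>. \<integral>u. norm (case (\<omega>, u) of (\<omega>, u) \<Rightarrow> ?w u \<omega>) \<partial>lborel)"
      by (rule Bochner_Integration.integrable_cong[THEN iffD1, OF refl, rotated]) (simp add: w0 wi)
  qed measurable
  then show i: "integrable (lborel \<Otimes>\<^sub>M M) (\<lambda>(u, \<omega>). ?w u \<omega>)"
    using Q.integrable_product_swap_iff[of "\<lambda>(u, \<omega>). ?w u \<omega>"] by (simp add: split_beta')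
  have "(\<integral>p. (case p of (u, \<omega>) \<Rightarrow> ?w u \<omega>) \<partial>(lborel \<Otimes>\<^sub>M M)) = (\<integral>\<omega>. (\<integral>u. ?w u \<omega> \<partial>lborel) \<partial>M)"
    using Q.integral_snd[OF i] by simp
  also have "\<dots> = (\<integral>\<omega>. c * (t - r) + K * ((damp \<epsilon> r \<omega> - damp \<epsilon> t \<omega>) / \<epsilon>) \<partial>M)"
    by (rule Bochner_Integration.integral_cong) (auto simp: wi)
  finally show "(\<integral>p. (case p of (u, \<omega>) \<Rightarrow> ?w u \<omega>) \<partial>(lborel \<Otimes>\<^sub>M M)) = \<dots>" .
qed

text \<open>With \<open>G(s, t) = E[1\<^sub>A trf s (X t) damp t]\<close>, the partial derivatives of \<open>G\<close> in \<open>s\<close> and in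
  \<open>t\<close> agree up to the derivative of the discount. They are only integrable, not continuous, so one
  integrates them over the triangle \<open>s + (t - r) \<le> \<sigma>\<close> in both orders.\<close>

lemma triangle_balance:
  assumes A: "A \<in> sets (Fl r)" and r: "0 \<le> r" "0 \<le> \<sigma>" "r + \<sigma> \<le> T" and \<epsilon>: "0 < \<epsilon>"
  shows "\<bar>\<integral>s. indicator {0..\<sigma>} s * (dtrf A \<epsilon> 0 (r + \<sigma> - s) - dtrf A \<epsilon> s r) \<partial>lborel\<bar>
    \<le> \<sigma> * (\<integral>\<omega>. 1 - damp \<epsilon> T \<omega> \<partial>M)"
proof -
  interpret P: pair_sigma_finite M lborel ..
  interpret Q: pair_sigma_finite lborel M ..
  interpret Z: pair_sigma_finite lborel "lborel \<Otimes>\<^sub>M M" ..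
  interpret Z': pair_sigma_finite "lborel \<Otimes>\<^sub>M M" lborel ..
  note T0 = less_imp_le[OF T_pos]
  have \<epsilon>0: "0 \<le> \<epsilon>" using \<epsilon> by simp
  have A'[measurable]: "A \<in> sets M" using A subalgebra_Fl by (auto simp: subalgebra_def)
  note [measurable] = mass_jointly_measurable[OF T0] damp_jointly_measurable[OF T0]
    rate_measurable[unfolded split_beta'] trf_measurable[unfolded split_beta']
  \<comment> \<open>Indicator of the triangle over which both derivatives are integrated; the two
    facts \<open>\<rho>s\<close> and \<open>\<rho>u\<close> describe its sections for fixed time and
    for fixed parameter.\<close>
  define \<rho> :: "real \<Rightarrow> real \<Rightarrow> real" where "\<rho> = (\<lambda>s u. if 0 \<le> s \<and> r \<le> u \<and> s + u \<le> r + \<sigma> then 1 else 0)"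
  have [measurable]: "(\<lambda>(s, u). \<rho> s u) \<in> borel_measurable (borel \<Otimes>\<^sub>M borel)"
    unfolding \<rho>_def by measurable
  have \<rho>s: "\<rho> s u = indicator {r..r + \<sigma>} u * indicator {0..r + \<sigma> - u} s" for s u
    by (auto simp: \<rho>_def split: split_indicator)
  have \<rho>u: "\<rho> s u = indicator {0..\<sigma>} s * indicator {r..r + \<sigma> - s} u" for s u
    by (auto simp: \<rho>_def split: split_indicator)
  \<comment> \<open>The expectation of \<open>\<Phi>\<close> is the derivative in the parameter
    \<open>s\<close>; that of \<open>\<Phi> - \<Theta>\<close> is the derivative in time, with
    \<open>\<Theta>\<close> the loss caused by the discount.\<close>
  define \<Phi> where "\<Phi> = (\<lambda>s (z :: real \<times> 'w). case z of (u, \<omega>) \<Rightarrow>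
    \<rho> s u * (indicator A \<omega> * (rate s (X (cut T u) \<omega>) * trf s (X (cut T u) \<omega>) * damp \<epsilon> (cut T u) \<omega>)))"
  define \<Theta> where "\<Theta> = (\<lambda>s (z :: real \<times> 'w). case z of (u, \<omega>) \<Rightarrow>
    \<rho> s u * (indicator A \<omega> * (\<epsilon> * mass (cut T u) \<omega> * damp \<epsilon> (cut T u) \<omega> * trf s (X (cut T u) \<omega>))))"
  have \<Phi>m[measurable]: "(\<lambda>(s, z). \<Phi> s z) \<in> borel_measurable (lborel \<Otimes>\<^sub>M (lborel \<Otimes>\<^sub>M M))"
    unfolding \<Phi>_def split_beta' by measurable
  have \<Theta>m[measurable]: "(\<lambda>(s, z). \<Theta> s z) \<in> borel_measurable (lborel \<Otimes>\<^sub>M (lborel \<Otimes>\<^sub>M M))"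
    unfolding \<Theta>_def split_beta' by measurable
  obtain K c where K: "0 \<le> K" "0 \<le> c"
    and Kc: "\<And>\<nu>. \<nu> \<in> Mplus_Delta \<Longrightarrow> (\<integral>s. \<bar>rate s \<nu>\<bar> \<partial>lborel) \<le> c + K * pair (\<lambda>_. 1) \<nu>"
    using rate_uniform_bound by metis
  have rt': "r \<le> r + \<sigma>" using r by simp
  note W = weight_integrable[OF r(1) rt' r(3) \<epsilon>]

  have \<Phi>_bound: "\<bar>\<Phi> s (u, \<omega>)\<bar> \<le> indicator {r..r + \<sigma>} u * damp \<epsilon> (cut T u) \<omega> * \<bar>rate s (X (cut T u) \<omega>)\<bar>"
    if \<omega>: "\<omega> \<in> space M" for s u \<omega>
  proof -
    have t: "\<bar>trf s (X (cut T u) \<omega>)\<bar> \<le> 1" using trf_bounds[OF X_cut_Mplus[OF \<omega>], of s u] by simp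
    have "\<bar>\<Phi> s (u, \<omega>)\<bar> \<le> indicator {r..r + \<sigma>} u * (\<bar>rate s (X (cut T u) \<omega>)\<bar> * \<bar>trf s (X (cut T u) \<omega>)\<bar> * damp \<epsilon> (cut T u) \<omega>)"
      using damp_pos[of \<epsilon> "cut T u" \<omega>]
      by (auto simp: \<Phi>_def \<rho>s abs_mult split: split_indicator)
    also have "\<dots> \<le> indicator {r..r + \<sigma>} u * (\<bar>rate s (X (cut T u) \<omega>)\<bar> * 1 * damp \<epsilon> (cut T u) \<omega>)"
      using t damp_pos[of \<epsilon> "cut T u" \<omega>]
      by (intro mult_left_mono mult_right_mono) auto
    finally show ?thesis by (simp add: mult_ac)
  qed
  have \<Phi>s_i: "integrable lborel (\<lambda>s. \<Phi> s z)" if zs: "z \<in> space (lborel \<Otimes>\<^sub>M M)" for z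
  proof -
    obtain u \<omega> where z: "z = (u, \<omega>)" "\<omega> \<in> space M" using zs by (auto simp: space_pair_measure)
    show ?thesis
    proof (rule Bochner_Integration.integrable_bound)
      show "integrable lborel (\<lambda>s. indicator {r..r + \<sigma>} u * damp \<epsilon> (cut T u) \<omega> * \<bar>rate s (X (cut T u) \<omega>)\<bar>)"
        using rate_integrable[OF X_cut_Mplus[OF z(2)]] by (intro integrable_mult_right integrable_abs)
      show "(\<lambda>s. \<Phi> s z) \<in> borel_measurable lborel"
        using measurable_compose[OF measurable_Pair2'[OF zs] \<Phi>m] by simp
      show "AE s in lborel. norm (\<Phi> s z) \<le> norm (indicator {r..r + \<sigma>} u * damp \<epsilon> (cut T u) \<omega> * \<bar>rate s (X (cut T u) \<omega>)\<bar>)"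
        using \<Phi>_bound[OF z(2), of _ u] unfolding z(1) by (intro AE_I2) (force intro: order_trans[OF _ abs_ge_self])
    qed
  qed
  \<comment> \<open>The parameter is integrated out first: by the uniform bound this leaves at most
    \<open>c + K * mass\<close>, and the discount makes that integrable in time and
    scenario.\<close>
  have "integrable ((lborel \<Otimes>\<^sub>M M) \<Otimes>\<^sub>M lborel) (\<lambda>(z, s). \<Phi> s z)"
  proof (rule Z'.Fubini_integrable)
    show m: "(\<lambda>(z, s). \<Phi> s z) \<in> borel_measurable ((lborel \<Otimes>\<^sub>M M) \<Otimes>\<^sub>M lborel)"
      using measurable_pair_swap[OF \<Phi>m] by (simp add: split_beta')
    show "AE z in lborel \<Otimes>\<^sub>M M. integrable lborel (\<lambda>s. case (z, s) of (z, s) \<Rightarrow> \<Phi> s z)"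
      using \<Phi>s_i by (intro AE_I2) simp
    show "integrable (lborel \<Otimes>\<^sub>M M) (\<lambda>z. \<integral>s. norm (case (z, s) of (z, s) \<Rightarrow> \<Phi> s z) \<partial>lborel)"
    proof (rule Bochner_Integration.integrable_bound[OF W(1)[OF K(2) K(1)]])
      show "(\<lambda>z. \<integral>s. norm (case (z, s) of (z, s) \<Rightarrow> \<Phi> s z) \<partial>lborel) \<in> borel_measurable (lborel \<Otimes>\<^sub>M M)"
        using m by measurable
      show "AE z in lborel \<Otimes>\<^sub>M M. norm (\<integral>s. norm (case (z, s) of (z, s) \<Rightarrow> \<Phi> s z) \<partial>lborel)
          \<le> norm (case z of (u :: real, \<omega>) \<Rightarrow> indicator {r..r + \<sigma>} u * (c + K * (mass (cut T u) \<omega> * damp \<epsilon> (cut T u) \<omega>)))"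
      proof (rule AE_I2)
        fix z :: "real \<times> 'w" assume zs: "z \<in> space (lborel \<Otimes>\<^sub>M M)"
        then obtain u \<omega> where z: "z = (u, \<omega>)" "\<omega> \<in> space M" by (auto simp: space_pair_measure)
        define d where "d = damp \<epsilon> (cut T u) \<omega>"
        have d: "0 \<le> d" "d \<le> 1" using damp_cut_bounds[OF z(2) \<epsilon>0, of "cut T u"] by (auto simp: d_def)
        have "(\<integral>s. norm (\<Phi> s z) \<partial>lborel) \<le> (\<integral>s. indicator {r..r + \<sigma>} u * d * \<bar>rate s (X (cut T u) \<omega>)\<bar> \<partial>lborel)"
          using rate_integrable[OF X_cut_Mplus[OF z(2)]] \<Phi>s_i[OF zs] \<Phi>_bound[OF z(2)]
          by (intro integral_mono integrable_norm integrable_mult_right integrable_abs) (auto simp: z(1) d_def)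
        also have "\<dots> = indicator {r..r + \<sigma>} u * d * (\<integral>s. \<bar>rate s (X (cut T u) \<omega>)\<bar> \<partial>lborel)"
          by simp
        also have "\<dots> \<le> indicator {r..r + \<sigma>} u * d * (c + K * mass (cut T u) \<omega>)"
          unfolding mass_def using d by (intro mult_left_mono Kc X_cut_Mplus z(2)) auto
        also have "\<dots> \<le> indicator {r..r + \<sigma>} u * (c + K * (mass (cut T u) \<omega> * d))"
          using d K mult_left_mono[OF d(2) K(2)] by (auto simp: algebra_simps split: split_indicator)
        finally have "(\<integral>s. norm (\<Phi> s z) \<partial>lborel) \<le> indicator {r..r + \<sigma>} u * (c + K * (mass (cut T u) \<omega> * d))" .
        moreover have "0 \<le> (\<integral>s. norm (\<Phi> s z) \<partial>lborel)" by (rule integral_nonneg_AE) simp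
        ultimately show "norm (\<integral>s. norm (case (z, s) of (z, s) \<Rightarrow> \<Phi> s z) \<partial>lborel)
          \<le> norm (case z of (u :: real, \<omega>) \<Rightarrow> indicator {r..r + \<sigma>} u * (c + K * (mass (cut T u) \<omega> * damp \<epsilon> (cut T u) \<omega>)))"
          by (simp add: z(1) d_def)
      qed
    qed
  qed
  then have \<Phi>i: "integrable (lborel \<Otimes>\<^sub>M (lborel \<Otimes>\<^sub>M M)) (\<lambda>(s, z). \<Phi> s z)"
    using Z.integrable_product_swap_iff[of "\<lambda>(s, z). \<Phi> s z"] by (simp add: split_beta')

  define w where "w = (\<lambda>z :: real \<times> 'w. case z of (u, \<omega>) \<Rightarrow> indicator {r..r + \<sigma>} u * (0 + \<epsilon> * (mass (cut T u) \<omega> * damp \<epsilon> (cut T u) \<omega>)))"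
  have wi: "integrable (lborel \<Otimes>\<^sub>M M) w"
    unfolding w_def by (rule W(1)) (use \<epsilon> in auto)
  have wI: "(\<integral>z. w z \<partial>(lborel \<Otimes>\<^sub>M M)) \<le> (\<integral>\<omega>. 1 - damp \<epsilon> T \<omega> \<partial>M)"
  proof -
    have di: "integrable M (damp \<epsilon> s)" if "0 \<le> s" for s
      by (rule integrable_const_bound[where B=1])
        (use damp_measurable[OF that] damp_cut_bounds[OF _ \<epsilon>0] in \<open>auto simp: less_imp_le\<close>)
    have "(\<integral>z. w z \<partial>(lborel \<Otimes>\<^sub>M M)) = (\<integral>\<omega>. 0 * (r + \<sigma> - r) + \<epsilon> * ((damp \<epsilon> r \<omega> - damp \<epsilon> (r + \<sigma>) \<omega>) / \<epsilon>) \<partial>M)"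
      unfolding w_def by (rule W(2)) (use \<epsilon> in auto)
    also have "\<dots> = (\<integral>\<omega>. damp \<epsilon> r \<omega> - damp \<epsilon> (r + \<sigma>) \<omega> \<partial>M)" using \<epsilon> by simp
    also have "\<dots> \<le> (\<integral>\<omega>. 1 - damp \<epsilon> T \<omega> \<partial>M)"
    proof (rule integral_mono)
      fix \<omega> assume \<omega>: "\<omega> \<in> space M"
      show "damp \<epsilon> r \<omega> - damp \<epsilon> (r + \<sigma>) \<omega> \<le> 1 - damp \<epsilon> T \<omega>"
        using damp_le_1[OF \<omega> \<epsilon>0, of r] damp_mono[OF \<omega> \<epsilon>0 r(3)] by simp
    qed (use di r T0 in auto)
    finally show ?thesis .
  qed
  have wi2: "integrable (lborel \<Otimes>\<^sub>M (lborel \<Otimes>\<^sub>M M)) (\<lambda>(s, z). indicator {0..\<sigma>} s * w z)"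
  proof (rule Z.Fubini_integrable)
    show "(\<lambda>(s, z). indicator {0..\<sigma>} s * w z) \<in> borel_measurable (lborel \<Otimes>\<^sub>M (lborel \<Otimes>\<^sub>M M))"
      using borel_measurable_integrable[OF wi] by measurable
    show "integrable lborel (\<lambda>s. \<integral>z. norm (case (s, z) of (s, z) \<Rightarrow> indicator {0..\<sigma>} s * w z) \<partial>(lborel \<Otimes>\<^sub>M M))"
      using r by (simp add: abs_mult emeasure_lborel_Icc_eq integrable_real_indicator)
  qed (use wi in auto)
  have \<Theta>_bound: "0 \<le> \<Theta> s z \<and> \<Theta> s z \<le> indicator {0..\<sigma>} s * w z" if zs: "z \<in> space (lborel \<Otimes>\<^sub>M M)" for s z
  proof -
    obtain u \<omega> where z: "z = (u, \<omega>)" "\<omega> \<in> space M" using zs by (auto simp: space_pair_measure)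
    define a where "a = \<epsilon> * mass (cut T u) \<omega> * damp \<epsilon> (cut T u) \<omega>"
    have a: "0 \<le> a" using \<epsilon> mass_nonneg[OF _ z(2), of "cut T u"] damp_pos[of \<epsilon> "cut T u" \<omega>] by (simp add: a_def)
    have "0 \<le> a * trf s (X (cut T u) \<omega>)" "a * trf s (X (cut T u) \<omega>) \<le> a"
      using a trf_bounds[OF X_cut_Mplus[OF z(2)], of s u] by (auto simp: mult_left_le)
    moreover have "\<Theta> s z = \<rho> s u * (indicator A \<omega> * (a * trf s (X (cut T u) \<omega>)))"
      by (simp add: \<Theta>_def z(1) a_def)
    moreover have "w z = indicator {r..r + \<sigma>} u * a" by (simp add: w_def z(1) a_def)
    ultimately show ?thesis using a by (auto simp: \<rho>_def split: split_indicator)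
  qed
  have \<Theta>i: "integrable (lborel \<Otimes>\<^sub>M (lborel \<Otimes>\<^sub>M M)) (\<lambda>(s, z). \<Theta> s z)"
  proof (rule Bochner_Integration.integrable_bound[OF wi2 \<Theta>m AE_I2])
    fix p :: "real \<times> real \<times> 'w" assume "p \<in> space (lborel \<Otimes>\<^sub>M (lborel \<Otimes>\<^sub>M M))"
    then obtain s z where p: "p = (s, z)" "z \<in> space (lborel \<Otimes>\<^sub>M M)" by (cases p) (auto simp: space_pair_measure)
    show "norm (case p of (s, z) \<Rightarrow> \<Theta> s z) \<le> norm (case p of (s, z) \<Rightarrow> indicator {0..\<sigma>} s * w z)"
      using \<Theta>_bound[OF p(2), of s] by (simp add: p(1))
  qed
  \<comment> \<open>The total loss over the triangle. The parameter ranges over an interval of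
    length \<open>\<sigma>\<close>, and for each value the loss in time telescopes to at most
    \<open>1 - damp \<epsilon> T\<close> in expectation.\<close>
  define J where "J = (\<integral>p. (case p of (s, z) \<Rightarrow> \<Theta> s z) \<partial>(lborel \<Otimes>\<^sub>M (lborel \<Otimes>\<^sub>M M)))"
  have J: "\<bar>J\<bar> \<le> \<sigma> * (\<integral>\<omega>. 1 - damp \<epsilon> T \<omega> \<partial>M)"
  proof -
    have "\<bar>J\<bar> \<le> (\<integral>p. \<bar>case p of (s, z) \<Rightarrow> \<Theta> s z\<bar> \<partial>(lborel \<Otimes>\<^sub>M (lborel \<Otimes>\<^sub>M M)))"
      unfolding J_def by (rule integral_abs_bound)
    also have "\<dots> \<le> (\<integral>p. (case p of (s, z) \<Rightarrow> indicator {0..\<sigma>} s * w z) \<partial>(lborel \<Otimes>\<^sub>M (lborel \<Otimes>\<^sub>M M)))"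
    proof (rule integral_mono[OF integrable_abs[OF \<Theta>i] wi2])
      fix p :: "real \<times> real \<times> 'w" assume "p \<in> space (lborel \<Otimes>\<^sub>M (lborel \<Otimes>\<^sub>M M))"
      then obtain s z where p: "p = (s, z)" "z \<in> space (lborel \<Otimes>\<^sub>M M)" by (cases p) (auto simp: space_pair_measure)
      show "\<bar>case p of (s, z) \<Rightarrow> \<Theta> s z\<bar> \<le> (case p of (s, z) \<Rightarrow> indicator {0..\<sigma>} s * w z)"
        using \<Theta>_bound[OF p(2), of s] by (simp add: p(1))
    qed
    also have "\<dots> = (\<integral>s. (\<integral>z. indicator {0..\<sigma>} s * w z \<partial>(lborel \<Otimes>\<^sub>M M)) \<partial>lborel)"
      using Z.integral_fst[OF wi2] by simp
    also have "\<dots> = \<sigma> * (\<integral>z. w z \<partial>(lborel \<Otimes>\<^sub>M M))"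
      using r by simp
    also have "\<dots> \<le> \<sigma> * (\<integral>\<omega>. 1 - damp \<epsilon> T \<omega> \<partial>M)"
      using r wI by (intro mult_left_mono) auto
    finally show ?thesis .
  qed

  have dm[measurable]: "(\<lambda>(s, t). dtrf A \<epsilon> s t) \<in> borel_measurable (borel \<Otimes>\<^sub>M borel)"
    by (rule dtrf_measurable(1)[OF A'])
  have dint: "integrable lborel (\<lambda>s. indicator {0..\<sigma>} s * f s)"
    if [measurable]: "f \<in> borel_measurable borel" and "\<And>s. \<bar>f s\<bar> \<le> 1" for f :: "real \<Rightarrow> real"
  proof (rule Bochner_Integration.integrable_bound[of _ "indicator {0..\<sigma>} :: real \<Rightarrow> real"])
    show "AE s in lborel. norm (indicator {0..\<sigma>} s * f s) \<le> norm (indicator {0..\<sigma>} s :: real)"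
      using that(2) by (auto split: split_indicator)
  qed (use r in \<open>auto simp: emeasure_lborel_Icc_eq\<close>)
  have b1: "integrable lborel (\<lambda>s. indicator {0..\<sigma>} s * dtrf A \<epsilon> s (r + \<sigma> - s))"
    and b2: "integrable lborel (\<lambda>s. indicator {0..\<sigma>} s * dtrf A \<epsilon> s r)"
    and b3: "integrable lborel (\<lambda>s. indicator {0..\<sigma>} s * dtrf A \<epsilon> 0 (r + \<sigma> - s))"
  proof -
    have m: "(\<lambda>s. dtrf A \<epsilon> (a s) (b s)) \<in> borel_measurable borel"
      if [measurable]: "a \<in> borel_measurable borel" "b \<in> borel_measurable borel" for a b
      using measurable_compose[OF measurable_Pair[OF that] dm] by simp
    show "integrable lborel (\<lambda>s. indicator {0..\<sigma>} s * dtrf A \<epsilon> s (r + \<sigma> - s))"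
      "integrable lborel (\<lambda>s. indicator {0..\<sigma>} s * dtrf A \<epsilon> s r)"
      "integrable lborel (\<lambda>s. indicator {0..\<sigma>} s * dtrf A \<epsilon> 0 (r + \<sigma> - s))"
      by (intro dint m dtrf_bounded[OF A' \<epsilon>0]; measurable)+
  qed

  have \<Phi>\<Theta>i: "integrable (lborel \<Otimes>\<^sub>M (lborel \<Otimes>\<^sub>M M)) (\<lambda>(s, z). \<Phi> s z - \<Theta> s z)"
    using Bochner_Integration.integrable_diff[OF \<Phi>i \<Theta>i] by (simp add: split_beta')
  \<comment> \<open>For fixed \<open>s\<close> the function \<open>\<psi> s\<close> is one element
    of \<open>Dminus D\<close>, and the discounted Dynkin formula applies between \<open>r\<close>
    and \<open>r + \<sigma> - s\<close>. Sections are integrable for almost every \<open>s\<close>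
    only, hence the premise.\<close>
  have in_s: "(\<integral>z. \<Phi> s z - \<Theta> s z \<partial>(lborel \<Otimes>\<^sub>M M)) = indicator {0..\<sigma>} s * (dtrf A \<epsilon> s (r + \<sigma> - s) - dtrf A \<epsilon> s r)"
    if i: "integrable (lborel \<Otimes>\<^sub>M M) (\<lambda>z. \<Phi> s z - \<Theta> s z)" for s
  proof (cases "s \<in> {0..\<sigma>}")
    case False
    then show ?thesis by (simp add: \<Phi>_def \<Theta>_def \<rho>u split_beta')
  next
    case True
    define t where "t = r + \<sigma> - s"
    have t: "r \<le> t" "0 \<le> t" "t \<le> T" "r \<le> T" "s \<in> {0..T}" using True r by (auto simp: t_def)
    have \<psi>s: "\<psi> s \<in> Dminus D" by (rule \<psi>_val[OF t(5)])
    let ?k = "\<lambda>u \<omega>. genX (\<psi> s) u \<omega> * damp \<epsilon> u \<omega> - \<epsilon> * mass u \<omega> * damp \<epsilon> u \<omega> * expX (\<psi> s) u \<omega>"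
    have eq: "\<Phi> s (u, \<omega>) - \<Theta> s (u, \<omega>) = exp (\<phi> s) * (indicator A \<omega> * (indicator {r..t} u * ?k u \<omega>))" for u \<omega>
    proof (cases "u \<in> {r..t}")
      case u: True
      then have cu: "cut T u = u" using t r by auto
      have "rate s (X u \<omega>) = F (\<psi> s) + pair (R (\<psi> s)) (X u \<omega>)" using t(5) by (simp add: rate_def R'_def)
      moreover have "\<rho> s u = 1" using u True by (auto simp: \<rho>_def t_def)
      moreover have "indicator {r..t} u = (1 :: real)" using u by simp
      ultimately show ?thesis
        by (simp add: \<Phi>_def \<Theta>_def cu trf_expX[OF t(5)] genX_def algebra_simps)
    next
      case False
      then show ?thesis by (simp add: \<Phi>_def \<Theta>_def \<rho>u t_def)
    qed
    have i': "integrable (lborel \<Otimes>\<^sub>M M) (\<lambda>(u, \<omega>). \<Phi> s (u, \<omega>) - \<Theta> s (u, \<omega>))"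
      using i by (simp add: split_beta')
    have "(\<integral>z. \<Phi> s z - \<Theta> s z \<partial>(lborel \<Otimes>\<^sub>M M)) = (\<integral>\<omega>. (\<integral>u. \<Phi> s (u, \<omega>) - \<Theta> s (u, \<omega>) \<partial>lborel) \<partial>M)"
      using Q.integral_snd[OF i'] by (simp add: split_beta')
    also have "\<dots> = exp (\<phi> s) * (\<integral>\<omega>. indicator A \<omega> * (\<integral>u\<in>{r..t}. ?k u \<omega> \<partial>lborel) \<partial>M)"
      unfolding eq set_lebesgue_integral_def by simp
    also have "(\<integral>\<omega>. indicator A \<omega> * (\<integral>u\<in>{r..t}. ?k u \<omega> \<partial>lborel) \<partial>M) =
        (\<integral>\<omega>. indicator A \<omega> * (expX (\<psi> s) t \<omega> * damp \<epsilon> t \<omega> - expX (\<psi> s) r \<omega> * damp \<epsilon> r \<omega>) \<partial>M)"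
      by (rule damped_dynkin[OF \<psi>s \<epsilon> r(1) t(1) A, symmetric])
    also have "exp (\<phi> s) * \<dots> = (\<integral>\<omega>. indicator A \<omega> * (trf s (X (cut T t) \<omega>) * damp \<epsilon> (cut T t) \<omega>)
        - indicator A \<omega> * (trf s (X (cut T r) \<omega>) * damp \<epsilon> (cut T r) \<omega>) \<partial>M)"
      unfolding integral_mult_right_zero[symmetric]
      using t r by (intro Bochner_Integration.integral_cong) (auto simp: trf_expX[OF t(5)] algebra_simps)
    also have "\<dots> = dtrf A \<epsilon> s t - dtrf A \<epsilon> s r"
      unfolding dtrf_def by (intro Bochner_Integration.integral_diff dtrf_integrable[OF A' \<epsilon>0])
    finally show ?thesis using True by (simp add: t_def)
  qed
  have lhs: "(\<integral>p. (case p of (s, z) \<Rightarrow> \<Phi> s z - \<Theta> s z) \<partial>(lborel \<Otimes>\<^sub>M (lborel \<Otimes>\<^sub>M M)))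
      = (\<integral>s. indicator {0..\<sigma>} s * (dtrf A \<epsilon> s (r + \<sigma> - s) - dtrf A \<epsilon> s r) \<partial>lborel)"
  proof -
    have "(\<integral>p. (case p of (s, z) \<Rightarrow> \<Phi> s z - \<Theta> s z) \<partial>(lborel \<Otimes>\<^sub>M (lborel \<Otimes>\<^sub>M M)))
        = (\<integral>s. (\<integral>z. \<Phi> s z - \<Theta> s z \<partial>(lborel \<Otimes>\<^sub>M M)) \<partial>lborel)"
      using Z.integral_fst[OF \<Phi>\<Theta>i] by simp
    also have "\<dots> = (\<integral>s. indicator {0..\<sigma>} s * (dtrf A \<epsilon> s (r + \<sigma> - s) - dtrf A \<epsilon> s r) \<partial>lborel)"
    proof (rule integral_cong_AE)
      show "AE s in lborel. (\<integral>z. \<Phi> s z - \<Theta> s z \<partial>(lborel \<Otimes>\<^sub>M M)) = indicator {0..\<sigma>} s * (dtrf A \<epsilon> s (r + \<sigma> - s) - dtrf A \<epsilon> s r)"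
        using Z.AE_integrable_fst[OF \<Phi>\<Theta>i] by eventually_elim (rule in_s)
      show "(\<lambda>s. indicator {0..\<sigma>} s * (dtrf A \<epsilon> s (r + \<sigma> - s) - dtrf A \<epsilon> s r)) \<in> borel_measurable lborel"
        using borel_measurable_integrable[OF Bochner_Integration.integrable_diff[OF b1 b2]]
        by (simp add: right_diff_distrib)
      show "(\<lambda>s. \<integral>z. \<Phi> s z - \<Theta> s z \<partial>(lborel \<Otimes>\<^sub>M M)) \<in> borel_measurable lborel"
        using borel_measurable_integrable[OF Z.integrable_fst[OF \<Phi>\<Theta>i]] .
    qed
    finally show ?thesis .
  qed

  \<comment> \<open>For fixed time and scenario the measure is fixed, and the Riccati equation
    evaluates the integral over the parameter.\<close>
  have in_z: "(\<integral>s. \<Phi> s (u, \<omega>) \<partial>lborel) = indicator {r..r + \<sigma>} u *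
      (indicator A \<omega> * (trf (r + \<sigma> - u) (X (cut T u) \<omega>) * damp \<epsilon> (cut T u) \<omega>)
      - indicator A \<omega> * (trf 0 (X (cut T u) \<omega>) * damp \<epsilon> (cut T u) \<omega>))" if \<omega>: "\<omega> \<in> space M" for u \<omega>
  proof (cases "u \<in> {r..r + \<sigma>}")
    case False
    then show ?thesis by (simp add: \<Phi>_def \<rho>s)
  next
    case True
    then have s: "r + \<sigma> - u \<in> {0..T}" using r by auto
    have "(\<integral>s. \<Phi> s (u, \<omega>) \<partial>lborel) = (\<integral>s. indicator A \<omega> * damp \<epsilon> (cut T u) \<omega> *
        (indicator {0..r + \<sigma> - u} s *\<^sub>R (rate s (X (cut T u) \<omega>) * trf s (X (cut T u) \<omega>))) \<partial>lborel)"
      using True by (intro Bochner_Integration.integral_cong) (auto simp: \<Phi>_def \<rho>s)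
    also have "\<dots> = indicator A \<omega> * damp \<epsilon> (cut T u) \<omega> * (trf (r + \<sigma> - u) (X (cut T u) \<omega>) - trf 0 (X (cut T u) \<omega>))"
      using trf_derivative[OF X_cut_Mplus[OF \<omega>] s] by (simp add: set_lebesgue_integral_def)
    finally show ?thesis using True by (simp add: algebra_simps)
  qed
  have rhs: "(\<integral>p. (case p of (s, z) \<Rightarrow> \<Phi> s z) \<partial>(lborel \<Otimes>\<^sub>M (lborel \<Otimes>\<^sub>M M)))
      = (\<integral>s. indicator {0..\<sigma>} s * (dtrf A \<epsilon> s (r + \<sigma> - s) - dtrf A \<epsilon> 0 (r + \<sigma> - s)) \<partial>lborel)"
  proof -
    have i: "integrable (lborel \<Otimes>\<^sub>M M) (\<lambda>(u, \<omega>). \<integral>s. \<Phi> s (u, \<omega>) \<partial>lborel)"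
      using Z.integrable_snd[OF \<Phi>i] by (simp add: split_beta')
    have "(\<integral>p. (case p of (s, z) \<Rightarrow> \<Phi> s z) \<partial>(lborel \<Otimes>\<^sub>M (lborel \<Otimes>\<^sub>M M)))
        = (\<integral>z. (\<integral>s. \<Phi> s z \<partial>lborel) \<partial>(lborel \<Otimes>\<^sub>M M))"
      using Z.integral_snd[OF \<Phi>i] by simp
    also have "\<dots> = (\<integral>u. (\<integral>\<omega>. (\<integral>s. \<Phi> s (u, \<omega>) \<partial>lborel) \<partial>M) \<partial>lborel)"
      using Q.integral_fst[OF i] by (simp add: split_beta')
    also have "\<dots> = (\<integral>u. indicator {r..r + \<sigma>} u * (dtrf A \<epsilon> (r + \<sigma> - u) u - dtrf A \<epsilon> 0 u) \<partial>lborel)"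
    proof (rule Bochner_Integration.integral_cong[OF refl])
      fix u
      have "(\<integral>\<omega>. (\<integral>s. \<Phi> s (u, \<omega>) \<partial>lborel) \<partial>M) = (\<integral>\<omega>. indicator {r..r + \<sigma>} u *
        (indicator A \<omega> * (trf (r + \<sigma> - u) (X (cut T u) \<omega>) * damp \<epsilon> (cut T u) \<omega>)
          - indicator A \<omega> * (trf 0 (X (cut T u) \<omega>) * damp \<epsilon> (cut T u) \<omega>)) \<partial>M)"
        by (rule Bochner_Integration.integral_cong) (auto simp: in_z)
      also have "\<dots> = indicator {r..r + \<sigma>} u * (dtrf A \<epsilon> (r + \<sigma> - u) u - dtrf A \<epsilon> 0 u)"
        unfolding integral_mult_right_zero dtrf_def
        using Bochner_Integration.integral_diff[OF dtrf_integrable[OF A' \<epsilon>0] dtrf_integrable[OF A' \<epsilon>0]] by simp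
      finally show "(\<integral>\<omega>. (\<integral>s. \<Phi> s (u, \<omega>) \<partial>lborel) \<partial>M) = indicator {r..r + \<sigma>} u * (dtrf A \<epsilon> (r + \<sigma> - u) u - dtrf A \<epsilon> 0 u)" .
    qed
    \<comment> \<open>The reflection \<open>u = r + \<sigma> - s\<close> parametrises this boundary
      integral by \<open>s\<close>, as in the other order of integration.\<close>
    also have "\<dots> = (\<integral>s. indicator {r..r + \<sigma>} (r + \<sigma> + (- 1) * s) * (dtrf A \<epsilon> (r + \<sigma> - (r + \<sigma> + (- 1) * s)) (r + \<sigma> + (- 1) * s)
        - dtrf A \<epsilon> 0 (r + \<sigma> + (- 1) * s)) \<partial>lborel)"
      by (subst lborel_integral_real_affine[where c="-1" and t="r + \<sigma>"]) simp_all
    also have "\<dots> = (\<integral>s. indicator {0..\<sigma>} s * (dtrf A \<epsilon> s (r + \<sigma> - s) - dtrf A \<epsilon> 0 (r + \<sigma> - s)) \<partial>lborel)"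
      by (intro Bochner_Integration.integral_cong) (auto split: split_indicator)
    finally show ?thesis .
  qed
  \<comment> \<open>The values on the hypotenuse, where parameter and time add up to
    \<open>r + \<sigma>\<close>, occur in both evaluations and cancel. What remains compares the two
    legs, up to \<open>J\<close>.\<close>
  have "(\<integral>p. (case p of (s, z) \<Rightarrow> \<Phi> s z - \<Theta> s z) \<partial>(lborel \<Otimes>\<^sub>M (lborel \<Otimes>\<^sub>M M)))
      = (\<integral>p. (case p of (s, z) \<Rightarrow> \<Phi> s z) \<partial>(lborel \<Otimes>\<^sub>M (lborel \<Otimes>\<^sub>M M))) - J"
    unfolding J_def using Bochner_Integration.integral_diff[OF \<Phi>i \<Theta>i] by (simp add: split_beta')
  then have "(\<integral>s. indicator {0..\<sigma>} s * (dtrf A \<epsilon> 0 (r + \<sigma> - s) - dtrf A \<epsilon> s r) \<partial>lborel) = - J"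
    unfolding lhs rhs right_diff_distrib
    using b1 b2 b3 by (simp add: Bochner_Integration.integral_diff)
  then show ?thesis using J by simp
qed

section \<open>Removing the discount\<close>

lemma g_Dminus: "g \<in> Dminus D"
  using \<psi>_val[of 0] \<psi>0 T_pos by auto

lemma damp_defect_tendsto_0:
  "(\<lambda>n. \<integral>\<omega>. 1 - damp (1 / real (Suc n)) T \<omega> \<partial>M) \<longlonglongrightarrow> 0"
proof -
  have "(\<lambda>n. \<integral>\<omega>. 1 - damp (1 / real (Suc n)) T \<omega> \<partial>M) \<longlonglongrightarrow> (\<integral>\<omega>. 0 \<partial>M)"
  proof (rule integral_dominated_convergence[where w="\<lambda>_. 1"])
    show "(\<lambda>\<omega>. 1 - damp (1 / real (Suc n)) T \<omega>) \<in> borel_measurable M" for n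
      using damp_measurable[OF less_imp_le[OF T_pos], of "1 / real (Suc n)"] by measurable
    show "AE \<omega> in M. norm (1 - damp (1 / real (Suc n)) T \<omega>) \<le> 1" for n
    proof (rule AE_I2)
      fix \<omega> assume "\<omega> \<in> space M"
      from damp_cut_bounds[OF this, of "1 / real (Suc n)" T]
      show "norm (1 - damp (1 / real (Suc n)) T \<omega>) \<le> 1" by simp
    qed
    have "(\<lambda>n. 1 - exp (- (1 / real (Suc n)) * c)) \<longlonglongrightarrow> 1 - exp (- 0 * c)" for c
      by (intro tendsto_intros LIMSEQ_Suc[OF lim_1_over_n])
    then show "AE \<omega> in M. (\<lambda>n. 1 - damp (1 / real (Suc n)) T \<omega>) \<longlonglongrightarrow> 0"
      by (intro AE_I2) (simp add: damp_def)
  qed auto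
  then show ?thesis by simp
qed

text \<open>\<open>trf\<close> is at most 1 and the discount decreases in time, so the discount at
  \<open>T\<close> controls all earlier ones. The bound is uniform in \<open>s\<close>,
  \<open>t\<close> and \<open>A\<close>.\<close>

lemma dtrf_undamped_diff:
  assumes A: "A \<in> sets M" and \<epsilon>: "0 \<le> \<epsilon>"
  shows "\<bar>dtrf A \<epsilon> s t - dtrf A 0 s t\<bar> \<le> (\<integral>\<omega>. 1 - damp \<epsilon> T \<omega> \<partial>M)"
proof -
  have di: "integrable M (\<lambda>\<omega>. 1 - damp \<epsilon> T \<omega>)"
    by (rule integrable_const_bound[where B=1])
      (use damp_measurable[OF less_imp_le[OF T_pos], of \<epsilon>] damp_cut_bounds[OF _ \<epsilon>, of _ T] in \<open>auto simp: less_imp_le\<close>)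
  have e: "dtrf A \<epsilon> s t - dtrf A 0 s t = (\<integral>\<omega>. indicator A \<omega> * (trf s (X (cut T t) \<omega>) * damp \<epsilon> (cut T t) \<omega>)
      - indicator A \<omega> * (trf s (X (cut T t) \<omega>) * damp 0 (cut T t) \<omega>) \<partial>M)"
    unfolding dtrf_def
    by (rule Bochner_Integration.integral_diff[symmetric]) (use dtrf_integrable[OF A] \<epsilon> in auto)
  have "\<bar>dtrf A \<epsilon> s t - dtrf A 0 s t\<bar> \<le> (\<integral>\<omega>. \<bar>indicator A \<omega> * (trf s (X (cut T t) \<omega>) * damp \<epsilon> (cut T t) \<omega>)
      - indicator A \<omega> * (trf s (X (cut T t) \<omega>) * damp 0 (cut T t) \<omega>)\<bar> \<partial>M)"
    unfolding e by (rule integral_abs_bound)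
  also have "\<dots> \<le> (\<integral>\<omega>. 1 - damp \<epsilon> T \<omega> \<partial>M)"
  proof (rule integral_mono'[OF di])
    fix \<omega> assume \<omega>: "\<omega> \<in> space M"
    note b = trf_bounds[OF X_cut_Mplus[OF \<omega>], of s t]
    have d: "damp \<epsilon> T \<omega> \<le> damp \<epsilon> (cut T t) \<omega>" using cut_mem[of t] by (intro damp_mono[OF \<omega> \<epsilon>]) auto
    have d1: "damp \<epsilon> (cut T t) \<omega> \<le> 1" "damp \<epsilon> T \<omega> \<le> 1" by (rule damp_le_1[OF \<omega> \<epsilon>])+
    show "0 \<le> 1 - damp \<epsilon> T \<omega>" using d1 by simp
    define p q where "p = trf s (X (cut T t) \<omega>)" and "q = damp \<epsilon> (cut T t) \<omega>"
    have pq: "0 < p" "p \<le> 1" "q \<le> 1" "damp \<epsilon> T \<omega> \<le> q"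
      using b d d1 by (simp_all only: p_def q_def)
    have "p * (1 - q) \<le> 1 * (1 - damp \<epsilon> T \<omega>)"
      using pq by (intro mult_mono) auto
    moreover have "0 \<le> p * (1 - q)" using pq by simp
    ultimately have "p * (1 - q) \<le> 1 - damp \<epsilon> T \<omega>" "0 \<le> p * (1 - q)" by simp_all
    then have pq1: "\<bar>p * q - p * 1\<bar> \<le> 1 - damp \<epsilon> T \<omega>"
      unfolding right_diff_distrib by linarith
    have damp0: "damp 0 (cut T t) \<omega> = 1" by (simp add: damp_def)
    show "\<bar>indicator A \<omega> * (trf s (X (cut T t) \<omega>) * damp \<epsilon> (cut T t) \<omega>)
      - indicator A \<omega> * (trf s (X (cut T t) \<omega>) * damp 0 (cut T t) \<omega>)\<bar> \<le> 1 - damp \<epsilon> T \<omega>"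
      unfolding damp0 p_def[symmetric] q_def[symmetric]
    proof (cases "\<omega> \<in> A")
      case True
      then have "indicator A \<omega> = (1 :: real)" by simp
      with pq1 show "\<bar>indicator A \<omega> * (p * q) - indicator A \<omega> * (p * 1)\<bar> \<le> 1 - damp \<epsilon> T \<omega>"
        by (simp only: mult_1)
    next
      case False
      then have "indicator A \<omega> = (0 :: real)" by simp
      with d1(2) show "\<bar>indicator A \<omega> * (p * q) - indicator A \<omega> * (p * 1)\<bar> \<le> 1 - damp \<epsilon> T \<omega>"
        by simp
    qed
  qed
  finally show ?thesis .
qed

lemma dtrf_continuous_fst:
  assumes A: "A \<in> sets M"
  shows "continuous_on UNIV (\<lambda>s. dtrf A 0 s t)"
  unfolding dtrf_def
proof (rule continuous_on_expectation[where C=1])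
  show "continuous_on UNIV (\<lambda>s. indicator A \<omega> * (trf s (X (cut T t) \<omega>) * damp 0 (cut T t) \<omega>))" if "\<omega> \<in> space M" for \<omega>
    by (intro continuous_intros trf_continuous X_cut_Mplus that)
qed (use dtrf_measurable(2)[OF A] dtrf_integrand_bounds(2) in auto)

text \<open>Right-continuity of the paths does not suffice here: the right end point \<open>T\<close> has to be
  reached, so the expectation must be shown to have no jump there.\<close>

lemma dtrf_continuous_snd:
  assumes A: "A \<in> sets (Fl r)" and r: "0 \<le> r"
  shows "continuous_on {r..T} (\<lambda>t. dtrf A 0 0 t)"
proof -
  have A': "A \<in> sets M" using A subalgebra_Fl by (auto simp: subalgebra_def)
  have cont: "continuous_on {r..T} (\<lambda>t. dtrf A \<epsilon> 0 t)" if \<epsilon>: "0 < \<epsilon>" for \<epsilon>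
  proof -
    have \<epsilon>0: "0 \<le> \<epsilon>" using \<epsilon> by simp
    obtain B where B: "0 \<le> B" "\<And>u \<omega>. \<omega> \<in> space M \<Longrightarrow> 0 \<le> u \<Longrightarrow>
        \<bar>genX g u \<omega> * damp \<epsilon> u \<omega>\<bar> \<le> \<bar>F g\<bar> + B * (mass u \<omega> * damp \<epsilon> u \<omega>)"
      using genX_damp_bound[OF g_Dminus \<epsilon>] by metis
    let ?V = "\<lambda>t. \<integral>\<omega>. damp \<epsilon> t \<omega> \<partial>M"
    have di: "integrable M (damp \<epsilon> s)" if "0 \<le> s" for s
      by (rule integrable_const_bound[where B=1])
        (use damp_measurable[OF that] damp_cut_bounds[OF _ \<epsilon>0] in \<open>auto simp: less_imp_le\<close>)
    have Vc: "continuous_on {r..T} ?V"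
    proof (rule continuous_on_expectation[where C=1])
      show "continuous_on {r..T} (\<lambda>t. damp \<epsilon> t \<omega>)" if "\<omega> \<in> space M" for \<omega>
        using damp_continuous[OF that, of T \<epsilon>] by (rule continuous_on_subset) (use r in auto)
      show "\<bar>damp \<epsilon> t \<omega>\<bar> \<le> 1" if "\<omega> \<in> space M" for t \<omega>
        using damp_cut_bounds[OF that \<epsilon>0, of t] by simp
    qed (use damp_measurable r in auto)
    \<comment> \<open>The drift of the discounted exponential is at most
      \<open>\<bar>F g\<bar> + (B + \<epsilon>) * (mass * damp)\<close>, and
      \<open>mass * damp\<close> integrates to the decrease of the discount divided by
      \<open>\<epsilon>\<close>. Up to a constant, \<open>h\<close> is the expected primitive of
      this bound.\<close>
    define h where "h = (\<lambda>t. \<bar>F g\<bar> * t - (B + \<epsilon>) / \<epsilon> * ?V t)"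
    show ?thesis
    proof (rule continuous_on_dominated_increments[of _ h])
      show "continuous_on {r..T} h" unfolding h_def by (intro continuous_intros Vc)
      fix x y assume xy: "x \<in> {r..T}" "y \<in> {r..T}" "x \<le> y"
      then have x0: "0 \<le> x" "0 \<le> y" using r by auto
      have Ax: "A \<in> sets (Fl x)" using A Fl_mono[of r x] xy by auto
      let ?k = "\<lambda>u \<omega>. genX g u \<omega> * damp \<epsilon> u \<omega> - \<epsilon> * mass u \<omega> * damp \<epsilon> u \<omega> * expX g u \<omega>"
      have cx: "cut T x = x" "cut T y = y" using xy r by auto
      have "dtrf A \<epsilon> 0 y - dtrf A \<epsilon> 0 x = (\<integral>\<omega>. indicator A \<omega> * (trf 0 (X (cut T y) \<omega>) * damp \<epsilon> (cut T y) \<omega>)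
          - indicator A \<omega> * (trf 0 (X (cut T x) \<omega>) * damp \<epsilon> (cut T x) \<omega>) \<partial>M)"
        unfolding dtrf_def
        by (rule Bochner_Integration.integral_diff[symmetric]) (rule dtrf_integrable[OF A' \<epsilon>0])+
      also have "\<dots> = (\<integral>\<omega>. indicator A \<omega> * (expX g y \<omega> * damp \<epsilon> y \<omega> - expX g x \<omega> * damp \<epsilon> x \<omega>) \<partial>M)"
        unfolding cx trf_0 expX_def by (simp add: right_diff_distrib)
      also have "\<dots> = (\<integral>\<omega>. indicator A \<omega> * (\<integral>u\<in>{x..y}. ?k u \<omega> \<partial>lborel) \<partial>M)"
        by (rule damped_dynkin[OF g_Dminus \<epsilon> x0(1) xy(3) Ax])
      finally have e: "dtrf A \<epsilon> 0 y - dtrf A \<epsilon> 0 x = (\<integral>\<omega>. indicator A \<omega> * (\<integral>u\<in>{x..y}. ?k u \<omega> \<partial>lborel) \<partial>M)" .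
      have "\<bar>dtrf A \<epsilon> 0 y - dtrf A \<epsilon> 0 x\<bar> \<le> (\<integral>\<omega>. \<bar>indicator A \<omega> * (\<integral>u\<in>{x..y}. ?k u \<omega> \<partial>lborel)\<bar> \<partial>M)"
        unfolding e by (rule integral_abs_bound)
      also have "\<dots> \<le> (\<integral>\<omega>. \<bar>F g\<bar> * (y - x) + (B + \<epsilon>) * ((damp \<epsilon> x \<omega> - damp \<epsilon> y \<omega>) / \<epsilon>) \<partial>M)"
      proof (rule integral_mono')
        show "integrable M (\<lambda>\<omega>. \<bar>F g\<bar> * (y - x) + (B + \<epsilon>) * ((damp \<epsilon> x \<omega> - damp \<epsilon> y \<omega>) / \<epsilon>))"
          using di x0 by simp
        fix \<omega> assume \<omega>: "\<omega> \<in> space M"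
        show nn: "0 \<le> \<bar>F g\<bar> * (y - x) + (B + \<epsilon>) * ((damp \<epsilon> x \<omega> - damp \<epsilon> y \<omega>) / \<epsilon>)"
          using xy B(1) \<epsilon> damp_mono[OF \<omega> \<epsilon>0 xy(3)] by simp
        have md: "set_integrable lborel {x..y} (\<lambda>u. mass u \<omega> * damp \<epsilon> u \<omega>)"
          using x0 by (intro set_integrable_subset[OF mass_damp_integral(1)[OF \<omega> \<epsilon>, of y]]) auto
        have cc: "set_integrable lborel {x..y} (\<lambda>u. \<bar>F g\<bar>)"
          using xy by (auto simp: set_integrable_def emeasure_lborel_Icc_eq intro!: integrable_real_indicator)
        have bnd: "set_integrable lborel {x..y} (\<lambda>u. \<bar>F g\<bar> + (B + \<epsilon>) * (mass u \<omega> * damp \<epsilon> u \<omega>))"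
          by (intro set_integral_add(1) set_integrable_mult_right md cc)
        have k: "\<bar>?k u \<omega>\<bar> \<le> \<bar>F g\<bar> + (B + \<epsilon>) * (mass u \<omega> * damp \<epsilon> u \<omega>)" if "u \<in> {x..y}" for u
        proof -
          have u: "0 \<le> u" using that x0 by auto
          define a where "a = mass u \<omega> * damp \<epsilon> u \<omega>"
          have a: "0 \<le> a" using mass_nonneg[OF u \<omega>] damp_pos[of \<epsilon> u \<omega>] by (simp add: a_def)
          have "\<bar>\<epsilon> * a * expX g u \<omega>\<bar> \<le> \<epsilon> * a"
            using a \<epsilon> expX_bounds[OF g_Dminus u \<omega>] by (simp add: abs_mult mult_left_le)
          moreover have "\<bar>genX g u \<omega> * damp \<epsilon> u \<omega>\<bar> \<le> \<bar>F g\<bar> + B * a" unfolding a_def by (rule B(2)[OF \<omega> u])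
          moreover have "\<epsilon> * mass u \<omega> * damp \<epsilon> u \<omega> * expX g u \<omega> = \<epsilon> * a * expX g u \<omega>" by (simp add: a_def)
          ultimately have "\<bar>?k u \<omega>\<bar> \<le> \<bar>F g\<bar> + B * a + \<epsilon> * a" by linarith
          then show ?thesis by (simp add: a_def algebra_simps)
        qed
        have "\<bar>\<integral>u\<in>{x..y}. ?k u \<omega> \<partial>lborel\<bar> \<le> (\<integral>u. \<bar>indicator {x..y} u *\<^sub>R ?k u \<omega>\<bar> \<partial>lborel)"
          unfolding set_lebesgue_integral_def by (rule integral_abs_bound)
        also have "\<dots> \<le> (\<integral>u\<in>{x..y}. \<bar>F g\<bar> + (B + \<epsilon>) * (mass u \<omega> * damp \<epsilon> u \<omega>) \<partial>lborel)"
          unfolding set_lebesgue_integral_def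
          by (rule integral_mono'[OF bnd[unfolded set_integrable_def]])
            (use k order_trans[OF abs_ge_zero k] in \<open>auto split: split_indicator\<close>)
        also have "\<dots> = (\<integral>u\<in>{x..y}. \<bar>F g\<bar> \<partial>lborel) + (\<integral>u\<in>{x..y}. (B + \<epsilon>) * (mass u \<omega> * damp \<epsilon> u \<omega>) \<partial>lborel)"
          by (intro set_integral_add(2) set_integrable_mult_right md cc)
        also have "(\<integral>u\<in>{x..y}. \<bar>F g\<bar> \<partial>lborel) = \<bar>F g\<bar> * (y - x)"
          using xy by (simp add: set_lebesgue_integral_def)
        also have "(\<integral>u\<in>{x..y}. (B + \<epsilon>) * (mass u \<omega> * damp \<epsilon> u \<omega>) \<partial>lborel) = (B + \<epsilon>) * (\<integral>u\<in>{x..y}. mass u \<omega> * damp \<epsilon> u \<omega> \<partial>lborel)"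
          by (rule set_integral_mult_right)
        also have "(\<integral>u\<in>{x..y}. mass u \<omega> * damp \<epsilon> u \<omega> \<partial>lborel) = (damp \<epsilon> x \<omega> - damp \<epsilon> y \<omega>) / \<epsilon>"
          unfolding set_integral_Icc_split[OF x0(1) xy(3) mass_damp_integral(1)[OF \<omega> \<epsilon>]] mass_damp_integral(2)[OF \<omega> \<epsilon>]
          by (simp add: diff_divide_distrib)
        finally show "\<bar>indicator A \<omega> * (\<integral>u\<in>{x..y}. ?k u \<omega> \<partial>lborel)\<bar> \<le> \<bar>F g\<bar> * (y - x) + (B + \<epsilon>) * ((damp \<epsilon> x \<omega> - damp \<epsilon> y \<omega>) / \<epsilon>)"
          using nn by (auto split: split_indicator)
      qed
      also have "\<dots> = h y - h x"
        using di x0 by (simp add: h_def prob_space algebra_simps diff_divide_distrib)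
      finally show "\<bar>dtrf A \<epsilon> 0 y - dtrf A \<epsilon> 0 x\<bar> \<le> h y - h x" .
    qed
  qed
  show ?thesis
  \<comment> \<open>The discounted functions are continuous and converge uniformly in
    \<open>t\<close> as the discount is removed.\<close>
  proof (rule uniform_limit_theorem[where F=sequentially and f="\<lambda>n t. dtrf A (1 / real (Suc n)) 0 t"])
    show "uniform_limit {r..T} (\<lambda>n t. dtrf A (1 / real (Suc n)) 0 t) (\<lambda>t. dtrf A 0 0 t) sequentially"
    proof (rule uniform_limitI)
      fix e :: real assume "0 < e"
      have "eventually (\<lambda>n. (\<integral>\<omega>. 1 - damp (1 / real (Suc n)) T \<omega> \<partial>M) < e) sequentially"
        using damp_defect_tendsto_0 \<open>0 < e\<close> by (rule order_tendstoD)
      then show "\<forall>\<^sub>F n in sequentially. \<forall>t\<in>{r..T}. dist (dtrf A (1 / real (Suc n)) 0 t) (dtrf A 0 0 t) < e"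
      proof eventually_elim
        case (elim n)
        show ?case
        proof
          fix t
          have "\<bar>dtrf A (1 / real (Suc n)) 0 t - dtrf A 0 0 t\<bar> \<le> (\<integral>\<omega>. 1 - damp (1 / real (Suc n)) T \<omega> \<partial>M)"
            by (rule dtrf_undamped_diff[OF A']) simp
          then show "dist (dtrf A (1 / real (Suc n)) 0 t) (dtrf A 0 0 t) < e"
            using elim by (simp add: dist_real_def)
        qed
      qed
    qed
  qed (use cont in auto)
qed

text \<open>The limit of \<open>triangle_balance\<close> as the discount disappears. Reflecting the
  first term makes both terms refer to increasing \<open>s\<close>, so the integrand does not depend
  on \<open>\<sigma>\<close> and the upper limit can be varied.\<close>

lemma dtrf_triangle_zero:
  assumes A: "A \<in> sets (Fl r)" and r: "0 \<le> r" "0 \<le> \<sigma>" "r + \<sigma> \<le> T"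
  shows "(\<integral>s\<in>{0..\<sigma>}. dtrf A 0 0 (r + s) - dtrf A 0 s r \<partial>lborel) = 0"
proof -
  have A': "A \<in> sets M" using A subalgebra_Fl by (auto simp: subalgebra_def)
  note dm = dtrf_measurable(1)[OF A']
  have m: "(\<lambda>s. dtrf A \<epsilon> (a s) (b s)) \<in> borel_measurable borel"
    if "a \<in> borel_measurable borel" "b \<in> borel_measurable borel" for a b \<epsilon>
    using measurable_compose[OF measurable_Pair[OF that] dm] by simp
  have dint: "integrable lborel (\<lambda>s. indicator {0..\<sigma>} s * dtrf A \<epsilon> (a s) (b s))"
    if "a \<in> borel_measurable borel" "b \<in> borel_measurable borel" "0 \<le> \<epsilon>" for a b \<epsilon>
  proof (rule Bochner_Integration.integrable_bound[of _ "indicator {0..\<sigma>} :: real \<Rightarrow> real"])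
    show "AE s in lborel. norm (indicator {0..\<sigma>} s * dtrf A \<epsilon> (a s) (b s)) \<le> norm (indicator {0..\<sigma>} s :: real)"
      using dtrf_bounded[OF A' that(3)] by (auto split: split_indicator)
    show "(\<lambda>s. indicator {0..\<sigma>} s * dtrf A \<epsilon> (a s) (b s)) \<in> borel_measurable lborel"
      using m[OF that(1,2), of \<epsilon>] by measurable
  qed (use r in \<open>auto simp: emeasure_lborel_Icc_eq\<close>)
  have di: "integrable lborel (\<lambda>s. indicator {0..\<sigma>} s * (dtrf A \<epsilon> 0 (r + \<sigma> - s) - dtrf A \<epsilon> s r))" if "0 \<le> \<epsilon>" for \<epsilon>
    unfolding right_diff_distrib using that by (intro Bochner_Integration.integrable_diff dint) auto
  define I where "I = (\<lambda>\<epsilon>. \<integral>s. indicator {0..\<sigma>} s * (dtrf A \<epsilon> 0 (r + \<sigma> - s) - dtrf A \<epsilon> s r) \<partial>lborel)"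
  \<comment> \<open>Removing the discount from the two terms costs two defects, and the balance
    itself a third one.\<close>
  have I0: "\<bar>I 0\<bar> \<le> 3 * \<sigma> * (\<integral>\<omega>. 1 - damp \<epsilon> T \<omega> \<partial>M)" if \<epsilon>: "0 < \<epsilon>" for \<epsilon>
  proof -
    define \<delta> where "\<delta> = (\<integral>\<omega>. 1 - damp \<epsilon> T \<omega> \<partial>M)"
    have \<epsilon>0: "0 \<le> \<epsilon>" using \<epsilon> by simp
    have "\<bar>I 0 - I \<epsilon>\<bar> = \<bar>\<integral>s. indicator {0..\<sigma>} s * (dtrf A 0 0 (r + \<sigma> - s) - dtrf A 0 s r)
        - indicator {0..\<sigma>} s * (dtrf A \<epsilon> 0 (r + \<sigma> - s) - dtrf A \<epsilon> s r) \<partial>lborel\<bar>"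
      unfolding I_def using di[of 0] di[OF \<epsilon>0] by simp
    also have "\<dots> \<le> (\<integral>s. \<bar>indicator {0..\<sigma>} s * (dtrf A 0 0 (r + \<sigma> - s) - dtrf A 0 s r)
        - indicator {0..\<sigma>} s * (dtrf A \<epsilon> 0 (r + \<sigma> - s) - dtrf A \<epsilon> s r)\<bar> \<partial>lborel)"
      by (rule integral_abs_bound)
    also have "\<dots> \<le> (\<integral>s. indicator {0..\<sigma>} s * (2 * \<delta>) \<partial>lborel)"
    proof (rule integral_mono)
      show "integrable lborel (\<lambda>s. indicator {0..\<sigma>} s * (2 * \<delta>))"
        by (auto simp: emeasure_lborel_Icc_eq r intro!: integrable_real_indicator)
      show "\<bar>indicator {0..\<sigma>} s * (dtrf A 0 0 (r + \<sigma> - s) - dtrf A 0 s r)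
        - indicator {0..\<sigma>} s * (dtrf A \<epsilon> 0 (r + \<sigma> - s) - dtrf A \<epsilon> s r)\<bar> \<le> indicator {0..\<sigma>} s * (2 * \<delta>)" for s
        using dtrf_undamped_diff[OF A' \<epsilon>0, of 0 "r + \<sigma> - s"] dtrf_undamped_diff[OF A' \<epsilon>0, of s r]
        unfolding \<delta>_def[symmetric] by (auto split: split_indicator)
    qed (use di[of 0] di[OF \<epsilon>0] in auto)
    also have "\<dots> = 2 * \<sigma> * \<delta>" using r by simp
    finally have "\<bar>I 0 - I \<epsilon>\<bar> \<le> 2 * \<sigma> * \<delta>" .
    moreover have "\<bar>I \<epsilon>\<bar> \<le> \<sigma> * \<delta>"
      unfolding I_def \<delta>_def by (rule triangle_balance[OF A r \<epsilon>])
    ultimately show ?thesis unfolding \<delta>_def[symmetric] by linarith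
  qed
  have "(\<lambda>n. 3 * \<sigma> * (\<integral>\<omega>. 1 - damp (1 / real (Suc n)) T \<omega> \<partial>M)) \<longlonglongrightarrow> 3 * \<sigma> * 0"
    by (intro tendsto_mult tendsto_const damp_defect_tendsto_0)
  then have "\<bar>I 0\<bar> \<le> 3 * \<sigma> * 0"
    by (rule LIMSEQ_le_const) (use I0 in auto)
  then have "I 0 = 0" by simp
  have i1: "integrable lborel (\<lambda>s. indicator {0..\<sigma>} s * dtrf A 0 0 (r + \<sigma> - s))"
    and i2: "integrable lborel (\<lambda>s. indicator {0..\<sigma>} s * dtrf A 0 s r)"
    and i3: "integrable lborel (\<lambda>s. indicator {0..\<sigma>} s * dtrf A 0 0 (r + s))"
    by (rule dint; simp)+
  have "(\<integral>s. indicator {0..\<sigma>} s * dtrf A 0 0 (r + s) \<partial>lborel) = (\<integral>s. indicator {0..\<sigma>} (\<sigma> + (- 1) * s) * dtrf A 0 0 (r + (\<sigma> + (- 1) * s)) \<partial>lborel)"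
    by (subst lborel_integral_real_affine[where c="-1" and t="\<sigma>"]) simp_all
  also have "\<dots> = (\<integral>s. indicator {0..\<sigma>} s * dtrf A 0 0 (r + \<sigma> - s) \<partial>lborel)"
    by (intro Bochner_Integration.integral_cong) (auto simp: algebra_simps split: split_indicator)
  finally have "(\<integral>s\<in>{0..\<sigma>}. dtrf A 0 0 (r + s) - dtrf A 0 s r \<partial>lborel) = I 0"
    unfolding I_def set_lebesgue_integral_def real_scaleR_def right_diff_distrib using i1 i2 i3 by simp
  with \<open>I 0 = 0\<close> show ?thesis by simp
qed

text \<open>Every triangle of size up to \<open>T - r\<close> balances, so the continuous integrand
  vanishes on all of \<open>[0, T - r]\<close>; the claim is its value at the right end
  point.\<close>

lemma dtrf_transport:
  assumes A: "A \<in> sets (Fl r)" and r: "0 \<le> r" "r \<le> T"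
  shows "dtrf A 0 0 T = dtrf A 0 (T - r) r"
proof (cases "r = T")
  case False
  then have "0 < T - r" using r by simp
  have A': "A \<in> sets M" using A subalgebra_Fl by (auto simp: subalgebra_def)
  have "dtrf A 0 0 (r + (T - r)) - dtrf A 0 (T - r) r = 0"
  proof (rule set_integral_zero_imp_zero[where c="\<lambda>s. dtrf A 0 0 (r + s) - dtrf A 0 s r", OF _ \<open>0 < T - r\<close>])
    show "continuous_on {0..T - r} (\<lambda>s. dtrf A 0 0 (r + s) - dtrf A 0 s r)"
    proof (intro continuous_intros)
      show "continuous_on {0..T - r} (\<lambda>s. dtrf A 0 0 (r + s))"
        by (rule continuous_on_compose2[OF dtrf_continuous_snd[OF A r(1)]]) (auto intro!: continuous_intros)
      show "continuous_on {0..T - r} (\<lambda>s. dtrf A 0 s r)"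
        by (rule continuous_on_subset[OF dtrf_continuous_fst[OF A']]) simp
    qed
    show "(\<integral>u\<in>{0..x}. dtrf A 0 0 (r + u) - dtrf A 0 u r \<partial>lborel) = 0" if "x \<in> {0..T - r}" for x
      by (rule dtrf_triangle_zero[OF A r(1)]) (use that in auto)
  qed (use r in auto)
  then show ?thesis by simp
qed simp

text \<open>A conditional expectation is characterised by its integrals over the sets
  \<open>A\<close> of \<open>Fl r\<close>. For the two sides these are \<open>dtrf A 0 0 T\<close>
  and \<open>dtrf A 0 (T - r) r\<close>.\<close>

lemma affine_transform_formula:
  assumes r: "r \<in> {0..T}"
  shows "AE \<omega> in M. real_cond_exp M (Fl r) (\<lambda>\<omega>'. exp (pair g (X T \<omega>'))) \<omega>
    = exp (\<phi> (T - r) + pair (\<psi> (T - r)) (X r \<omega>))"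
proof -
  have r': "0 \<le> r" "r \<le> T" "T - r \<in> {0..T}" using r by auto
  interpret fs: finite_measure_subalgebra M "Fl r"
    by unfold_locales (rule subalgebra_Fl)
  have damp0: "damp 0 t \<omega> = 1" for t \<omega> by (simp add: damp_def)
  have cT: "cut T T = T" and cr: "cut T r = r" using r' by auto
  have trf_r: "trf (T - r) (X r \<omega>) = exp (\<phi> (T - r) + pair (\<psi> (T - r)) (X r \<omega>))" for \<omega>
    using r' by (simp add: trf_def)
  have int: "integrable M (\<lambda>\<omega>. trf s (X (cut T t) \<omega>))" for s t
  proof -
    have "integrable M (\<lambda>\<omega>. indicator (space M) \<omega> * (trf s (X (cut T t) \<omega>) * damp 0 (cut T t) \<omega>))"
      by (rule dtrf_integrable) auto
    then show ?thesis
      by (rule Bochner_Integration.integrable_cong[THEN iffD1, OF refl, rotated]) (simp add: damp0)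
  qed
  show ?thesis unfolding trf_r[symmetric]
  proof (rule fs.real_cond_exp_charact)
    show "integrable M (\<lambda>\<omega>'. exp (pair g (X T \<omega>')))" using int[of 0 T] unfolding cT trf_0 .
    show "integrable M (\<lambda>\<omega>. trf (T - r) (X r \<omega>))" using int[of "T - r" r] unfolding cr .
    have "(\<lambda>\<omega>. exp (\<phi> (T - r)) * expX (\<psi> (T - r)) r \<omega>) \<in> borel_measurable (Fl r)"
      using expX_measurable_Fl[OF \<psi>_val[OF r'(3)] r'(1)] by measurable
    then show "(\<lambda>\<omega>. trf (T - r) (X r \<omega>)) \<in> borel_measurable (Fl r)"
      unfolding trf_expX[OF r'(3)] .
    fix A assume "A \<in> sets (Fl r)"
    from dtrf_transport[OF this r'(1,2)]
    show "(\<integral>\<omega>\<in>A. exp (pair g (X T \<omega>)) \<partial>M) = (\<integral>\<omega>\<in>A. trf (T - r) (X r \<omega>) \<partial>M)"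
      unfolding dtrf_def damp0 cT cr trf_0 by (simp add: set_lebesgue_integral_def)
  qed
qed

end

theorem theorem6p6:
  fixes D :: "('e::polish_space option \<Rightarrow> real) set"
    and L :: "('e dmeas \<Rightarrow> real) \<Rightarrow> ('e dmeas \<Rightarrow> real)"
    and F :: "('e option \<Rightarrow> real) \<Rightarrow> real"
    and R :: "('e option \<Rightarrow> real) \<Rightarrow> ('e option \<Rightarrow> real)"
    and M :: "'w measure" and Fl :: "real \<Rightarrow> 'w measure"
    and X :: "real \<Rightarrow> 'w \<Rightarrow> 'e dmeas"
    and g :: "'e option \<Rightarrow> real" and \<psi> :: "real \<Rightarrow> 'e option \<Rightarrow> real" and T :: real
  assumes E_lc: "locally_compact_space (euclidean :: 'e topology)"
    and D: "dense_subspace D"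
    and L_lin: "linear_on_Dom D L"
    and L_aff: "affine_type D L F R"
    and P: "prob_space M"
    and filt: "filtration_on M Fl"
    and sol: "mp_solution D L M Fl X"
    and g: "g \<in> Dminus D"
    and \<psi>_val: "\<forall>t\<in>{0..T}. \<psi> t \<in> Dminus D"
    and \<psi>0: "\<psi> 0 = g"
    and \<psi>_int: "\<forall>\<nu>\<in>Mplus_Delta. \<forall>t\<in>{0<..T}.
                  set_integrable lborel {0..t} (\<lambda>s. pair (R (\<psi> s)) \<nu>)"
    and \<psi>_ode: "\<forall>\<nu>\<in>Mplus_Delta. \<forall>t\<in>{0<..T}.
                  pair (\<psi> t) \<nu> = pair g \<nu> + (\<integral>s\<in>{0..t}. pair (R (\<psi> s)) \<nu> \<partial>lborel)"
    and \<phi>_int: "\<forall>t\<in>{0..T}. set_integrable lborel {0..t} (\<lambda>s. F (\<psi> s))"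
    and \<phi>_neg: "\<forall>t\<in>{0..T}. (\<integral>s\<in>{0..t}. F (\<psi> s) \<partial>lborel) \<le> 0"
  shows "\<forall>t\<in>{0..T}. AE \<omega> in M.
           real_cond_exp M (Fl t) (\<lambda>\<omega>'. exp (pair g (X T \<omega>'))) \<omega>
             = exp ((\<integral>s\<in>{0..T - t}. F (\<psi> s) \<partial>lborel) + pair (\<psi> (T - t)) (X t \<omega>))"
proof -
  interpret S: affine_solution D L F R M Fl X
    by (rule affine_solution.intro) fact+
  show ?thesis
  proof (cases "0 < T")
    case True
    interpret affine_riccati D L F R M Fl X g \<psi> T
      by (intro affine_riccati.intro affine_riccati_axioms.intro S.affine_solution_axioms)
        (use True \<psi>_val \<psi>0 \<psi>_int \<psi>_ode \<phi>_int \<phi>_neg in auto)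
    show ?thesis using affine_transform_formula by (simp add: \<phi>_def)
  next
    \<comment> \<open>For negative \<open>T\<close> the range of \<open>t\<close> is empty. For
      \<open>T = 0\<close> the only time is 0, and a bounded variable measurable at time 0 is its
      own conditional expectation.\<close>
    case False
    show ?thesis
    proof
      fix t assume "t \<in> {0..T}"
      then have t: "t = 0" "T = 0" using False by auto
      interpret fs: finite_measure_subalgebra M "Fl 0"
        by unfold_locales (rule S.subalgebra_Fl)
      have m: "(\<lambda>\<omega>. exp (pair g (X 0 \<omega>))) \<in> borel_measurable (Fl 0)"
        using S.expX_measurable_Fl[OF g order_refl] by (simp add: S.expX_def[abs_def])
      have "integrable M (\<lambda>\<omega>. exp (pair g (X 0 \<omega>)))"
      proof (rule S.integrable_const_bound[where B=1])
        show "AE \<omega> in M. norm (exp (pair g (X 0 \<omega>))) \<le> 1"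
          using S.expX_bounds(3)[OF g order_refl] by (intro AE_I2) (simp add: S.expX_def)
        show "(\<lambda>\<omega>. exp (pair g (X 0 \<omega>))) \<in> borel_measurable M"
          by (rule measurable_from_subalg[OF S.subalgebra_Fl m])
      qed
      then have "AE \<omega> in M. real_cond_exp M (Fl 0) (\<lambda>\<omega>'. exp (pair g (X 0 \<omega>'))) \<omega> = exp (pair g (X 0 \<omega>))"
        by (rule fs.real_cond_exp_F_meas[OF _ m])
      then show "AE \<omega> in M. real_cond_exp M (Fl t) (\<lambda>\<omega>'. exp (pair g (X T \<omega>'))) \<omega>
          = exp ((\<integral>s\<in>{0..T - t}. F (\<psi> s) \<partial>lborel) + pair (\<psi> (T - t)) (X t \<omega>))"
        by (simp add: t \<psi>0 set_integral_singleton)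
    qed
  qed
qed

end
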